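(* Suppose $h\in\mathbb{R}[x_1,\ldots,x_n]$ is hyperbolic with respect to $\mathbf{e}$. Let $\mathsf{X}_1,\ldots,\mathsf{X}_m$ be independent random vectors in $\Lambda_+(\mathbf{e})$ of rank at most one and with finite supports such that $\mathbb{E}\sum_{i=1}^m\mathsf{X}_i=\mathbf{e}$ and $\operatorname{tr}(\mathbb{E}\mathsf{X}_i)\leq\epsilon$ for all $1\leq i\leq m$. Then $$\mathbb{P}\Big[\lambda_{\max}\Big(\sum_{i=1}^m\mathsf{X}_i\Big)\leq\delta(\epsilon,m)\Big]>0,$$ where $\delta(\epsilon,m):=\Big(1-\frac1m+\sqrt{\epsilon-\frac1m\big(1-\frac1m\big)}\Big)^2$.
   Context: A homogeneous polynomial $h$ of degree $d$ is hyperbolic with respect to $\mathbf{e}\in\mathbb{R}^n$ if $h(\mathbf{e})\neq0$ and for every $\mathbf{x}$, $t\mapsto h(t\mathbf{e}-\mathbf{x})$ has only real zeros; writing $h(t\mathbf{e}-\mathbf{x})=h(\mathbf{e})\prod_{j=1}^d(t-\lambda_j(\mathbf{x}))$ with $\lambda_1(\mathbf{x})\geq\cdots\geq\lambda_d(\mathbf{x})$ defines the eigenvalues; $\lambda_{\max}=\lambda_1$. $\Lambda_+(\mathbf{e})=\{\mathbf{x}:\lambda_d(\mathbf{x})\geq0\}$, $\operatorname{tr}(\mathbf{x})=\sum_j\lambda_j(\mathbf{x})$, $\operatorname{rk}(\mathbf{x})=\#\{j:\lambda_j(\mathbf{x})\neq0\}$. *)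

theory Defs
  imports "HOL-Analysis.Analysis" "HOL-Probability.Probability"
begin

text \<open>A polynomial in the variables x_i (i :: 'n) with real coefficients is represented by its
  coefficient function c, mapping exponent vectors alpha :: 'n => nat to reals, with finite
  support. It can be evaluated at vectors over any real algebra (in particular over the
  reals and over the complex numbers).\<close>

definition poly_support :: "(('n::finite \<Rightarrow> nat) \<Rightarrow> real) \<Rightarrow> ('n \<Rightarrow> nat) set" where
  "poly_support c = {\<alpha>. c \<alpha> \<noteq> 0}"

definition peval :: "(('n::finite \<Rightarrow> nat) \<Rightarrow> real) \<Rightarrow> 'a::{real_normed_field} ^ 'n \<Rightarrow> 'a" where
  "peval c x = (\<Sum>\<alpha>\<in>poly_support c. of_real (c \<alpha>) * (\<Prod>i\<in>UNIV. (x $ i) ^ (\<alpha> i)))"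

definition homogeneous_poly :: "(('n::finite \<Rightarrow> nat) \<Rightarrow> real) \<Rightarrow> nat \<Rightarrow> bool" where
  "homogeneous_poly c d \<longleftrightarrow> finite (poly_support c) \<and>
     (\<forall>\<alpha>\<in>poly_support c. (\<Sum>i\<in>UNIV. \<alpha> i) = d)"

definition hyperbolic :: "(('n::finite \<Rightarrow> nat) \<Rightarrow> real) \<Rightarrow> nat \<Rightarrow> real ^ 'n \<Rightarrow> bool" where
  "hyperbolic c d e \<longleftrightarrow> homogeneous_poly c d \<and> peval c e \<noteq> 0 \<and>
     (\<forall>x::real ^ 'n. \<forall>z::complex.
        peval c (\<chi> i. z * complex_of_real (e $ i) - complex_of_real (x $ i)) = 0 \<longrightarrow> z \<in> \<real>)"

definition eigs :: "(('n::finite \<Rightarrow> nat) \<Rightarrow> real) \<Rightarrow> real ^ 'n \<Rightarrow> real ^ 'n \<Rightarrow> real multiset" where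
  "eigs c e x = (SOME M. \<forall>t::real. peval c (t *\<^sub>R e - x) = peval c e * (\<Prod>l\<in>#M. (t - l)))"

definition lambda_max :: "(('n::finite \<Rightarrow> nat) \<Rightarrow> real) \<Rightarrow> real ^ 'n \<Rightarrow> real ^ 'n \<Rightarrow> real" where
  "lambda_max c e x = Max (set_mset (eigs c e x))"

definition lambda_min :: "(('n::finite \<Rightarrow> nat) \<Rightarrow> real) \<Rightarrow> real ^ 'n \<Rightarrow> real ^ 'n \<Rightarrow> real" where
  "lambda_min c e x = Min (set_mset (eigs c e x))"

definition hcone :: "(('n::finite \<Rightarrow> nat) \<Rightarrow> real) \<Rightarrow> real ^ 'n \<Rightarrow> (real ^ 'n) set" where
  "hcone c e = {x. lambda_min c e x \<ge> 0}"

definition htr :: "(('n::finite \<Rightarrow> nat) \<Rightarrow> real) \<Rightarrow> real ^ 'n \<Rightarrow> real ^ 'n \<Rightarrow> real" where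
  "htr c e x = sum_mset (eigs c e x)"

definition hrk :: "(('n::finite \<Rightarrow> nat) \<Rightarrow> real) \<Rightarrow> real ^ 'n \<Rightarrow> real ^ 'n \<Rightarrow> nat" where
  "hrk c e x = size (filter_mset (\<lambda>l. l \<noteq> 0) (eigs c e x))"

definition delta_bound :: "real \<Rightarrow> nat \<Rightarrow> real" where
  "delta_bound \<epsilon> m = (1 - 1 / real m + sqrt (\<epsilon> - (1 / real m) * (1 - 1 / real m))) ^ 2"

end

theory Submission
  imports Defs "HOL-Complex_Analysis.Complex_Analysis"
    "HOL-Computational_Algebra.Fundamental_Theorem_Algebra"
begin

text \<open>Let \<open>v_i\<close> be the mean of \<open>X_i\<close>, and normalise \<open>h(e) = 1\<close>. A vector \<open>w\<close> of rank at most one in the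
  hyperbolicity cone makes \<open>h\<close> affine along \<open>w\<close>, so \<open>h(x - b w) = (1 - b D_w) h(x)\<close> and, by
  independence, \<open>E h(x - \<Sum> b_i X_i) = \<Prod> (1 - b_i D_(v_i)) h(x)\<close>. This mixed polynomial in \<open>(x, b)\<close> is
  again hyperbolic with respect to \<open>(e, 0)\<close>: if \<open>F\<close> has no zeros with imaginary part in the open
  cone, then \<open>(F(z + w) - F(z)) / F(z)\<close> has nonpositive imaginary part there.

  On the real hyperbolicity cone the same quotient is the barrier function in direction \<open>w\<close>. It is
  nonincreasing and convex along the cone, because its reciprocal measures how far one can move
  in direction \<open>-w\<close> without leaving a convex set. Hence the barrier argument of Marcus, Spielman
  and Srivastava applies and shows that \<open>(t e, 1)\<close> is in the cone for \<open>t > \<delta>(\<epsilon>, m)\<close>. The random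
  vectors are then replaced one at a time by a value in their support: if a weighted mean of barrier
  functions is below 1 for all \<open>t > \<delta>\<close>, then, by monotonicity, so is one of them.\<close>

text \<open>The rank hypothesis only describes \<open>h\<close> along \<open>w\<close> from the base
  point \<open>e\<close>; the obstacle is to reach every complex base point. Coefficients of a
  univariate polynomial with all zeros in the open lower half plane do not vanish. Perturb
  \<open>w\<close> into the open cone and let the perturbation tend to 0: Hurwitz's theorem makes a
  coefficient that vanishes at one base point vanish along a line of them. The constant is the value
  of an optimisation. Give the last operator the coefficient \<open>\<beta>\<close> and every other
  one \<open>a\<close>; averaging over the choice of the last one restores the coefficients 1 iff
  \<open>(m - 1) * a + \<beta> = m\<close>. The barriers ask for the starting point
  \<open>\<beta> * \<epsilon>\<close> on the ray of \<open>e\<close> and for shifts of length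
  \<open>a * \<beta> / (\<beta> - a)\<close>; the bound is the least averaged position. For
  \<open>m \<ge> 2\<close> the minimiser has \<open>a > 0\<close> iff
  \<open>\<epsilon> > 1/m\<close>. The trace hypothesis gives \<open>\<epsilon> \<ge> 1/m\<close>,
  since \<open>tr(e) = d \<ge> 1\<close>; continuity covers equality.\<close>

unbundle no fps_syntax

subsection \<open>Hyperbolicity cones are convex\<close>

lemma Hurwitz_parametric:
  fixes p :: "real \<Rightarrow> complex \<Rightarrow> complex"
  assumes S: "open S" "connected S" and T: "compact T"
    and cont: "continuous_on (T \<times> S) (\<lambda>(t, z). p t z)"
    and hol: "\<And>t. t \<in> T \<Longrightarrow> p t holomorphic_on S"
    and seq: "\<And>n. s n \<in> T" "s \<longlonglongrightarrow> t"
    and nz: "\<And>n z. z \<in> S \<Longrightarrow> p (s n) z \<noteq> 0"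
    and nonconst: "\<not> p t constant_on S" and z: "z \<in> S"
  shows "p t z \<noteq> 0"
proof (rule Hurwitz_no_zeros[OF S, where \<F> = "\<lambda>n. p (s n)" and g = "p t"])
  have t: "t \<in> T"
    using T seq by (meson closed_sequentially compact_imp_closed)
  show "p t holomorphic_on S" by (rule hol[OF t])
  show "uniform_limit K (\<lambda>n. p (s n)) (p t) sequentially" if K: "compact K" "K \<subseteq> S" for K
  proof (rule uniform_limitI)
    fix e :: real assume e: "0 < e"
    have "continuous_on (T \<times> K) (\<lambda>(t, z). p t z)"
      by (rule continuous_on_subset[OF cont]) (use K in auto)
    then have "uniformly_continuous_on (T \<times> K) (\<lambda>(t, z). p t z)"
      by (rule compact_uniformly_continuous) (intro compact_Times T K)
    then obtain d where d: "d > 0" "\<And>x x'. \<lbrakk>x \<in> T \<times> K; x' \<in> T \<times> K; dist x' x < d\<rbrakk> \<Longrightarrow>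
        dist ((\<lambda>(t, z). p t z) x') ((\<lambda>(t, z). p t z) x) < e"
      using e unfolding uniformly_continuous_on_def by meson
    have "\<forall>\<^sub>F n in sequentially. dist (s n) t < d"
      using seq(2) d(1) tendstoD by blast
    then show "\<forall>\<^sub>F n in sequentially. \<forall>x\<in>K. dist (p (s n) x) (p t x) < e"
    proof (rule eventually_mono, intro ballI)
      fix n x assume "dist (s n) t < d" "x \<in> K"
      then show "dist (p (s n) x) (p t x) < e"
        using d(2)[of "(t, x)" "(s n, x)"] seq(1) t by (auto simp: dist_Pair_Pair)
    qed
  qed
qed (use hol seq nz nonconst z in auto)

text \<open>The parameters without a zero in \<open>S\<close> form a closed set by Hurwitz; those
  with a zero in \<open>closure S\<close> form a closed set by compactness, as all zeros lie in a
  fixed ball. The frontier condition makes the two sets disjoint, so connectedness of the unit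
  interval leaves only the first.\<close>

lemma zero_free_homotopy:
  fixes p :: "real \<Rightarrow> complex \<Rightarrow> complex"
  assumes S: "open S" "connected S" "\<not> bounded S"
    and cont: "continuous_on ({0..1} \<times> UNIV) (\<lambda>(t, z). p t z)"
    and hol: "\<And>t. t \<in> {0..1} \<Longrightarrow> p t holomorphic_on S"
    and bd: "\<And>t z. t \<in> {0..1} \<Longrightarrow> p t z = 0 \<Longrightarrow> norm z \<le> R"
    and fr: "\<And>t z. t \<in> {0..1} \<Longrightarrow> z \<in> closure S \<Longrightarrow> z \<notin> S \<Longrightarrow> p t z \<noteq> 0"
    and start: "\<And>z. z \<in> S \<Longrightarrow> p 0 z \<noteq> 0" and z: "z \<in> S"
  shows "p 1 z \<noteq> 0"
proof
  assume z0: "p 1 z = 0"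
  define A where "A = {t\<in>{0..1::real}. \<forall>z\<in>S. p t z \<noteq> 0}"
  define B where "B = {t\<in>{0..1::real}. \<exists>z\<in>closure S. p t z = 0}"
  have "closed A"
    unfolding closed_sequential_limits
  proof (intro allI impI, elim conjE)
    fix s t assume s: "\<forall>n. s n \<in> A" and lim: "s \<longlonglongrightarrow> t"
    have t: "t \<in> {0..1}"
      by (rule closed_sequentially[OF _ _ lim]) (use s in \<open>simp_all add: A_def\<close>)
    show "t \<in> A"
    proof (rule ccontr)
      assume "t \<notin> A"
      then obtain w where w: "w \<in> S" "p t w = 0" using t by (auto simp: A_def)
      have "p t constant_on S"
      proof (rule ccontr)
        assume "\<not> p t constant_on S"
        from this w(1) have "p t w \<noteq> 0"
          by - (rule Hurwitz_parametric[OF S(1,2), where T = "{0..1}" and s = s],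
               use s w t hol lim in \<open>auto simp: A_def intro: continuous_on_subset[OF cont]\<close>)
        then show False using w by simp
      qed
      \<comment> \<open>A constant function with a zero vanishes on all of \<open>S\<close>, so the
        bound on the zeros would bound \<open>S\<close>.\<close>
      then have "\<forall>x\<in>S. norm x \<le> R"
        using w bd[OF t] by (metis constant_on_def)
      then show False using S(3) by (auto simp: bounded_iff)
    qed
  qed
  moreover have "closed B"
  proof -
    define Z where "Z = {x \<in> {0..1} \<times> (closure S \<inter> cball 0 R). (\<lambda>(t, z). p t z) x = 0}"
    have "compact ({0..1::real} \<times> (closure S \<inter> cball 0 R))"
      by (intro compact_Times closed_Int_compact) auto
    moreover have "closed Z" unfolding Z_def
      by (intro continuous_closed_preimage_constant continuous_on_subset[OF cont])
         (auto intro!: closed_Times)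
    ultimately have "compact Z"
      by (metis (no_types, lifting) Z_def compact_Int_closed inf.absorb_iff2 mem_Collect_eq subsetI)
    then have "compact (fst ` Z)"
      by (rule compact_continuous_image[rotated]) (intro continuous_intros)
    moreover have "fst ` Z = B"
      using bd by (force simp: Z_def B_def)
    ultimately show ?thesis by (simp add: compact_imp_closed)
  qed
  moreover have "A \<inter> B = {}" using fr by (auto simp: A_def B_def)
  moreover have "{0..1} \<subseteq> A \<union> B" using closure_subset by (fastforce simp: A_def B_def)
  moreover have "0 \<in> A" using start by (auto simp: A_def)
  moreover have "1 \<in> B" using z z0 closure_subset by (auto simp: B_def)
  ultimately have "\<not> connected {0..1::real}"
    unfolding connected_closed not_not
    by (intro exI[of _ A] exI[of _ B] conjI) auto
  then show False by simp
qed

text \<open>The restriction of a hyperbolic polynomial to the span of the direction of hyperbolicity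
  (first argument) and two further vectors.\<close>

locale hyperbolic3 =
  fixes G :: "complex \<Rightarrow> complex \<Rightarrow> complex \<Rightarrow> complex" and d :: nat
  assumes cont: "continuous_on UNIV (\<lambda>(a, b, c). G a b c)"
    and hol: "\<And>a a' b b'. (\<lambda>c. G (a + a' * c) (b + b' * c) c) holomorphic_on UNIV"
    and hom: "\<And>k a b c. G (k * a) (k * b) (k * c) = k ^ d * G a b c"
    and hyp: "\<And>a b c. Im a \<noteq> 0 \<Longrightarrow> b \<in> \<real> \<Longrightarrow> c \<in> \<real> \<Longrightarrow> G a b c \<noteq> 0"
begin

lemma G_100: "G 1 0 0 \<noteq> 0"
  using hyp[of \<i> 0 0] hom[of \<i> 1 0 0] by auto

lemma cont': "continuous_on X f \<Longrightarrow> continuous_on X g \<Longrightarrow> continuous_on X h \<Longrightarrow>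
    continuous_on X (\<lambda>x. G (f x) (g x) (h x))"
  using continuous_on_compose2[OF cont, of X "\<lambda>x. (f x, g x, h x)"]
  by (simp add: continuous_on_Pair)

text \<open>Dividing by \<open>c\<close> turns a zero with large \<open>c\<close> into one with last
  argument 1 and the others near 0, which continuity excludes. The bound supplies the compactness in
  the homotopies.\<close>

lemma bounded_zeros:
  assumes nz: "G 0 0 1 \<noteq> 0"
  shows "\<exists>R. \<forall>a b c. norm a \<le> B \<longrightarrow> norm b \<le> B \<longrightarrow> G a b c = 0 \<longrightarrow> norm c \<le> R"
proof -
  have "isCont (\<lambda>x. G (fst x) (snd x) 1) (0, 0)"
    using cont'[of UNIV fst snd "\<lambda>_. 1"] continuous_on_eq_continuous_at
    by (fastforce intro: continuous_intros)
  then have "\<forall>\<^sub>F x in at (0, 0). G (fst x) (snd x) 1 \<noteq> 0"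
    using nz by (intro tendsto_imp_eventually_ne[of _ "G 0 0 1"]) (simp_all add: isCont_def)
  then obtain r where r: "r > 0" "\<And>x. x \<noteq> (0,0) \<Longrightarrow> dist x (0, 0) < r \<Longrightarrow> G (fst x) (snd x) 1 \<noteq> 0"
    unfolding eventually_at by auto
  have r': "G a b 1 \<noteq> 0" if "norm a < r/2" "norm b < r/2" for a b
  proof (cases "(a, b) = (0, 0)")
    case False
    have "dist (a, b) (0, 0) \<le> norm a + norm b"
      by (simp add: dist_Pair_Pair sqrt_sum_squares_le_sum)
    then show ?thesis using r(2)[OF False] that by simp
  qed (use nz in simp)
  have "norm c \<le> 2 * \<bar>B\<bar> / r + 1" if h: "norm a \<le> B" "norm b \<le> B" "G a b c = 0" for a b c
  proof (rule ccontr)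
    assume n: "\<not> norm c \<le> 2 * \<bar>B\<bar> / r + 1"
    have "2 * \<bar>B\<bar> / r \<ge> 0" using r(1) by simp
    with n have c: "norm c > 2 * \<bar>B\<bar> / r" and c0: "norm c > 0" by linarith+
    have "norm (a / c) < r / 2" "norm (b / c) < r / 2"
      using h c c0 r(1) by (auto simp: norm_divide field_simps)
    then have "G (a / c) (b / c) 1 \<noteq> 0" by (rule r')
    moreover have "c \<noteq> 0" using c0 by auto
    ultimately show False using hom[of c "a / c" "b / c" 1] h(3) by simp
  qed
  then show ?thesis by blast
qed

text \<open>Replaces the second and third vector, \<open>u\<close> and \<open>v\<close>, by
  \<open>u + \<rho> e\<close> and \<open>v + \<sigma> e\<close>. Real multiples of \<open>e\<close>
  do not change the imaginary part of its coefficient.\<close>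

lemma shift:
  assumes "\<rho> \<in> \<real>" "\<sigma> \<in> \<real>"
  shows "hyperbolic3 (\<lambda>a b c. G (a + \<rho> * b + \<sigma> * c) b c) d"
proof
  show "continuous_on UNIV (\<lambda>(a, b, c). G (a + \<rho> * b + \<sigma> * c) b c)"
    unfolding case_prod_unfold by (intro cont' continuous_intros)
  show "(\<lambda>c. G (a + a' * c + \<rho> * (b + b' * c) + \<sigma> * c) (b + b' * c) c) holomorphic_on UNIV" for a a' b b'
    using hol[of "a + \<rho> * b" "a' + \<rho> * b' + \<sigma>" b b'] by (simp add: algebra_simps)
  show "G (k * a + \<rho> * (k * b) + \<sigma> * (k * c)) (k * b) (k * c) = k ^ d * G (a + \<rho> * b + \<sigma> * c) b c" for k a b c
    using hom[of k "a + \<rho> * b + \<sigma> * c" b c] by (simp add: algebra_simps)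
  show "G (a + \<rho> * b + \<sigma> * c) b c \<noteq> 0" if "Im a \<noteq> 0" "b \<in> \<real>" "c \<in> \<real>" for a b c
    using that assms by (intro hyp) (auto simp: complex_is_Real_iff)
qed

text \<open>\<open>pos\<close> says that the third vector lies in the cone. At a zero,
  \<open>a / z\<close> would be real by hyperbolicity and negative by \<open>pos\<close>, so
  \<open>z\<close> would be a negative multiple of \<open>a\<close>, in the lower half
  plane.\<close>

lemma start_ne_0:
  assumes pos: "\<And>s::real. s \<ge> (0::real) \<Longrightarrow> G (of_real s) 0 1 \<noteq> 0"
    and a: "Re a = 0" "Im a > 0" and z: "Im z \<ge> 0"
  shows "G a 0 z \<noteq> 0"
proof (cases "z = 0")
  case True
  then show ?thesis using hyp[of a 0 0] a by auto
next
  case z0: False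
  have "G a 0 z = z ^ d * G (a / z) 0 1" using hom[of z "a / z" 0 1] z0 by simp
  moreover have "G (a / z) 0 1 \<noteq> 0"
  proof
    assume 0: "G (a / z) 0 1 = 0"
    then have im: "Im (a / z) = 0" using hyp[of "a / z" 0 1] by auto
    then obtain s where s: "a / z = complex_of_real s" by (metis complex_is_Real_iff Reals_cases)
    then have "s < 0" using pos[of s] 0 by (metis not_le)
    moreover have "a = of_real s * z" using s z0 by (simp add: field_simps)
    then have "Im a = s * Im z" by simp
    ultimately show False using a z by (smt (verit) mult_nonneg_nonneg mult_nonpos_nonneg)
  qed
  ultimately show ?thesis using z0 by simp
qed

text \<open>Homotopy that grows the coefficient of the second vector from 0 to 1. For real
  \<open>z\<close> the only nonreal coefficient is that of \<open>e\<close>, so by hyperbolicity no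
  zero can cross the real axis.\<close>

lemma stable_imag:
  assumes pos: "\<And>s::real. s \<ge> (0::real) \<Longrightarrow> G (of_real s) 0 1 \<noteq> 0" and s: "s > 0" and z: "Im z \<ge> 0"
  shows "G (\<i> * of_real s) 1 z \<noteq> 0"
proof (cases "Im z = 0")
  case True
  then show ?thesis using s by (intro hyp) (auto simp: complex_is_Real_iff)
next
  case False
  define a where "a = \<i> * complex_of_real s"
  have a: "Im a > 0" "Re a = 0" using s by (auto simp: a_def)
  obtain R where R: "\<And>x b c. norm x \<le> norm a + 1 \<Longrightarrow> norm b \<le> norm a + 1 \<Longrightarrow> G x b c = 0 \<Longrightarrow> norm c \<le> R"
    using bounded_zeros[of "norm a + 1"] pos[of 0] by auto
  define S where "S = {z. Im z > 0}"
  have nb: "\<not> bounded S"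
  proof
    assume "bounded S"
    then obtain K where K: "\<And>x. x \<in> S \<Longrightarrow> norm x \<le> K" by (auto simp: bounded_iff)
    have "\<i> * of_real (\<bar>K\<bar> + 1) \<in> S" by (simp add: S_def)
    from K[OF this] show False by (simp add: norm_mult del: of_real_add)
  qed
  have cl: "closure S \<subseteq> {z. Im z \<ge> 0}"
    by (intro closure_minimal closed_halfspace_Im_ge) (auto simp: S_def)
  have "G a (of_real 1) z \<noteq> 0"
  proof (rule zero_free_homotopy[where S = S and R = R and z = z and p = "\<lambda>t. G a (of_real t)"])
    show "open S" "connected S"
      by (auto simp: S_def open_halfspace_Im_gt convex_connected convex_halfspace_Im_gt)
    show "continuous_on ({0..1} \<times> UNIV) (\<lambda>(t, z). G a (complex_of_real t) z)"
      unfolding case_prod_unfold by (intro cont' continuous_intros)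
    show "G a (complex_of_real t) holomorphic_on S" for t
      using hol[of a 0 "of_real t" 0] by (auto intro: holomorphic_on_subset)
    show "norm z \<le> R" if "t \<in> {0..1}" "G a (complex_of_real t) z = 0" for t z
      using that norm_ge_zero[of a] by (intro R[of a "of_real t"]) (auto intro: add_increasing)
    show "G a (complex_of_real t) z \<noteq> 0" if "z \<in> closure S" "z \<notin> S" for t z
      using that cl a by (intro hyp) (auto simp: S_def complex_is_Real_iff)
    show "G a (complex_of_real 0) z \<noteq> 0" if "z \<in> S" for z
      using start_ne_0[OF pos a(2,1), of z] that by (auto simp: S_def)
    show "z \<in> S" using z False by (simp add: S_def)
  qed (rule nb)
  then show ?thesis by (simp add: a_def)
qed

lemma stable_upper:
  assumes pos: "\<And>s::real. s \<ge> (0::real) \<Longrightarrow> G (of_real s) 0 1 \<noteq> 0" and a: "Im a > 0" and z: "Im z \<ge> 0"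
  shows "G a 1 z \<noteq> 0"
proof -
  interpret H: hyperbolic3 "\<lambda>x b c. G (x + of_real (Re a) * b + 0 * c) b c" d
    by (rule shift) auto
  have "G (\<i> * of_real (Im a) + of_real (Re a) * 1 + 0 * z) 1 z \<noteq> 0"
    using pos a z by (intro H.stable_imag) auto
  then show ?thesis by (simp add: complex_eq[symmetric] add.commute)
qed

lemma eventually_shift_ne_0:
  assumes nz: "\<And>s::real. s \<ge> (0::real) \<Longrightarrow> G (of_real s) u v \<noteq> 0"
  shows "\<exists>\<eta>>0::real. \<forall>s::real. s \<ge> -(\<eta>::real) \<longrightarrow> G (of_real s) u v \<noteq> 0"
proof -
  have "isCont (\<lambda>s::real. G (of_real s) u v) 0"
    using cont'[of UNIV "\<lambda>s::real. of_real s" "\<lambda>_. u" "\<lambda>_. v"] continuous_on_eq_continuous_at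
    by (auto intro!: continuous_intros)
  then have "\<forall>\<^sub>F s::real in at 0. G (of_real s) u v \<noteq> 0"
    using nz[of 0] by (intro tendsto_imp_eventually_ne[of _ "G 0 u v"]) (auto simp: isCont_def)
  then obtain r where r: "r > 0" "\<And>s::real. s \<noteq> 0 \<Longrightarrow> dist s (0::real) < r \<Longrightarrow> G (of_real s) u v \<noteq> 0"
    unfolding eventually_at by auto
  show ?thesis
  proof (intro exI[of _ "r/2"] conjI allI impI)
    fix s :: real assume "- (r / 2) \<le> s"
    then show "G s u v \<noteq> 0" using r nz[of s] by (cases "s \<ge> 0") auto
  qed (use r in auto)
qed

text \<open>With \<open>v\<close> for the third vector, \<open>v - \<eta> e\<close> still lies in
  the cone for some \<open>\<eta> > 0\<close>, and
  \<open>z v = \<eta> z e + z (v - \<eta> e)\<close> supplies the coefficient of \<open>e\<close>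
  with positive imaginary part that \<open>stable_upper\<close> asks for.\<close>

lemma stable_in_cone:
  assumes pos: "\<And>s::real. s \<ge> (0::real) \<Longrightarrow> G (of_real s) 0 1 \<noteq> 0" and z: "Im z > 0"
  shows "G 0 1 z \<noteq> 0"
proof -
  obtain \<eta> where \<eta>: "\<eta> > 0" "\<And>s::real. s \<ge> -(\<eta>::real) \<Longrightarrow> G (of_real s) 0 1 \<noteq> 0"
    using eventually_shift_ne_0[OF pos] by auto
  interpret H: hyperbolic3 "\<lambda>x b c. G (x + 0 * b + of_real (-\<eta>) * c) b c" d
    by (rule shift) auto
  have "G (of_real \<eta> * z + 0 * 1 + of_real (-\<eta>) * z) 1 z \<noteq> 0"
  proof (rule H.stable_upper)
    fix s :: real assume "0 \<le> s"
    then show "G (complex_of_real s + 0 * 0 + complex_of_real (- \<eta>) * 1) 0 1 \<noteq> 0"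
      using \<eta>(2)[of "s - \<eta>"] by simp
  qed (use \<eta> z in auto)
  then show ?thesis by simp
qed

lemma stable_in_cone':
  assumes pos: "\<And>s::real. s \<ge> (0::real) \<Longrightarrow> G (of_real s) 0 1 \<noteq> 0" and z: "Im z \<noteq> 0" and a: "a \<in> \<real>" and b: "b \<in> \<real>" "b \<noteq> 0"
  shows "G a b z \<noteq> 0"
proof -
  define z' where "z' = z / b"
  have ab: "a / b \<in> \<real>" using a b by auto
  then obtain r where r: "a / b = complex_of_real r" by (elim Reals_cases)
  obtain b' where b': "b = of_real b'" using b by (elim Reals_cases)
  have "Im z' \<noteq> 0" using z b b' by (simp add: z'_def)
  have "G (a / b) 1 z' \<noteq> 0"
  proof (cases "Im z' > 0")
    case True
    interpret H: hyperbolic3 "\<lambda>x b c. G (x + of_real r * b + 0 * c) b c" d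
      by (rule shift) auto
    show ?thesis using H.stable_in_cone[OF _ True] pos r by simp
  next
    case False
    interpret H: hyperbolic3 "\<lambda>x b c. G (x + of_real r * b + 0 * c) b c" d
      by (rule shift) auto
    \<comment> \<open>Negating all arguments moves \<open>z'\<close> to the upper half plane and
      changes the value only by \<open>(-1) ^ d\<close>; \<open>K\<close> is the slice with the
      second vector negated.\<close>
    interpret K: hyperbolic3 "\<lambda>x b c. G (x + of_real r * (-b) + 0 * c) (- b) c" d
    proof
      show "continuous_on UNIV (\<lambda>(a, b, c). G (a + complex_of_real r * - b + 0 * c) (- b) c)"
        unfolding case_prod_unfold by (intro cont' continuous_intros)
      show "(\<lambda>c. G (a + a' * c + complex_of_real r * - (b + b' * c) + 0 * c) (- (b + b' * c)) c)
           holomorphic_on UNIV" for a a' b b'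
        using H.hol[of a a' "-b" "-b'"] by (simp add: algebra_simps)
      show "G (k * a + complex_of_real r * - (k * b) + 0 * (k * c)) (- (k * b)) (k * c) =
          k ^ d * G (a + complex_of_real r * - b + 0 * c) (- b) c" for k a b c
        using H.hom[of k a "-b" c] by simp
      show "G (a + complex_of_real r * - b + 0 * c) (- b) c \<noteq> 0"
        if "Im a \<noteq> 0" "b \<in> \<real>" "c \<in> \<real>" for a b c
        using H.hyp[of a "-b" c] that by simp
    qed
    have "G (- of_real r) (-1) (-z') \<noteq> 0"
      using K.stable_in_cone[of "-z'"] pos False \<open>Im z' \<noteq> 0\<close> by simp
    then show ?thesis using hom[of "-1" "of_real r" 1 z'] r by simp
  qed
  then show ?thesis using hom[of b "a / b" 1 z'] b by (simp add: z'_def)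
qed

text \<open>Homotopy through \<open>(1 - t) e + t u + z v\<close> with \<open>z\<close> in the right
  half plane, read at \<open>t = 1\<close>, \<open>z = 1\<close>. On the imaginary axis, zeros off
  the origin are excluded by stability in \<open>z\<close>, and \<open>z = 0\<close> leaves either
  \<open>e\<close> or a positive multiple of a vector that \<open>pos1\<close> covers.\<close>

theorem cone_add:
  assumes pos1: "\<And>s::real. s \<ge> (0::real) \<Longrightarrow> G (of_real s) 1 0 \<noteq> 0" and pos2: "\<And>s::real. s \<ge> (0::real) \<Longrightarrow> G (of_real s) 0 1 \<noteq> 0"
  shows "G 0 1 1 \<noteq> 0"
proof -
  obtain R where R: "\<And>x b c. norm x \<le> 1 \<Longrightarrow> norm b \<le> 1 \<Longrightarrow> G x b c = 0 \<Longrightarrow> norm c \<le> R"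
    using bounded_zeros[of 1] pos2[of 0] by auto
  define S where "S = {z. Re z > 0}"
  have nb: "\<not> bounded S"
  proof
    assume "bounded S"
    then obtain K where K: "\<And>x. x \<in> S \<Longrightarrow> norm x \<le> K" by (auto simp: bounded_iff)
    have "of_real (\<bar>K\<bar> + 1) \<in> S" by (simp add: S_def)
    from K[OF this] show False by (simp add: norm_mult del: of_real_add)
  qed
  have cl: "closure S \<subseteq> {z. Re z \<ge> 0}"
    by (intro closure_minimal closed_halfspace_Re_ge) (auto simp: S_def)
  have "G (of_real (1 - 1)) (of_real 1) 1 \<noteq> 0"
  proof (rule zero_free_homotopy[where S = S and R = R and z = 1 and
        p = "\<lambda>t. G (of_real (1 - t)) (of_real t)"])
    show "open S" "connected S"
      by (auto simp: S_def open_halfspace_Re_gt convex_connected convex_halfspace_Re_gt)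
    show "continuous_on ({0..1} \<times> UNIV) (\<lambda>(t, z). G (complex_of_real (1 - t)) (complex_of_real t) z)"
      unfolding case_prod_unfold by (intro cont' continuous_intros)
    show "G (complex_of_real (1 - t)) (complex_of_real t) holomorphic_on S" for t
      using hol[of "of_real (1 - t)" 0 "of_real t" 0] by (auto intro: holomorphic_on_subset)
    show "norm z \<le> R" if "t \<in> {0..1}" "G (complex_of_real (1 - t)) (complex_of_real t) z = 0" for t z
      using that by (intro R[of "of_real (1 - t)" "of_real t"]) (auto simp del: of_real_diff)
    show "G (complex_of_real (1 - t)) (complex_of_real t) z \<noteq> 0"
      if t: "t \<in> {0..1}" and z: "z \<in> closure S" "z \<notin> S" for t z
    proof (cases "t = 0")
      case True
      show ?thesis
      proof (cases "z = 0")
        case False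
        have "Re z = 0" using z cl by (auto simp: S_def)
        then have "Im (1 / z) \<noteq> 0" using False by (auto simp: complex_eq_iff Im_divide)
        then have "G (1 / z) 0 1 \<noteq> 0" by (intro hyp) auto
        then show ?thesis using hom[of z "1/z" 0 1] False True by simp
      qed (use True G_100 in simp)
    next
      case t0: False
      show ?thesis
      proof (cases "Im z = 0")
        case True
        then have z: "z = 0" using z cl by (auto simp: S_def complex_eq_iff)
        have "G (of_real ((1 - t) / t)) 1 0 \<noteq> 0" using t t0 by (intro pos1) auto
        then show ?thesis using hom[of "of_real t" "of_real ((1 - t) / t)" 1 0] t0 z by simp
      qed (use t t0 stable_in_cone'[OF pos2] in auto)
    qed
    show "G (complex_of_real (1 - 0)) (complex_of_real 0) z \<noteq> 0" if "z \<in> S" for z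
    proof -
      have z: "z \<noteq> 0" "Re z > 0" using that by (auto simp: S_def)
      have "G (1 / z) 0 1 \<noteq> 0"
      proof (cases "Im (1 / z) = 0")
        case True
        then have "1 / z = of_real (Re (1 / z))" by (simp add: complex_eq_iff)
        moreover have "Re (1 / z) \<ge> 0" using z by (simp add: Re_divide)
        ultimately show ?thesis using pos2 by metis
      next
        case False
        then show ?thesis by (rule hyp) auto
      qed
      then show ?thesis using hom[of z "1/z" 0 1] z by simp
    qed
    show "1 \<in> S" by (simp add: S_def)
  qed (rule nb)
  then show ?thesis by simp
qed

end

subsection \<open>Hyperbolic functions and univariate stability\<close>

definition cvec :: "real ^ 'n \<Rightarrow> complex ^ 'n" where
  "cvec x = (\<chi> i. complex_of_real (x $ i))"

lemma cvec_nth [simp]: "cvec x $ i = complex_of_real (x $ i)"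
  by (simp add: cvec_def)

lemma cvec_add: "cvec (x + y) = cvec x + cvec y"
  and cvec_diff: "cvec (x - y) = cvec x - cvec y"
  and cvec_scaleR: "cvec (k *\<^sub>R x) = complex_of_real k *s cvec x"
  by (simp_all add: vec_eq_iff)

lemma cvec_0 [simp]: "cvec 0 = 0"
  by (simp add: vec_eq_iff)

lemma continuous_on_cvec [continuous_intros]:
  "continuous_on S f \<Longrightarrow> continuous_on S (\<lambda>x. cvec (f x))"
  unfolding cvec_def by (intro continuous_intros)

lemma continuous_on_smult_vec [continuous_intros]:
  fixes g :: "'a::topological_space \<Rightarrow> complex ^ 'n"
  shows "continuous_on S f \<Longrightarrow> continuous_on S g \<Longrightarrow> continuous_on S (\<lambda>x. f x *s g x)"
  unfolding vector_scalar_mult_def by (intro continuous_intros)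

lemma peval_cvec: "peval c (cvec x) = complex_of_real (peval c x)"
  by (simp add: peval_def)

lemma peval_smult:
  fixes z :: "'a::real_normed_field ^ 'n::finite"
  assumes "homogeneous_poly c d"
  shows "peval c (k *s z) = k ^ d * peval c z"
proof -
  have "(\<Prod>i\<in>UNIV. (k * z $ i) ^ \<alpha> i) = k ^ d * (\<Prod>i\<in>UNIV. (z $ i) ^ \<alpha> i)"
    if "\<alpha> \<in> poly_support c" for \<alpha>
    using assms that
    by (simp add: homogeneous_poly_def power_mult_distrib prod.distrib flip: power_sum)
  then show ?thesis
    by (simp add: peval_def sum_distrib_left mult.left_commute)
qed

lemma continuous_on_peval [continuous_intros]:
  fixes f :: "'b::topological_space \<Rightarrow> 'a::real_normed_field ^ 'n::finite"
  shows "continuous_on S f \<Longrightarrow> continuous_on S (\<lambda>x. peval c (f x))"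
  unfolding peval_def by (intro continuous_intros)

lemma holomorphic_on_peval_line:
  "(\<lambda>t. peval c (z0 + t *s z1)) holomorphic_on S"
  unfolding peval_def by (auto intro!: holomorphic_intros)

lemma differentiable_peval:
  fixes x :: "real ^ 'n::finite"
  shows "peval c differentiable (at x)"
proof -
  have "(\<lambda>x. \<Prod>i\<in>UNIV. (x $ i) ^ \<alpha> i) differentiable (at x)" for \<alpha> :: "'n \<Rightarrow> nat"
  proof -
    have "(\<lambda>x::real^'n. x $ i ^ \<alpha> i) differentiable (at x)" for i
      by (intro differentiable_power bounded_linear_imp_differentiable bounded_linear_vec_nth)
    then obtain D where "((\<lambda>x::real^'n. x $ i ^ \<alpha> i) has_derivative D i) (at x)" for i
      unfolding differentiable_def by metis
    then show ?thesis
      using has_derivative_prod[of UNIV "\<lambda>i x. x $ i ^ \<alpha> i" D x UNIV]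
      unfolding differentiable_def by blast
  qed
  then have "(\<lambda>x. \<Sum>\<alpha>\<in>poly_support c. of_real (c \<alpha>) * (\<Prod>i\<in>UNIV. (x $ i) ^ \<alpha> i)) differentiable (at x)"
    by (cases "finite (poly_support c)") (auto intro!: differentiable_sum differentiable_mult)
  then show ?thesis by (simp add: peval_def[abs_def])
qed

text \<open>\<open>b\<close> holds auxiliary variables that take part in homogeneity, so the cone
  lives in the space of pairs \<open>(x, b)\<close> and the direction of hyperbolicity is
  \<open>(e, 0)\<close>. Continuity and holomorphy are stated on slices, which is where the
  three-variable results are applied.\<close>

locale hyperbolic_function =
  fixes e :: "real ^ 'n::finite" and d :: nat
    and F :: "complex ^ 'n \<Rightarrow> (nat \<Rightarrow> complex) \<Rightarrow> complex"
  assumes F_cont: "\<And>z1 z2 z3 b1 b2 b3. continuous_on UNIV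
      (\<lambda>(\<alpha>, \<beta>, \<gamma>). F (\<alpha> *s z1 + \<beta> *s z2 + \<gamma> *s z3) (\<lambda>j. \<alpha> * b1 j + \<beta> * b2 j + \<gamma> * b3 j))"
    and F_hol: "\<And>z0 z1 b0 b1. (\<lambda>t. F (z0 + t *s z1) (\<lambda>j. b0 j + t * b1 j)) holomorphic_on UNIV"
    and F_hom: "\<And>k z b. F (k *s z) (\<lambda>j. k * b j) = k ^ d * F z b"
    and F_hyp: "\<And>x b s. s > 0 \<Longrightarrow> F (cvec x + (\<i> * of_real s) *s cvec e) (\<lambda>j. of_real (b j)) \<noteq> 0"
begin

text \<open>Positivity of all eigenvalues of \<open>(x, b)\<close> with respect to
  \<open>(e, 0)\<close>: the real zeros on the line \<open>x + s e\<close> are at the negatives of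
  the eigenvalues.\<close>

definition cone :: "real ^ 'n \<Rightarrow> (nat \<Rightarrow> real) \<Rightarrow> bool" where
  "cone x b \<longleftrightarrow> (\<forall>s\<ge>0. F (cvec (x + s *\<^sub>R e)) (\<lambda>j. of_real (b j)) \<noteq> 0)"

lemma hyperbolic3_slice:
  "hyperbolic3 (\<lambda>\<alpha> \<beta> \<gamma>. F (\<alpha> *s cvec e + \<beta> *s cvec x + \<gamma> *s cvec y)
     (\<lambda>j. \<beta> * of_real (b j) + \<gamma> * of_real (b' j))) d"
proof
  show "continuous_on UNIV (\<lambda>(\<alpha>, \<beta>, \<gamma>). F (\<alpha> *s cvec e + \<beta> *s cvec x + \<gamma> *s cvec y)
     (\<lambda>j. \<beta> * of_real (b j) + \<gamma> * of_real (b' j)))"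
    using F_cont[of "cvec e" "cvec x" "cvec y" "\<lambda>_. 0" "\<lambda>j. of_real (b j)" "\<lambda>j. of_real (b' j)"] by simp
  show "(\<lambda>\<gamma>. F ((\<alpha> + \<alpha>' * \<gamma>) *s cvec e + (\<beta> + \<beta>' * \<gamma>) *s cvec x + \<gamma> *s cvec y)
     (\<lambda>j. (\<beta> + \<beta>' * \<gamma>) * of_real (b j) + \<gamma> * of_real (b' j))) holomorphic_on UNIV" for \<alpha> \<alpha>' \<beta> \<beta>'
  proof -
    have "(\<alpha> + \<alpha>' * \<gamma>) *s cvec e + (\<beta> + \<beta>' * \<gamma>) *s cvec x + \<gamma> *s cvec y
        = (\<alpha> *s cvec e + \<beta> *s cvec x) + \<gamma> *s (\<alpha>' *s cvec e + \<beta>' *s cvec x + cvec y)" for \<gamma>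
      by (simp add: vec_eq_iff algebra_simps)
    moreover have "(\<lambda>j. (\<beta> + \<beta>' * \<gamma>) * of_real (b j) + \<gamma> * of_real (b' j))
        = (\<lambda>j. \<beta> * of_real (b j) + \<gamma> * (\<beta>' * of_real (b j) + of_real (b' j)))" for \<gamma>
      by (simp add: algebra_simps)
    ultimately show ?thesis
      by (simp only: F_hol[of "\<alpha> *s cvec e + \<beta> *s cvec x" "\<alpha>' *s cvec e + \<beta>' *s cvec x + cvec y"
            "\<lambda>j. \<beta> * of_real (b j)" "\<lambda>j. \<beta>' * of_real (b j) + of_real (b' j)"])
  qed
  show "F ((k * \<alpha>) *s cvec e + (k * \<beta>) *s cvec x + (k * \<gamma>) *s cvec y)
         (\<lambda>j. k * \<beta> * complex_of_real (b j) + k * \<gamma> * complex_of_real (b' j)) =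
       k ^ d * F (\<alpha> *s cvec e + \<beta> *s cvec x + \<gamma> *s cvec y)
          (\<lambda>j. \<beta> * complex_of_real (b j) + \<gamma> * complex_of_real (b' j))" for k \<alpha> \<beta> \<gamma>
  proof -
    have "(k * \<alpha>) *s cvec e + (k * \<beta>) *s cvec x + (k * \<gamma>) *s cvec y
        = k *s (\<alpha> *s cvec e + \<beta> *s cvec x + \<gamma> *s cvec y)"
      by (simp add: vec_eq_iff algebra_simps)
    then show ?thesis
      using F_hom[of k "\<alpha> *s cvec e + \<beta> *s cvec x + \<gamma> *s cvec y"
          "\<lambda>j. \<beta> * of_real (b j) + \<gamma> * of_real (b' j)"]
      by (simp only: distrib_left mult.assoc)
  qed
  have pos: "F (\<alpha> *s cvec e + of_real \<beta> *s cvec x + of_real \<gamma> *s cvec y)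
         (\<lambda>j. of_real \<beta> * of_real (b j) + of_real \<gamma> * of_real (b' j)) \<noteq> 0"
    if "Im \<alpha> > 0" for \<alpha> \<beta> \<gamma>
  proof -
    have "\<alpha> *s cvec e + of_real \<beta> *s cvec x + of_real \<gamma> *s cvec y
      = cvec (Re \<alpha> *\<^sub>R e + \<beta> *\<^sub>R x + \<gamma> *\<^sub>R y) + (\<i> * of_real (Im \<alpha>)) *s cvec e"
      by (simp add: vec_eq_iff complex_eq_iff algebra_simps)
    then show ?thesis
      using F_hyp[OF that, of "Re \<alpha> *\<^sub>R e + \<beta> *\<^sub>R x + \<gamma> *\<^sub>R y" "\<lambda>j. \<beta> * b j + \<gamma> * b' j"] by simp
  qed
  show "F (\<alpha> *s cvec e + \<beta> *s cvec x + \<gamma> *s cvec y)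
     (\<lambda>j. \<beta> * of_real (b j) + \<gamma> * of_real (b' j)) \<noteq> 0"
    if "Im \<alpha> \<noteq> 0" and re: "\<beta> \<in> \<real>" "\<gamma> \<in> \<real>" for \<alpha> \<beta> \<gamma>
  proof -
    obtain \<beta>' \<gamma>' where bg: "\<beta> = of_real \<beta>'" "\<gamma> = of_real \<gamma>'"
      using re by (auto elim!: Reals_cases)
    show ?thesis
    proof (cases "Im \<alpha> > 0")
      case True
      then show ?thesis using pos bg by simp
    next
      case False
      then have "Im (-\<alpha>) > 0" using that by simp
      from pos[OF this, of "-\<beta>'" "-\<gamma>'"] have
        "F ((-1) *s (\<alpha> *s cvec e + \<beta> *s cvec x + \<gamma> *s cvec y))
         (\<lambda>j. (-1) * (\<beta> * of_real (b j) + \<gamma> * of_real (b' j))) \<noteq> 0"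
        by (simp add: bg vector_add_ldistrib vector_smult_assoc add.commute)
      then show ?thesis unfolding F_hom by simp
    qed
  qed
qed

lemma cone_add_e: "cone x b \<Longrightarrow> s \<ge> 0 \<Longrightarrow> cone (x + s *\<^sub>R e) b"
  unfolding cone_def by (metis add.assoc add_nonneg_nonneg scaleR_left.add)

lemma cone_imp_ne_0: "cone x b \<Longrightarrow> F (cvec x) (\<lambda>j. of_real (b j)) \<noteq> 0"
  unfolding cone_def by (metis add.right_neutral order_refl scaleR_zero_left)

lemma cone_scale:
  assumes "cone x b" "k > 0"
  shows "cone (k *\<^sub>R x) (\<lambda>j. k * b j)"
  unfolding cone_def
proof (intro allI impI)
  fix s :: real assume s: "s \<ge> 0"
  have "cvec (k *\<^sub>R x + s *\<^sub>R e) = of_real k *s cvec (x + (s / k) *\<^sub>R e)"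
    using assms(2) by (simp add: vec_eq_iff field_simps)
  moreover have "F (cvec (x + (s / k) *\<^sub>R e)) (\<lambda>j. of_real (b j)) \<noteq> 0"
    using assms s unfolding cone_def by simp
  ultimately show "F (cvec (k *\<^sub>R x + s *\<^sub>R e)) (\<lambda>j. of_real (k * b j)) \<noteq> 0"
    using assms(2) by (simp add: F_hom)
qed

lemma cone_add:
  assumes "cone x b" "cone y b'"
  shows "cone (x + y) (\<lambda>j. b j + b' j)"
  unfolding cone_def
proof (intro allI impI)
  fix s :: real assume s: "s \<ge> 0"
  interpret H: hyperbolic3 "\<lambda>\<alpha> \<beta> \<gamma>. F (\<alpha> *s cvec e + \<beta> *s cvec (x + s *\<^sub>R e) + \<gamma> *s cvec y)
     (\<lambda>j. \<beta> * of_real (b j) + \<gamma> * of_real (b' j))" d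
    by (rule hyperbolic3_slice)
  have "cone (x + s *\<^sub>R e) b" by (intro cone_add_e assms s)
  then have "F (0 *s cvec e + 1 *s cvec (x + s *\<^sub>R e) + 1 *s cvec y) (\<lambda>j. 1 * of_real (b j) + 1 * of_real (b' j)) \<noteq> 0"
    using assms(2) by (intro H.cone_add)
      (simp_all add: cone_def cvec_add cvec_scaleR add_ac)
  then show "F (cvec (x + y + s *\<^sub>R e)) (\<lambda>j. of_real (b j + b' j)) \<noteq> 0"
    by (simp add: cvec_add cvec_scaleR add_ac)
qed

lemma cone_open:
  assumes "cone x b"
  shows "\<exists>\<eta>>0. cone (x - \<eta> *\<^sub>R e) b"
proof -
  interpret H: hyperbolic3 "\<lambda>\<alpha> \<beta> \<gamma>. F (\<alpha> *s cvec e + \<beta> *s cvec x + \<gamma> *s cvec x)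
     (\<lambda>j. \<beta> * of_real (b j) + \<gamma> * of_real (b j))" d
    by (rule hyperbolic3_slice)
  obtain \<eta> where \<eta>: "\<eta> > 0" "\<And>s. s \<ge> -\<eta> \<Longrightarrow> F (of_real s *s cvec e + 1 *s cvec x + 0 *s cvec x)
     (\<lambda>j. 1 * of_real (b j) + 0 * of_real (b j)) \<noteq> 0"
    using H.eventually_shift_ne_0[of 1 0] assms
    by (auto simp: cone_def cvec_add cvec_scaleR add_ac)
  have "cone (x - \<eta> *\<^sub>R e) b"
    unfolding cone_def
  proof (intro allI impI)
    fix s :: real assume "s \<ge> 0"
    moreover have "cvec (x - \<eta> *\<^sub>R e + s *\<^sub>R e) = of_real (s - \<eta>) *s cvec e + 1 *s cvec x + 0 *s cvec x"
      by (simp add: vec_eq_iff algebra_simps)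
    ultimately show "F (cvec (x - \<eta> *\<^sub>R e + s *\<^sub>R e)) (\<lambda>j. complex_of_real (b j)) \<noteq> 0"
      using \<eta>(2)[of "s - \<eta>"] by simp
  qed
  then show ?thesis using \<eta>(1) by blast
qed

lemma cone_stable:
  assumes "cone y b'" and z: "Im \<zeta> > 0"
  shows "F (cvec x + \<zeta> *s cvec y) (\<lambda>j. of_real (b j) + \<zeta> * of_real (b' j)) \<noteq> 0"
proof -
  interpret H: hyperbolic3 "\<lambda>\<alpha> \<beta> \<gamma>. F (\<alpha> *s cvec e + \<beta> *s cvec x + \<gamma> *s cvec y)
     (\<lambda>j. \<beta> * of_real (b j) + \<gamma> * of_real (b' j))" d
    by (rule hyperbolic3_slice)
  have "F (0 *s cvec e + 1 *s cvec x + \<zeta> *s cvec y)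
     (\<lambda>j. 1 * of_real (b j) + \<zeta> * of_real (b' j)) \<noteq> 0"
    using assms by (intro H.stable_in_cone) (simp_all add: cone_def cvec_add cvec_scaleR add_ac)
  then show ?thesis by simp
qed

lemma cone_sum:
  assumes "finite K" "K \<noteq> {}" "\<And>k. k \<in> K \<Longrightarrow> cone (x k) (b k)"
  shows "cone (\<Sum>k\<in>K. x k) (\<lambda>j. \<Sum>k\<in>K. b k j)"
  using assms
proof (induction K rule: finite_ne_induct)
  case (insert k K)
  then show ?case using cone_add[of "x k" "b k"] by simp
qed simp

end

section \<open>Univariate polynomials with all zeros in the open lower half plane\<close>

text \<open>The logarithmic derivative is the sum of \<open>1 / (z - r)\<close> over the roots
  \<open>r\<close>. Every root lies strictly below \<open>z\<close>, so every summand has negative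
  imaginary part.\<close>

lemma upper_half_plane_log_deriv:
  fixes p :: "complex poly"
  assumes "p \<noteq> 0" and "\<And>z. poly p z = 0 \<Longrightarrow> Im z < 0" and "Im z \<ge> 0"
  shows "Im (poly (pderiv p) z / poly p z) \<le> 0 \<and>
    (degree p > 0 \<longrightarrow> Im (poly (pderiv p) z / poly p z) < 0)"
  using assms
proof (induction "degree p" arbitrary: p)
  case 0
  then obtain a where "p = [:a:]" by (metis degree_eq_zeroE)
  then show ?case using 0 by (simp add: pderiv_pCons)
next
  case (Suc n)
  then obtain r where r: "poly p r = 0"
    using fundamental_theorem_of_algebra[of p] by (auto simp: constant_degree)
  then obtain q where q: "p = [:-r, 1:] * q" by (metis dvdE poly_eq_0_iff_dvd)
  have "q \<noteq> 0" using Suc.prems q by auto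
  then have dq: "degree q = n" using Suc.hyps(2) q by (simp add: degree_mult_eq del: mult_pCons_left)
  have IH: "Im (poly (pderiv q) z / poly q z) \<le> 0"
    using Suc.hyps(1)[of q] dq Suc.prems q \<open>q \<noteq> 0\<close> by auto
  have "poly q z \<noteq> 0" using Suc.prems(2)[of z] Suc.prems(3) q by auto
  have rz: "Im r < 0" using Suc.prems(2) r by auto
  then have "z - r \<noteq> 0" using Suc.prems(3) by auto
  have "poly (pderiv p) z = (z - r) * poly (pderiv q) z + poly q z" "poly p z = (z - r) * poly q z"
    unfolding q pderiv_mult by (simp_all add: pderiv_pCons algebra_simps)
  then have "poly (pderiv p) z / poly p z = 1 / (z - r) + poly (pderiv q) z / poly q z"
    using \<open>poly q z \<noteq> 0\<close> \<open>z - r \<noteq> 0\<close> by (simp add: divide_simps)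
  moreover have "Im (1 / (z - r)) < 0"
  proof -
    have "(Re (z - r))\<^sup>2 + (Im (z - r))\<^sup>2 > 0"
      using \<open>z - r \<noteq> 0\<close> complex_neq_0 by blast
    then show ?thesis using rz Suc.prems(3) by (simp add: Im_divide divide_less_0_iff)
  qed
  ultimately show ?case using IH by simp
qed

lemma Gauss_Lucas_upper_half_plane:
  fixes p :: "complex poly"
  assumes "degree p > 0" and "\<And>z. poly p z = 0 \<Longrightarrow> Im z < 0" and "poly (pderiv p) z = 0"
  shows "Im z < 0"
proof (rule ccontr)
  assume "\<not> Im z < 0"
  then have "Im (poly (pderiv p) z / poly p z) < 0"
    using upper_half_plane_log_deriv[OF _ assms(2), of p z] assms(1) by fastforce
  then show False using assms(3) by simp
qed

text \<open>Up to a factorial, the coefficient is the value at 0 of the \<open>k\<close>-th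
  derivative, whose zeros stay in the open lower half plane by Gauss-Lucas.\<close>

lemma coeff_ne_0_if_stable:
  fixes p :: "complex poly"
  assumes "k \<le> degree p" "p \<noteq> 0" and "\<And>z. poly p z = 0 \<Longrightarrow> Im z < 0"
  shows "coeff p k \<noteq> 0"
  using assms
proof (induction k arbitrary: p)
  case 0
  from 0(3)[of 0] show ?case by (auto simp: poly_0_coeff_0)
next
  case (Suc k)
  have dp: "degree p > 0" using Suc.prems(1) by simp
  have "coeff (pderiv p) k \<noteq> 0"
  proof (rule Suc.IH)
    show "k \<le> degree (pderiv p)" using Suc.prems(1) by (simp add: degree_pderiv)
    show "pderiv p \<noteq> 0" using dp by (simp add: pderiv_eq_0_iff)
    show "Im z < 0" if "poly (pderiv p) z = 0" for z
      using Gauss_Lucas_upper_half_plane[of p z] dp Suc.prems(3) that by simp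
  qed
  then show ?case by (simp add: coeff_pderiv)
qed

subsection \<open>Rank-one vectors\<close>

lemma coeff_mult_top:
  fixes p q :: "'a::comm_semiring_0 poly"
  assumes "degree p \<le> m" "degree q \<le> n"
  shows "coeff (p * q) (m + n) = coeff p m * coeff q n"
proof -
  have "coeff (p * q) (m + n) = (\<Sum>i\<le>m + n. coeff p i * coeff q (m + n - i))"
    by (rule coeff_mult)
  also have "\<dots> = (\<Sum>i\<in>{m}. coeff p i * coeff q (m + n - i))"
  proof (rule sum.mono_neutral_right)
    show "\<forall>i\<in>{..m + n} - {m}. coeff p i * coeff q (m + n - i) = 0"
    proof
      fix i assume i: "i \<in> {..m + n} - {m}"
      show "coeff p i * coeff q (m + n - i) = 0"
      proof (cases "i < m")
        case True
        then have "coeff q (m + n - i) = 0" using assms by (intro coeff_eq_0) auto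
        then show ?thesis by simp
      next
        case False
        then have "coeff p i = 0" using assms i by (intro coeff_eq_0) auto
        then show ?thesis by simp
      qed
    qed
  qed auto
  finally show ?thesis by simp
qed

lemma linear_power_top:
  fixes a b :: "'a::comm_semiring_1"
  shows "degree ([:a, b:] ^ n) \<le> n \<and> coeff ([:a, b:] ^ n) n = b ^ n"
proof (induction n)
  case (Suc n)
  have "degree ([:a, b:] ^ Suc n) \<le> degree [:a, b:] + degree ([:a, b:] ^ n)"
    unfolding power_Suc by (rule degree_mult_le)
  also have "\<dots> \<le> Suc n" using Suc by (auto intro: order_trans[OF add_mono[of _ 1 _ n]])
  finally have "degree ([:a, b:] ^ Suc n) \<le> Suc n" .
  moreover have "coeff ([:a, b:] * [:a, b:] ^ n) (1 + n) = coeff [:a, b:] 1 * coeff ([:a, b:] ^ n) n"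
    by (rule coeff_mult_top) (use Suc in auto)
  ultimately show ?case using Suc by simp
qed simp

lemma prod_top:
  fixes f :: "'i \<Rightarrow> 'a::comm_semiring_1 poly"
  assumes "finite I" "\<And>i. i \<in> I \<Longrightarrow> degree (f i) \<le> n i"
  shows "degree (\<Prod>i\<in>I. f i) \<le> (\<Sum>i\<in>I. n i) \<and>
    coeff (\<Prod>i\<in>I. f i) (\<Sum>i\<in>I. n i) = (\<Prod>i\<in>I. coeff (f i) (n i))"
  using assms
proof (induction I rule: finite_induct)
  case (insert i I)
  have "degree (f i * (\<Prod>i\<in>I. f i)) \<le> n i + (\<Sum>i\<in>I. n i)"
    using insert by (intro order_trans[OF degree_mult_le add_mono]) auto
  then show ?case using insert by (simp add: coeff_mult_top)
qed simp

lemma infinite_range_of_real: "infinite (range complex_of_real)"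
  using finite_imageD[of complex_of_real UNIV] infinite_UNIV_char_0[where 'a = real]
  by (auto simp: inj_def)

lemma coeff_linear: "coeff [:a, b:] k = (if k = 0 then a else if k = 1 then b else 0)"
  by (auto simp: coeff_pCons split: nat.split)

section \<open>Restrictions of a homogeneous polynomial to complex lines\<close>

definition line_poly :: "(('n::finite \<Rightarrow> nat) \<Rightarrow> real) \<Rightarrow> complex ^ 'n \<Rightarrow> complex ^ 'n \<Rightarrow> complex poly" where
  "line_poly c z w = (\<Sum>\<alpha>\<in>poly_support c. smult (of_real (c \<alpha>)) (\<Prod>i\<in>UNIV. [:z $ i, w $ i:] ^ \<alpha> i))"

lemma poly_line_poly: "poly (line_poly c z w) t = peval c (z + t *s w)"
  by (simp add: line_poly_def peval_def poly_sum poly_prod mult.commute)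

text \<open>The top coefficient depends only on the direction. Hence a direction in the open cone
  makes the degree exactly \<open>d\<close> at every base point.\<close>

lemma line_poly_top:
  assumes "homogeneous_poly c d"
  shows "degree (line_poly c z w) \<le> d" "coeff (line_poly c z w) d = peval c w"
proof -
  have *: "degree (\<Prod>i\<in>UNIV. [:z $ i, w $ i:] ^ \<alpha> i) \<le> d"
    "coeff (\<Prod>i\<in>UNIV. [:z $ i, w $ i:] ^ \<alpha> i) d = (\<Prod>i\<in>UNIV. (w $ i) ^ \<alpha> i)"
    if "\<alpha> \<in> poly_support c" for \<alpha>
    using prod_top[of UNIV "\<lambda>i. [:z $ i, w $ i:] ^ \<alpha> i" \<alpha>] assms that
    by (auto simp: homogeneous_poly_def linear_power_top)
  then show "degree (line_poly c z w) \<le> d"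
    unfolding line_poly_def using assms
    by (intro degree_sum_le) (auto simp: homogeneous_poly_def intro: order_trans[OF degree_smult_le])
  show "coeff (line_poly c z w) d = peval c w"
    using * by (simp add: line_poly_def peval_def coeff_sum)
qed

lemma continuous_coeff_mult:
  fixes p q :: "'a::topological_space \<Rightarrow> complex poly"
  assumes "\<And>k. continuous_on S (\<lambda>x. coeff (p x) k)" "\<And>k. continuous_on S (\<lambda>x. coeff (q x) k)"
  shows "continuous_on S (\<lambda>x. coeff (p x * q x) k)"
  unfolding coeff_mult by (intro continuous_intros assms)

lemma holomorphic_coeff_mult:
  fixes p q :: "complex \<Rightarrow> complex poly"
  assumes "\<And>k. (\<lambda>x. coeff (p x) k) holomorphic_on S" "\<And>k. (\<lambda>x. coeff (q x) k) holomorphic_on S"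
  shows "(\<lambda>x. coeff (p x * q x) k) holomorphic_on S"
  unfolding coeff_mult by (intro holomorphic_intros assms)

lemma continuous_coeff_line_poly:
  fixes f g :: "'a::topological_space \<Rightarrow> complex ^ 'n::finite"
  assumes "continuous_on S f" "continuous_on S g"
  shows "continuous_on S (\<lambda>x. coeff (line_poly c (f x) (g x)) k)"
proof -
  have lin: "continuous_on S (\<lambda>x. coeff [:f x $ i, g x $ i:] k)" for i k
    unfolding coeff_linear by (cases "k = 0"; cases "k = 1") (auto intro!: continuous_intros assms)
  have pow: "continuous_on S (\<lambda>x. coeff ([:f x $ i, g x $ i:] ^ n) k)" for i n k
  proof (induction n arbitrary: k)
    case (Suc n)
    show ?case unfolding power_Suc by (rule continuous_coeff_mult[OF lin Suc])
  qed auto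
  have "continuous_on S (\<lambda>x. coeff (\<Prod>i\<in>I. [:f x $ i, g x $ i:] ^ \<alpha> i) k)" if "finite I" for I \<alpha> k
    using that
  proof (induction I arbitrary: k)
    case (insert i I)
    show ?case unfolding prod.insert[OF insert.hyps]
      by (rule continuous_coeff_mult[OF pow insert.IH])
  qed auto
  then show ?thesis
    unfolding line_poly_def coeff_sum coeff_smult by (intro continuous_intros) auto
qed

lemma holomorphic_coeff_line_poly:
  "(\<lambda>\<zeta>. coeff (line_poly c (z0 + \<zeta> *s z1) w) k) holomorphic_on S"
proof -
  have lin: "(\<lambda>\<zeta>. coeff [:(z0 + \<zeta> *s z1) $ i, w $ i:] k) holomorphic_on S" for i k
    unfolding coeff_linear by (cases "k = 0"; cases "k = 1") (auto intro!: holomorphic_intros)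
  have pow: "(\<lambda>\<zeta>. coeff ([:(z0 + \<zeta> *s z1) $ i, w $ i:] ^ n) k) holomorphic_on S" for i n k
  proof (induction n arbitrary: k)
    case (Suc n)
    show ?case unfolding power_Suc by (rule holomorphic_coeff_mult[OF lin Suc])
  qed auto
  have "(\<lambda>\<zeta>. coeff (\<Prod>i\<in>I. [:(z0 + \<zeta> *s z1) $ i, w $ i:] ^ \<alpha> i) k) holomorphic_on S"
    if "finite I" for I \<alpha> k
    using that
  proof (induction I arbitrary: k)
    case (insert i I)
    show ?case unfolding prod.insert[OF insert.hyps]
      by (rule holomorphic_coeff_mult[OF pow insert.IH])
  qed auto
  then show ?thesis
    unfolding line_poly_def coeff_sum coeff_smult by (intro holomorphic_intros) auto
qed

section \<open>The normalised polynomial, its open and closed cone, and propagation of rank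
  one\<close>

locale hyperbolic_polynomial =
  fixes c :: "('n::finite \<Rightarrow> nat) \<Rightarrow> real" and d :: nat and e :: "real ^ 'n"
  assumes hyperbolic: "hyperbolic c d e"
begin

lemma hom: "homogeneous_poly c d" and peval_e: "peval c e \<noteq> 0"
  using hyperbolic by (auto simp: hyperbolic_def)

definition N :: "complex ^ 'n \<Rightarrow> complex" where
  "N z = peval c z / of_real (peval c e)"

lemma peval_eq_N: "peval c z = of_real (peval c e) * N z"
  using peval_e by (simp add: N_def)

lemma N_hom: "N (k *s z) = k ^ d * N z"
  by (simp add: N_def peval_smult[OF hom])

lemma N_e: "N (cvec e) = 1"
  using peval_e by (simp add: N_def peval_cvec)

lemma N_cvec: "N (cvec x) = of_real (peval c x / peval c e)"
  by (simp add: N_def peval_cvec)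

lemma N_cont [continuous_intros]: "continuous_on S f \<Longrightarrow> continuous_on S (\<lambda>x. N (f x))"
  unfolding N_def using peval_e by (intro continuous_intros) auto

sublocale N: hyperbolic_function e d "\<lambda>z b. N z"
proof
  show "continuous_on UNIV (\<lambda>(\<alpha>, \<beta>, \<gamma>). N (\<alpha> *s z1 + \<beta> *s z2 + \<gamma> *s z3))" for z1 z2 z3
    unfolding case_prod_unfold by (intro continuous_intros)
  show "(\<lambda>t. N (z0 + t *s z1)) holomorphic_on UNIV" for z0 z1
    unfolding N_def using peval_e by (intro holomorphic_intros holomorphic_on_peval_line) auto
  show "N (cvec x + (\<i> * of_real s) *s cvec e) \<noteq> 0" if "s > 0" for x s
  proof
    assume 0: "N (cvec x + (\<i> * of_real s) *s cvec e) = 0"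
    have "cvec x + (\<i> * of_real s) *s cvec e =
      (\<chi> i. (\<i> * of_real s) * complex_of_real (e $ i) - complex_of_real ((- x) $ i))"
      by (simp add: vec_eq_iff)
    then have "peval c (\<chi> i. (\<i> * of_real s) * complex_of_real (e $ i) - complex_of_real ((- x) $ i)) = 0"
      using 0 peval_e by (simp add: N_def)
    then have "\<i> * of_real s \<in> \<real>"
      using hyperbolic unfolding hyperbolic_def by blast
    then show False using that by (simp add: complex_is_Real_iff)
  qed
qed (rule N_hom)

abbreviation pos_cone :: "real ^ 'n \<Rightarrow> bool" where
  "pos_cone x \<equiv> N.cone x (\<lambda>_. 0)"

lemma N_cone_any: "N.cone x b \<longleftrightarrow> pos_cone x"
  by (simp add: N.cone_def)

text \<open>The closed cone, described through the open one. Rank-one vectors have zero eigenvalues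
  when \<open>d \<ge> 2\<close> and then lie on its boundary.\<close>

definition psd :: "real ^ 'n \<Rightarrow> bool" where
  "psd w \<longleftrightarrow> (\<forall>\<eta>>0. pos_cone (w + \<eta> *\<^sub>R e))"

lemma pos_cone_e: "pos_cone e"
proof -
  have "N (cvec (e + s *\<^sub>R e)) \<noteq> 0" if "s \<ge> 0" for s
  proof -
    have "cvec (e + s *\<^sub>R e) = of_real (1 + s) *s cvec e"
      by (simp add: vec_eq_iff algebra_simps)
    moreover have "complex_of_real (1 + s) \<noteq> 0" using that by (simp only: of_real_eq_0_iff)
    ultimately show ?thesis by (simp only: N_hom N_e) simp
  qed
  then show ?thesis by (simp add: N.cone_def)
qed

lemma pos_cone_add: "pos_cone x \<Longrightarrow> pos_cone y \<Longrightarrow> pos_cone (x + y)"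
  using N.cone_add[of x "\<lambda>_. 0" y "\<lambda>_. 0"] by simp

lemma pos_cone_scale: "pos_cone x \<Longrightarrow> k > 0 \<Longrightarrow> pos_cone (k *\<^sub>R x)"
  using N.cone_scale[of x "\<lambda>_. 0" k] by simp

text \<open>The room \<open>\<eta>\<close> that openness leaves at \<open>x\<close> is handed over
  to \<open>w\<close>, which puts both summands into the open cone.\<close>

lemma pos_cone_add_psd:
  assumes "pos_cone x" "psd w" "t \<ge> 0"
  shows "pos_cone (x + t *\<^sub>R w)"
proof (cases "t = 0")
  case False
  obtain \<eta> where \<eta>: "\<eta> > 0" "pos_cone (x - \<eta> *\<^sub>R e)"
    using N.cone_open[OF assms(1)] by auto
  have "pos_cone (t *\<^sub>R (w + (\<eta> / t) *\<^sub>R e))"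
    using assms \<eta> False by (intro pos_cone_scale) (auto simp: psd_def)
  from pos_cone_add[OF \<eta>(2) this] show ?thesis
    using False by (simp add: scaleR_add_right)
qed (use assms in simp)

lemma psd_e: "psd e"
  using pos_cone_scale[OF pos_cone_e, of "1 + \<eta>" for \<eta>] by (simp add: psd_def scaleR_add_left)

text \<open>Dividing \<open>e + x + s e\<close> by \<open>1 + s\<close> gives a point no farther
  from \<open>e\<close> than \<open>e + x\<close>, so continuity of \<open>N\<close> at
  \<open>e\<close> settles the whole ray.\<close>

lemma pos_cone_near_e: "\<exists>r>0. \<forall>x. norm x < r \<longrightarrow> pos_cone (e + x)"
proof -
  have "continuous_on UNIV (\<lambda>x. N (cvec (e + x)))"
    by (intro continuous_intros)
  then have "isCont (\<lambda>x. N (cvec (e + x))) 0"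
    by (simp add: continuous_on_eq_continuous_at)
  then have "\<forall>\<^sub>F x in at 0. N (cvec (e + x)) \<noteq> 0"
    by (intro tendsto_imp_eventually_ne[of _ 1]) (auto simp: isCont_def N_e)
  then obtain r where r: "r > 0" "\<And>x. x \<noteq> 0 \<Longrightarrow> dist x 0 < r \<Longrightarrow> N (cvec (e + x)) \<noteq> 0"
    unfolding eventually_at by auto
  have "pos_cone (e + x)" if x: "norm x < r" for x
    unfolding N.cone_def
  proof (intro allI impI)
    fix s :: real assume s: "s \<ge> 0"
    have "cvec (e + x + s *\<^sub>R e) = of_real (1 + s) *s cvec (e + (1 / (1 + s)) *\<^sub>R x)"
      using s by (simp add: vec_eq_iff field_simps add_nonneg_eq_0_iff complex_eq_iff)
    moreover have "norm ((1 / (1 + s)) *\<^sub>R x) < r"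
    proof -
      have "norm x \<le> (1 + s) * norm x" using s by (simp add: algebra_simps)
      then have "norm x / (1 + s) \<le> norm x" using s by (simp add: divide_le_eq mult.commute)
      then show ?thesis using s x by simp
    qed
    then have "N (cvec (e + (1 / (1 + s)) *\<^sub>R x)) \<noteq> 0"
      using r(2)[of "(1 / (1 + s)) *\<^sub>R x"] N_e by (cases "(1 / (1 + s)) *\<^sub>R x = 0") (auto simp del: scaleR_eq_0_iff)
    moreover have "complex_of_real (1 + s) \<noteq> 0" using s by (simp only: of_real_eq_0_iff)
    ultimately show "N (cvec (e + x + s *\<^sub>R e)) \<noteq> 0"
      by (simp only: N_hom) simp
  qed
  then show ?thesis using r(1) by blast
qed

definition affine_at :: "real ^ 'n \<Rightarrow> complex ^ 'n \<Rightarrow> bool" where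
  "affine_at w z \<longleftrightarrow> (\<forall>t. N (z + t *s cvec w) = N z + t * (N (z + cvec w) - N z))"

lemma affine_at_scale:
  assumes "affine_at w z" "k \<noteq> 0"
  shows "affine_at w (k *s z)"
proof -
  have "N (k *s z + t *s cvec w) = k ^ d * (N z + (t / k) * (N (z + cvec w) - N z))" for t
  proof -
    have "k *s z + t *s cvec w = k *s (z + (t / k) *s cvec w)"
      using assms(2) by (simp add: vec_eq_iff field_simps)
    then have "N (k *s z + t *s cvec w) = k ^ d * N (z + (t / k) *s cvec w)"
      by (simp only: N_hom)
    then show ?thesis using assms(1) by (simp add: affine_at_def)
  qed
  note * = this
  have **: "N (k *s z + cvec w) = k ^ d * (N z + (1 / k) * (N (z + cvec w) - N z))"
    using *[of 1] by simp
  show ?thesis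
    unfolding affine_at_def * ** N_hom by (simp add: algebra_simps)
qed

text \<open>For fixed \<open>t\<close> the defect from affineness is a polynomial in
  \<open>\<sigma>\<close>; with infinitely many zeros it is 0.\<close>

lemma affine_at_continuation:
  assumes "infinite I" "\<And>\<sigma>. \<sigma> \<in> I \<Longrightarrow> affine_at w (z0 + \<sigma> *s z1)"
  shows "affine_at w (z0 + \<sigma> *s z1)"
  unfolding affine_at_def
proof
  fix t
  let ?Q = "\<lambda>z. line_poly c z z1"
  define P where "P = ?Q (z0 + t *s cvec w) - ?Q z0 - smult t (?Q (z0 + cvec w) - ?Q z0)"
  have P: "poly P \<sigma> = of_real (peval c e) * (N (z0 + \<sigma> *s z1 + t *s cvec w) - N (z0 + \<sigma> *s z1)
      - t * (N (z0 + \<sigma> *s z1 + cvec w) - N (z0 + \<sigma> *s z1)))" for \<sigma>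
    using peval_e by (simp add: P_def poly_line_poly N_def field_simps)
  have "P = 0"
  proof (rule ccontr)
    assume "P \<noteq> 0"
    then have "finite {\<sigma>. poly P \<sigma> = 0}" by (rule poly_roots_finite)
    moreover have "I \<subseteq> {\<sigma>. poly P \<sigma> = 0}"
      using assms(2) by (auto simp: P affine_at_def)
    ultimately show False using assms(1) finite_subset by blast
  qed
  then show "N (z0 + \<sigma> *s z1 + t *s cvec w) = N (z0 + \<sigma> *s z1) + t * (N (z0 + \<sigma> *s z1 + cvec w) - N (z0 + \<sigma> *s z1))"
    using P[of \<sigma>] peval_e by (simp only: poly_0) (simp add: diff_eq_eq)
qed

lemma line_poly_stable:
  assumes w: "pos_cone w" and y: "pos_cone y" and t: "poly (line_poly c (cvec x + \<i> *s cvec y) (cvec w)) t = 0"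
  shows "Im t < 0"
proof (rule ccontr)
  assume "\<not> Im t < 0"
  then have "psd w \<Longrightarrow> pos_cone (y + Im t *\<^sub>R w)" by (intro pos_cone_add_psd y) auto
  moreover have "psd w" unfolding psd_def using N.cone_add_e[OF w] by auto
  ultimately have "N (cvec (x + Re t *\<^sub>R w) + \<i> *s cvec (y + Im t *\<^sub>R w)) \<noteq> 0"
    by (intro N.cone_stable) auto
  moreover have "cvec x + \<i> *s cvec y + t *s cvec w = cvec (x + Re t *\<^sub>R w) + \<i> *s cvec (y + Im t *\<^sub>R w)"
    by (simp add: vec_eq_iff complex_eq_iff)
  ultimately show False using t by (simp add: poly_line_poly N_def)
qed

text \<open>For \<open>2 \<le> k \<le> d\<close> take the coefficient of \<open>t ^ k\<close> in
  \<open>h(i e + \<zeta> x + t (w + \<eta> e))\<close>. For \<open>\<eta> > 0\<close> it has no zero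
  \<open>\<zeta>\<close> in a strip around the real axis, by stability. As \<open>\<eta>\<close>
  tends to 0, Hurwitz leaves a function that is zero-free or constant; by \<open>aff\<close> it
  vanishes at \<open>\<zeta> = 0\<close>, hence also at \<open>\<zeta> = 1\<close>.\<close>

lemma affine_at_upper:
  assumes w: "psd w" and aff: "\<And>t::real. N (cvec (e + t *\<^sub>R w)) = 1 + of_real (t * \<mu>)"
  shows "affine_at w (cvec x + \<i> *s cvec e)"
proof -
  obtain r where r: "r > 0" "\<And>x. norm x < r \<Longrightarrow> pos_cone (e + x)"
    using pos_cone_near_e by auto
  \<comment> \<open>Width of the strip on which \<open>e + Im \<zeta> x\<close> stays in the ball of
    radius \<open>r\<close> around \<open>e\<close>; the summand 1 guards against
    \<open>x = 0\<close>.\<close>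
  define \<tau> where "\<tau> = r / (norm x + 1)"
  have \<tau>: "\<tau> > 0" using r(1) by (simp add: \<tau>_def add_nonneg_pos)
  define S where "S = {\<zeta>. Im \<zeta> > - \<tau>} \<inter> {\<zeta>. Im \<zeta> < \<tau>}"
  have near: "pos_cone (e + Im \<zeta> *\<^sub>R x)" if "\<zeta> \<in> S" for \<zeta>
  proof (rule r(2))
    have "norm (Im \<zeta> *\<^sub>R x) \<le> \<bar>Im \<zeta>\<bar> * (norm x + 1)"
      by (simp add: algebra_simps)
    also have "\<dots> < \<tau> * (norm x + 1)"
      using that by (intro mult_strict_right_mono) (auto simp: S_def add_nonneg_pos)
    also have "\<dots> = r" by (simp add: \<tau>_def add_nonneg_eq_0_iff)
    finally show "norm (Im \<zeta> *\<^sub>R x) < r" .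
  qed
  define p where "p = (\<lambda>k \<eta> \<zeta>. coeff (line_poly c (\<i> *s cvec e + \<zeta> *s cvec x) (cvec (w + \<eta> *\<^sub>R e))) k)"
  have nz: "p k \<eta> \<zeta> \<noteq> 0" if "\<eta> > 0" "\<zeta> \<in> S" "k \<le> d" for k \<eta> \<zeta>
  proof -
    let ?L = "line_poly c (\<i> *s cvec e + \<zeta> *s cvec x) (cvec (w + \<eta> *\<^sub>R e))"
    have pw: "pos_cone (w + \<eta> *\<^sub>R e)" using w that(1) by (auto simp: psd_def)
    then have "peval c (cvec (w + \<eta> *\<^sub>R e)) \<noteq> 0"
      using N.cone_imp_ne_0[OF pw] by (auto simp: N_def)
    then have top: "coeff ?L d \<noteq> 0" by (simp add: line_poly_top(2)[OF hom])
    have "\<i> *s cvec e + \<zeta> *s cvec x = cvec (Re \<zeta> *\<^sub>R x) + \<i> *s cvec (e + Im \<zeta> *\<^sub>R x)"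
      by (simp add: vec_eq_iff complex_eq_iff)
    then have "Im t < 0" if "poly ?L t = 0" for t
      using line_poly_stable[OF pw near[OF \<open>\<zeta> \<in> S\<close>], of "Re \<zeta> *\<^sub>R x" t] that by simp
    moreover have "k \<le> degree ?L" using le_degree[OF top] that(3) by simp
    ultimately show ?thesis unfolding p_def using top by (intro coeff_ne_0_if_stable) auto
  qed
  have aff_ie: "affine_at w (\<i> *s cvec e)"
  proof (rule affine_at_scale)
    have inf: "infinite (range complex_of_real)"
      by (rule infinite_range_of_real)
    have "line_poly c (cvec e) (cvec w) = smult (of_real (peval c e)) [:1, of_real \<mu>:]"
    proof (rule ccontr)
      assume "line_poly c (cvec e) (cvec w) \<noteq> smult (of_real (peval c e)) [:1, of_real \<mu>:]"
      then have "finite {t. poly (line_poly c (cvec e) (cvec w) - smult (of_real (peval c e)) [:1, of_real \<mu>:]) t = 0}"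
        by (intro poly_roots_finite) auto
      moreover have "range complex_of_real \<subseteq> {t. poly (line_poly c (cvec e) (cvec w) - smult (of_real (peval c e)) [:1, of_real \<mu>:]) t = 0}"
        using aff peval_e by (auto simp: poly_line_poly N_def cvec_add cvec_scaleR field_simps)
      ultimately show False using inf finite_subset by blast
    qed
    then have "N (cvec e + t *s cvec w) = 1 + t * of_real \<mu>" for t
      using peval_e poly_line_poly[of c "cvec e" "cvec w" t] by (simp add: N_def field_simps)
    from this this[of 1] show "affine_at w (cvec e)"
      by (simp add: affine_at_def N_e)
  qed simp
  have "coeff (line_poly c (\<i> *s cvec e) (cvec w)) k = 0" if "k \<ge> 2" for k
  proof -
    let ?h = "complex_of_real (peval c e)"
    have "line_poly c (\<i> *s cvec e) (cvec w) =
      smult ?h [:N (\<i> *s cvec e), N (\<i> *s cvec e + cvec w) - N (\<i> *s cvec e):]"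
      unfolding poly_eq_poly_eq_iff[symmetric]
    proof
      fix t
      show "poly (line_poly c (\<i> *s cvec e) (cvec w)) t =
        poly (smult ?h [:N (\<i> *s cvec e), N (\<i> *s cvec e + cvec w) - N (\<i> *s cvec e):]) t"
        using aff_ie unfolding affine_at_def by (simp add: poly_line_poly peval_eq_N distrib_left mult.left_commute)
    qed
    then show ?thesis using that by (simp add: coeff_pCons split: nat.split)
  qed
  then have p00: "p k 0 0 = 0" if "k \<ge> 2" for k using that by (simp add: p_def)
  have S: "open S" "connected S"
    unfolding S_def
    by (auto intro!: open_Int open_halfspace_Im_gt open_halfspace_Im_lt convex_connected convex_Int
          convex_halfspace_Im_gt convex_halfspace_Im_lt)
  have "0 \<in> S" "1 \<in> S" using \<tau> by (auto simp: S_def)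
  have p01: "p k 0 1 = 0" if k: "k \<ge> 2" for k
  proof (cases "k \<le> d")
    case True
    have "p k 0 constant_on S"
    proof (rule ccontr)
      assume nc: "\<not> p k 0 constant_on S"
      have "p k 0 0 \<noteq> 0"
      proof (rule Hurwitz_parametric[OF S, where p = "p k" and T = "{0..1}" and s = "\<lambda>n. inverse (of_nat (Suc n))"])
        have "continuous_on ({0..1} \<times> S) (\<lambda>x. p k (fst x) (snd x))"
          unfolding p_def by (intro continuous_coeff_line_poly continuous_intros)
        then show "continuous_on ({0..1} \<times> S) (\<lambda>(t, z). p k t z)"
          by (simp add: case_prod_unfold)
        show "p k \<eta> holomorphic_on S" for \<eta>
          unfolding p_def by (rule holomorphic_coeff_line_poly)
        show "inverse (real (Suc n)) \<in> {0..1}" for n by (simp add: inverse_eq_divide)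
        show "(\<lambda>n. inverse (real (Suc n))) \<longlonglongrightarrow> 0" by (rule LIMSEQ_inverse_real_of_nat)
        show "p k (inverse (real (Suc n))) z \<noteq> 0" if "z \<in> S" for n z
          using that True by (intro nz) auto
      qed (use nc \<open>0 \<in> S\<close> in auto)
      then show False using p00[OF k] by simp
    qed
    then show ?thesis using \<open>0 \<in> S\<close> \<open>1 \<in> S\<close> p00[OF k] by (metis constant_on_def)
  next
    case False
    then have "d < k" by simp
    then show ?thesis unfolding p_def
      by (intro coeff_eq_0) (rule le_less_trans[OF line_poly_top(1)[OF hom]])
  qed
  define P where "P = line_poly c (cvec x + \<i> *s cvec e) (cvec w)"
  have Pt: "poly P t = of_real (peval c e) * N (cvec x + \<i> *s cvec e + t *s cvec w)" for t
    using peval_e by (simp add: P_def poly_line_poly N_def)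
  have P0: "coeff P k = 0" if "k \<ge> 2" for k
    using p01[OF that] by (simp add: p_def P_def add.commute)
  have P: "P = [:coeff P 0, coeff P 1:]"
  proof (rule poly_eqI)
    fix k
    show "coeff P k = coeff [:coeff P 0, coeff P 1:] k"
      using P0[of k] by (cases "k \<ge> 2") (auto simp: coeff_linear not_le less_2_cases_iff)
  qed
  show ?thesis
    unfolding affine_at_def
  proof
    fix t
    show "N (cvec x + \<i> *s cvec e + t *s cvec w) = N (cvec x + \<i> *s cvec e) +
        t * (N (cvec x + \<i> *s cvec e + cvec w) - N (cvec x + \<i> *s cvec e))"
    proof -
      have "poly P s = coeff P 0 + s * coeff P 1" for s
        using arg_cong[OF P, of "\<lambda>p. poly p s"] by simp
      then have "poly P t = poly P 0 + t * (poly P 1 - poly P 0)" by simp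
      then have "complex_of_real (peval c e) * N (cvec x + \<i> *s cvec e + t *s cvec w) =
          complex_of_real (peval c e) * (N (cvec x + \<i> *s cvec e) +
          t * (N (cvec x + \<i> *s cvec e + cvec w) - N (cvec x + \<i> *s cvec e)))"
        unfolding Pt by (simp add: algebra_simps)
      then show ?thesis using peval_e by simp
    qed
  qed
qed

text \<open>Scaling reaches \<open>x + i s e\<close> for all \<open>s > 0\<close>; continuation in
  the coefficient of \<open>e\<close> reaches the real points; continuation in
  \<open>\<sigma>\<close> from real values to \<open>i\<close> reaches every
  \<open>x + i y\<close>.\<close>

lemma affine_at_everywhere:
  assumes w: "psd w" and aff: "\<And>t::real. N (cvec (e + t *\<^sub>R w)) = 1 + of_real (t * \<mu>)"
  shows "affine_at w z"
proof -
  have "affine_at w (cvec x + \<sigma> *s cvec e)" if \<sigma>: "\<sigma> \<in> (\<lambda>s. \<i> * complex_of_real s) ` {0<..}" for x \<sigma>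
  proof -
    obtain s where s: "s > 0" "\<sigma> = \<i> * complex_of_real s"
      using \<sigma> unfolding image_iff by auto
    have "cvec x + \<sigma> *s cvec e = of_real s *s (cvec ((1 / s) *\<^sub>R x) + \<i> *s cvec e)"
      using s by (simp add: vec_eq_iff field_simps)
    then show ?thesis
      using affine_at_scale[OF affine_at_upper[OF w aff]] s(1) by simp
  qed
  moreover have "infinite ((\<lambda>s. \<i> * complex_of_real s) ` {0<..})"
  proof -
    have "infinite {0::real<..}" by (rule infinite_Ioi)
    moreover have "inj_on (\<lambda>s. \<i> * complex_of_real s) {0<..}" by (simp add: inj_on_def)
    ultimately show ?thesis using finite_imageD by blast
  qed
  ultimately have "affine_at w (cvec x + 0 *s cvec e)" for x
    by - (rule affine_at_continuation[where I = "(\<lambda>s. \<i> * complex_of_real s) ` {0<..}"])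
  then have real: "affine_at w (cvec x)" for x by simp
  define x where "x = (\<chi> i. Re (z $ i))"
  define y where "y = (\<chi> i. Im (z $ i))"
  have "infinite (range complex_of_real)"
    by (rule infinite_range_of_real)
  moreover have "affine_at w (cvec x + \<sigma> *s cvec y)" if "\<sigma> \<in> range complex_of_real" for \<sigma>
    using that real by (auto simp flip: cvec_add cvec_scaleR)
  ultimately have "affine_at w (cvec x + \<i> *s cvec y)"
    by (rule affine_at_continuation[where I = "range complex_of_real"])
  moreover have "cvec x + \<i> *s cvec y = z"
    by (simp add: x_def y_def vec_eq_iff complex_eq_iff)
  ultimately show ?thesis by simp
qed

end

subsection \<open>Barrier functions\<close>

text \<open>As \<open>\<phi>\<close> is real at \<open>\<sigma>\<close>, its difference quotient
  with step \<open>i \<eta>\<close> has real part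
  \<open>Im (\<phi> (\<sigma> + i \<eta>)) / \<eta>\<close>.\<close>

lemma Re_deriv_nonpos_if_Im_nonpos:
  assumes D: "(\<phi> has_field_derivative D) (at (complex_of_real \<sigma>))"
    and Im: "\<And>\<eta>. \<eta> > 0 \<Longrightarrow> Im (\<phi> (of_real \<sigma> + \<i> * of_real \<eta>)) \<le> 0"
    and real: "Im (\<phi> (of_real \<sigma>)) = 0"
  shows "Re D \<le> 0"
proof -
  define q where "q = (\<lambda>y. (\<phi> y - \<phi> (of_real \<sigma>)) / (y - of_real \<sigma>))"
  have "(q \<longlongrightarrow> D) (at (of_real \<sigma>))"
    using D unfolding has_field_derivative_iff q_def .
  moreover have "filterlim (\<lambda>\<eta>. complex_of_real \<sigma> + \<i> * of_real \<eta>) (at (of_real \<sigma>)) (at_right 0)"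
    unfolding filterlim_at
  proof
    show "\<forall>\<^sub>F \<eta> in at_right 0. complex_of_real \<sigma> + \<i> * of_real \<eta> \<in> UNIV \<and>
        complex_of_real \<sigma> + \<i> * of_real \<eta> \<noteq> complex_of_real \<sigma>"
      by (auto simp: eventually_at_filter)
    have "((\<lambda>\<eta>. complex_of_real \<sigma> + \<i> * of_real \<eta>) \<longlongrightarrow> complex_of_real \<sigma> + \<i> * of_real 0) (at_right 0)"
      by (intro tendsto_intros)
    then show "((\<lambda>\<eta>. complex_of_real \<sigma> + \<i> * of_real \<eta>) \<longlongrightarrow> complex_of_real \<sigma>) (at_right 0)"
      by simp
  qed
  ultimately have "((\<lambda>\<eta>. q (complex_of_real \<sigma> + \<i> * of_real \<eta>)) \<longlongrightarrow> D) (at_right 0)"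
    by (rule filterlim_compose)
  then have "((\<lambda>\<eta>. Re (q (complex_of_real \<sigma> + \<i> * of_real \<eta>))) \<longlongrightarrow> Re D) (at_right 0)"
    by (rule tendsto_Re)
  moreover have "\<forall>\<^sub>F \<eta> in at_right 0. Re (q (complex_of_real \<sigma> + \<i> * of_real \<eta>)) \<le> 0"
  proof (rule eventually_at_rightI[of 0 1])
    fix \<eta> :: real assume "\<eta> \<in> {0<..<1}"
    then have \<eta>: "\<eta> > 0" by simp
    have "Re (X / (\<i> * of_real \<eta>)) = Im X / \<eta>" for X
      using \<eta> by (simp add: Re_divide power2_eq_square)
    then show "Re (q (complex_of_real \<sigma> + \<i> * of_real \<eta>)) \<le> 0"
      using Im[OF \<eta>] real \<eta> by (simp add: q_def divide_nonpos_pos)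
  qed simp
  ultimately show ?thesis
    by (intro tendsto_upperbound) auto
qed

lemma has_field_derivative_Re_of_real:
  assumes "(\<phi> has_field_derivative D) (at (complex_of_real \<sigma>))"
  shows "((\<lambda>s. Re (\<phi> (of_real s))) has_field_derivative Re D) (at \<sigma>)"
proof -
  have "((\<lambda>s. \<phi> (of_real s)) has_vector_derivative D) (at \<sigma>)"
    using assms by (rule has_vector_derivative_real_field)
  then have "((\<lambda>s. Re (\<phi> (of_real s))) has_vector_derivative Re D) (at \<sigma>)"
    by (rule bounded_linear.has_vector_derivative[OF bounded_linear_Re])
  then show ?thesis by (simp add: has_real_derivative_iff_has_vector_derivative)
qed

lemma harmonic_arithmetic_mean:
  fixes a1 a2 \<theta> :: real
  assumes "a1 > 0" "a2 > 0" "0 \<le> \<theta>" "\<theta> \<le> 1"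
  shows "1 \<le> ((1 - \<theta>) / a1 + \<theta> / a2) * ((1 - \<theta>) * a1 + \<theta> * a2)"
proof -
  have "((1 - \<theta>) / a1 + \<theta> / a2) * ((1 - \<theta>) * a1 + \<theta> * a2) - 1 = \<theta> * (1 - \<theta>) * (a1 - a2)\<^sup>2 / (a1 * a2)"
    using assms(1,2) by (simp add: field_simps power2_eq_square)
  also have "\<dots> \<ge> 0" using assms by (intro divide_nonneg_pos mult_nonneg_nonneg) auto
  finally show ?thesis by simp
qed

locale rank_one_family = hyperbolic_polynomial c d e
  for c :: "('n::finite \<Rightarrow> nat) \<Rightarrow> real" and d e +
  fixes W :: "(real ^ 'n) set"
  assumes W_psd: "w \<in> W \<Longrightarrow> psd w" and W_affine: "w \<in> W \<Longrightarrow> affine_at w z"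

text \<open>The invariant of the mixing operators. \<open>F_stable\<close> allows every
  \<open>y\<close> in the cone, not only multiples of \<open>e\<close>, because the sign argument in
  \<open>Im_diff_quotient_nonpos\<close> adds \<open>Im t\<close> times \<open>w\<close> to
  \<open>y\<close>.\<close>

locale stable_family = rank_one_family c d e W
  for c :: "('n::finite \<Rightarrow> nat) \<Rightarrow> real" and d e W +
  fixes F :: "complex ^ 'n \<Rightarrow> (nat \<Rightarrow> complex) \<Rightarrow> complex"
  assumes F_continuous: "\<And>z1 z2 z3 b1 b2 b3. continuous_on UNIV
      (\<lambda>(\<alpha>, \<beta>, \<gamma>). F (\<alpha> *s z1 + \<beta> *s z2 + \<gamma> *s z3) (\<lambda>j. \<alpha> * b1 j + \<beta> * b2 j + \<gamma> * b3 j))"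
    and F_holomorphic: "\<And>z0 z1 b0 b1. (\<lambda>t. F (z0 + t *s z1) (\<lambda>j. b0 j + t * b1 j)) holomorphic_on UNIV"
    and F_homogeneous: "\<And>k z b. F (k *s z) (\<lambda>j. k * b j) = k ^ d * F z b"
    and F_real: "\<And>x b. F (cvec x) (\<lambda>j. of_real (b j)) \<in> \<real>"
    and F_affine: "\<And>w z b t. w \<in> W \<Longrightarrow> F (z + t *s cvec w) b = F z b + t * (F (z + cvec w) b - F z b)"
    and F_stable: "\<And>x y b. pos_cone y \<Longrightarrow> F (cvec x + \<i> *s cvec y) (\<lambda>j. of_real (b j)) \<noteq> 0"
    and F_0: "\<And>z. F z (\<lambda>_. 0) = N z"
    and F_differentiable: "\<And>x b. (\<lambda>x. Re (F (cvec x) (\<lambda>j. of_real (b j)))) differentiable (at x)"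
begin

sublocale F: hyperbolic_function e d F
proof
  show "F (cvec x + (\<i> * of_real s) *s cvec e) (\<lambda>j. complex_of_real (b j)) \<noteq> 0" if "s > 0" for x b s
    using F_stable[of "s *\<^sub>R e" x b] pos_cone_scale[OF pos_cone_e that]
    by (simp add: cvec_scaleR vector_smult_assoc)
qed (fact F_continuous F_holomorphic F_homogeneous)+

text \<open>If the quotient \<open>a\<close> is nonzero, the affine function along \<open>w\<close>
  has the root \<open>t = - 1 / a\<close>. Stability puts \<open>t\<close> in the open lower half
  plane, and \<open>a = - 1 / t\<close> lies there too. The second claim is the case of equality,
  for \<open>stable_family_mix\<close>.\<close>

lemma Im_diff_quotient_nonpos:
  fixes x y :: "real ^ 'n" and b :: "nat \<Rightarrow> real"
  assumes w: "w \<in> W" and y: "pos_cone y"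
  defines "z \<equiv> cvec x + \<i> *s cvec y" and "b' \<equiv> \<lambda>j. complex_of_real (b j)"
  shows "Im ((F (z + cvec w) b' - F z b') / F z b') \<le> 0"
    and "Im ((F (z + cvec w) b' - F z b') / F z b') = 0 \<Longrightarrow> F (z + cvec w) b' = F z b'"
proof -
  let ?a = "(F (z + cvec w) b' - F z b') / F z b'"
  have nz: "F z b' \<noteq> 0" unfolding z_def b'_def by (rule F_stable[OF y])
  have neg: "Im ?a < 0" if ne: "F (z + cvec w) b' \<noteq> F z b'"
  proof -
    define t where "t = - (1 / ?a)"
    have a0: "?a \<noteq> 0" using ne nz by simp
    have "F (z + t *s cvec w) b' = F z b' * (1 + t * ?a)"
      using nz by (simp add: F_affine[OF w] field_simps)
    also have "\<dots> = 0" using a0 by (simp add: t_def)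
    finally have 0: "F (z + t *s cvec w) b' = 0" .
    have "Im t < 0"
    proof (rule ccontr)
      assume "\<not> Im t < 0"
      then have "pos_cone (y + Im t *\<^sub>R w)" by (intro pos_cone_add_psd y W_psd w) auto
      then have "F (cvec (x + Re t *\<^sub>R w) + \<i> *s cvec (y + Im t *\<^sub>R w)) b' \<noteq> 0"
        unfolding b'_def by (rule F_stable)
      moreover have "z + t *s cvec w = cvec (x + Re t *\<^sub>R w) + \<i> *s cvec (y + Im t *\<^sub>R w)"
        by (simp add: z_def vec_eq_iff complex_eq_iff)
      ultimately show False using 0 by simp
    qed
    moreover have "?a = - (1 / t)" by (simp add: t_def)
    moreover have "Im (- (1 / t)) = Im t / ((Re t)\<^sup>2 + (Im t)\<^sup>2)" by (simp add: Im_divide)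
    moreover have "t \<noteq> 0" using a0 by (simp add: t_def)
    then have "(Re t)\<^sup>2 + (Im t)\<^sup>2 > 0" using complex_neq_0 by blast
    ultimately show ?thesis by (simp add: divide_neg_pos)
  qed
  show "Im ?a \<le> 0" using neg by (cases "F (z + cvec w) b' = F z b'") auto
  show "Im ?a = 0 \<Longrightarrow> F (z + cvec w) b' = F z b'" using neg by force
qed

definition f :: "(nat \<Rightarrow> real) \<Rightarrow> real ^ 'n \<Rightarrow> real" where
  "f b x = Re (F (cvec x) (\<lambda>j. of_real (b j)))"

definition increment :: "real ^ 'n \<Rightarrow> (nat \<Rightarrow> real) \<Rightarrow> real ^ 'n \<Rightarrow> real" where
  "increment w b x = f b (x + w) - f b x"

text \<open>The logarithmic derivative of \<open>f\<close> in direction \<open>w\<close>; affineness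
  turns the derivative into a difference.\<close>

definition barrier :: "real ^ 'n \<Rightarrow> (nat \<Rightarrow> real) \<Rightarrow> real ^ 'n \<Rightarrow> real" where
  "barrier w b x = increment w b x / f b x"

lemma F_eq_f: "F (cvec x) (\<lambda>j. of_real (b j)) = of_real (f b x)"
  using F_real[of x b] by (auto simp: f_def complex_is_Real_iff complex_eq_iff)

lemma cone_iff: "F.cone x b \<longleftrightarrow> (\<forall>s\<ge>0. f b (x + s *\<^sub>R e) \<noteq> 0)"
  by (simp add: F.cone_def F_eq_f)

lemma f_affine: "w \<in> W \<Longrightarrow> f b (x + t *\<^sub>R w) = f b x + t * increment w b x"
  using F_affine[of w "cvec x" "of_real t" "\<lambda>j. of_real (b j)"]
  by (simp add: increment_def f_def cvec_add cvec_scaleR)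

lemma cone_of_pos_cone: "pos_cone x \<Longrightarrow> F.cone x (\<lambda>_. 0)"
  by (simp add: F.cone_def N.cone_def F_0)

lemma cone_add_psd:
  assumes "F.cone x b" "psd w" "t \<ge> 0"
  shows "F.cone (x + t *\<^sub>R w) b"
proof (cases "t = 0")
  case False
  obtain \<eta> where \<eta>: "\<eta> > 0" "F.cone (x - \<eta> *\<^sub>R e) b"
    using F.cone_open[OF assms(1)] by auto
  have "pos_cone (t *\<^sub>R (w + (\<eta> / t) *\<^sub>R e))"
    using assms \<eta> False by (intro pos_cone_scale) (auto simp: psd_def)
  from F.cone_add[OF \<eta>(2) cone_of_pos_cone[OF this]] show ?thesis
    using False by (simp add: scaleR_add_right)
qed (use assms in simp)

text \<open>The segment from \<open>(e, 0)\<close>, where \<open>f\<close> is 1, to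
  \<open>(x, b)\<close> stays in the cone, so \<open>f\<close> cannot change sign on it.\<close>

lemma f_pos:
  assumes "F.cone x b"
  shows "f b x > 0"
proof -
  define g where "g = (\<lambda>\<theta>::real. f (\<lambda>j. \<theta> * b j) ((1 - \<theta>) *\<^sub>R e + \<theta> *\<^sub>R x))"
  have "continuous_on UNIV (\<lambda>\<theta>. Re ((\<lambda>(\<alpha>, \<beta>, \<gamma>). F (\<alpha> *s cvec e + \<beta> *s cvec x + \<gamma> *s cvec x)
      (\<lambda>j. \<alpha> * 0 + \<beta> * of_real (b j) + \<gamma> * of_real (b j))) (of_real (1 - \<theta>), of_real \<theta>, 0)))"
    by (intro continuous_intros continuous_on_compose2[OF F_continuous]) auto
  then have cont: "continuous_on {0..1} g"
    by (auto simp: g_def f_def cvec_add cvec_scaleR intro: continuous_on_subset)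
  have nz: "g \<theta> \<noteq> 0" if "\<theta> \<in> {0..1}" for \<theta>
  proof (cases "\<theta> = 0")
    case False
    then have "F.cone (\<theta> *\<^sub>R x + (1 - \<theta>) *\<^sub>R e) (\<lambda>j. \<theta> * b j)"
      using that assms by (intro F.cone_add_e F.cone_scale) auto
    then show ?thesis using F.cone_imp_ne_0[of "\<theta> *\<^sub>R x + (1 - \<theta>) *\<^sub>R e" "\<lambda>j. \<theta> * b j"]
      by (simp add: g_def F_eq_f add.commute del: of_real_mult)
  qed (simp add: g_def f_def F_0 N_e)
  have "g 0 = 1" by (simp add: g_def f_def F_0 N_e)
  have "g 1 > 0"
  proof (rule ccontr)
    assume "\<not> g 1 > 0"
    then obtain \<theta> where "\<theta> \<ge> 0" "\<theta> \<le> 1" "g \<theta> = 0"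
      using IVT2'[of g 1 0 0] cont \<open>g 0 = 1\<close> by auto
    then show False using nz by auto
  qed
  then show ?thesis by (simp add: g_def)
qed

text \<open>A negative slope would bring the affine function \<open>f\<close> to 0 at some
  \<open>x + t w\<close> with \<open>t \<ge> 0\<close>, which is still in the cone.\<close>

lemma barrier_nonneg:
  assumes x: "F.cone x b" and w: "w \<in> W"
  shows "barrier w b x \<ge> 0" "increment w b x \<ge> 0"
proof -
  show *: "increment w b x \<ge> 0"
  proof (rule ccontr)
    assume neg: "\<not> increment w b x \<ge> 0"
    define t where "t = f b x / - increment w b x"
    have "t \<ge> 0" using neg f_pos[OF x] by (simp add: t_def divide_nonneg_neg)
    then have "f b (x + t *\<^sub>R w) > 0" by (intro f_pos cone_add_psd x W_psd w)
    moreover have "f b (x + t *\<^sub>R w) = 0"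
      using neg unfolding f_affine[OF w] t_def by simp
    ultimately show False by simp
  qed
  show "barrier w b x \<ge> 0" using * f_pos[OF x] by (simp add: barrier_def)
qed

text \<open>As a function of the complex coefficient of \<open>e\<close>, the quotient is real on
  the axis and has nonpositive imaginary part above it, so its real derivative is
  nonpositive.\<close>

lemma barrier_antimono_e:
  assumes x: "F.cone x b" and w: "w \<in> W" and s: "s \<ge> 0"
  shows "barrier w b (x + s *\<^sub>R e) \<le> barrier w b x"
proof -
  define b' where "b' = (\<lambda>j. complex_of_real (b j))"
  define A where "A = (\<lambda>s. F (cvec x + s *s cvec e) b')"
  define B where "B = (\<lambda>s. F (cvec x + cvec w + s *s cvec e) b')"
  define \<phi> where "\<phi> = (\<lambda>s. (B s - A s) / A s)"
  have hA: "A holomorphic_on UNIV" and hB: "B holomorphic_on UNIV"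
    unfolding A_def B_def
    using F_holomorphic[of _ "cvec e" b' "\<lambda>_. 0"] by simp_all
  have real: "A (of_real \<sigma>) = of_real (f b (x + \<sigma> *\<^sub>R e))"
    "\<phi> (of_real \<sigma>) = of_real (barrier w b (x + \<sigma> *\<^sub>R e))" for \<sigma>
  proof -
    show A: "A (of_real \<sigma>) = of_real (f b (x + \<sigma> *\<^sub>R e))"
      by (simp add: A_def b'_def cvec_add cvec_scaleR flip: F_eq_f)
    have "B (of_real \<sigma>) = of_real (f b (x + \<sigma> *\<^sub>R e + w))"
      by (simp add: B_def b'_def cvec_add cvec_scaleR add_ac flip: F_eq_f)
    then show "\<phi> (of_real \<sigma>) = of_real (barrier w b (x + \<sigma> *\<^sub>R e))"
      using A by (simp add: \<phi>_def barrier_def increment_def)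
  qed
  have "\<exists>y. ((\<lambda>s. barrier w b (x + s *\<^sub>R e)) has_real_derivative y) (at \<sigma>) \<and> y \<le> 0"
    if "0 \<le> \<sigma>" "\<sigma> \<le> s" for \<sigma>
  proof -
    have "A (of_real \<sigma>) \<noteq> 0" using x that by (simp add: real cone_iff)
    moreover obtain A' B' where "(A has_field_derivative A') (at (of_real \<sigma>))"
      "(B has_field_derivative B') (at (of_real \<sigma>))"
      using hA hB by (metis UNIV_I field_differentiable_def holomorphic_on_imp_differentiable_at open_UNIV)
    ultimately obtain D where D: "(\<phi> has_field_derivative D) (at (of_real \<sigma>))"
      unfolding \<phi>_def using DERIV_divide[OF DERIV_diff] by blast
    have "Re D \<le> 0"
    proof (rule Re_deriv_nonpos_if_Im_nonpos[OF D])
      fix \<eta> :: real assume "\<eta> > 0"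
      then have cone: "pos_cone (\<eta> *\<^sub>R e)" by (intro pos_cone_scale pos_cone_e)
      have z: "cvec x + (of_real \<sigma> + \<i> * of_real \<eta>) *s cvec e = cvec (x + \<sigma> *\<^sub>R e) + \<i> *s cvec (\<eta> *\<^sub>R e)"
        "cvec x + cvec w + (of_real \<sigma> + \<i> * of_real \<eta>) *s cvec e =
          cvec (x + \<sigma> *\<^sub>R e) + \<i> *s cvec (\<eta> *\<^sub>R e) + cvec w"
        by (simp_all add: vec_eq_iff algebra_simps)
      show "Im (\<phi> (of_real \<sigma> + \<i> * of_real \<eta>)) \<le> 0"
        unfolding \<phi>_def A_def B_def b'_def z by (rule Im_diff_quotient_nonpos(1)[OF w cone])
    qed (simp add: real)
    then show ?thesis
      using has_field_derivative_Re_of_real[OF D] by (auto simp: real)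
  qed
  from DERIV_nonpos_imp_nonincreasing[OF s this] show ?thesis by simp
qed

text \<open>\<open>f\<close> at \<open>y - r w\<close> is
  \<open>f b y * (1 - r * barrier w b y)\<close>. Monotonicity along \<open>e\<close> keeps the
  second factor positive on the whole ray once it is positive at \<open>x\<close>.\<close>

lemma cone_diff_iff:
  assumes x: "F.cone x b" and w: "w \<in> W" and r: "r \<ge> 0"
  shows "F.cone (x - r *\<^sub>R w) b \<longleftrightarrow> r * barrier w b x < 1"
proof
  have eq: "f b (y - r *\<^sub>R w) = f b y * (1 - r * barrier w b y)" if "f b y \<noteq> 0" for y
    using f_affine[OF w, of b y "-r"] that by (simp add: barrier_def right_diff_distrib)
  {
    assume "F.cone (x - r *\<^sub>R w) b"
    from f_pos[OF this] f_pos[OF x] eq[of x] show "r * barrier w b x < 1"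
      by (simp add: zero_less_mult_iff)
  }
  assume less: "r * barrier w b x < 1"
  show "F.cone (x - r *\<^sub>R w) b"
    unfolding cone_iff
  proof (intro allI impI)
    fix s :: real assume s: "s \<ge> 0"
    have pos: "f b (x + s *\<^sub>R e) > 0" by (intro f_pos F.cone_add_e x s)
    have "r * barrier w b (x + s *\<^sub>R e) < 1"
      using mult_left_mono[OF barrier_antimono_e[OF x w s] r] less by simp
    then have "f b (x + s *\<^sub>R e - r *\<^sub>R w) \<noteq> 0"
      using eq[of "x + s *\<^sub>R e"] pos by simp
    moreover have "x + s *\<^sub>R e - r *\<^sub>R w = x - r *\<^sub>R w + s *\<^sub>R e" by simp
    ultimately show "f b (x - r *\<^sub>R w + s *\<^sub>R e) \<noteq> 0" by metis
  qed
qed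

text \<open>Translation by \<open>t y\<close> maps the cone into itself, so it cannot shorten the
  way to the boundary in direction \<open>-w\<close>. The contradiction is read off at the
  reciprocal of the larger barrier.\<close>

lemma barrier_antimono:
  assumes x: "F.cone x b" and w: "w \<in> W" and y: "psd y" "t \<ge> 0"
  shows "barrier w b (x + t *\<^sub>R y) \<le> barrier w b x"
proof (rule ccontr)
  have xy: "F.cone (x + t *\<^sub>R y) b" by (intro cone_add_psd x y)
  assume "\<not> ?thesis"
  then have less: "barrier w b x < barrier w b (x + t *\<^sub>R y)" by simp
  define r where "r = 1 / barrier w b (x + t *\<^sub>R y)"
  have pos: "barrier w b (x + t *\<^sub>R y) > 0" using less barrier_nonneg(1)[OF x w] by simp
  then have r: "r \<ge> 0" by (simp add: r_def)
  have "r * barrier w b x < 1" using less pos by (simp add: r_def divide_simps)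
  then have "F.cone (x - r *\<^sub>R w) b" using cone_diff_iff[OF x w r] by simp
  then have "F.cone (x - r *\<^sub>R w + t *\<^sub>R y) b" by (intro cone_add_psd y)
  moreover have "x - r *\<^sub>R w + t *\<^sub>R y = x + t *\<^sub>R y - r *\<^sub>R w" by simp
  ultimately have "r * barrier w b (x + t *\<^sub>R y) < 1"
    using cone_diff_iff[OF xy w r] by simp
  then show False using pos by (simp add: r_def)
qed

lemma cone_convex:
  assumes "F.cone x b" "F.cone y b" "\<theta> \<ge> 0" "\<theta> \<le> 1"
  shows "F.cone ((1 - \<theta>) *\<^sub>R x + \<theta> *\<^sub>R y) b"
proof -
  consider "\<theta> = 0" | "\<theta> = 1" | "0 < \<theta>" "\<theta> < 1" using assms by linarith
  then show ?thesis
  proof cases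
    case 3
    then have "F.cone ((1 - \<theta>) *\<^sub>R x + \<theta> *\<^sub>R y) (\<lambda>j. (1 - \<theta>) * b j + \<theta> * b j)"
      using assms by (intro F.cone_add F.cone_scale) auto
    then show ?thesis by (simp add: algebra_simps)
  qed (use assms in auto)
qed

text \<open>Since \<open>F\<close> is affine along \<open>w\<close>, the reciprocal of the barrier function at \<open>x\<close> is the length of
  the longest segment in direction \<open>-w\<close> that stays inside the cone; it is concave because the
  cone is convex, and the reciprocal of a concave positive function is convex.\<close>

lemma barrier_convex:
  assumes x: "F.cone x b" and y: "F.cone y b" and w: "w \<in> W" and \<theta>: "0 \<le> \<theta>" "\<theta> \<le> 1"
  shows "barrier w b ((1 - \<theta>) *\<^sub>R x + \<theta> *\<^sub>R y) \<le> (1 - \<theta>) * barrier w b x + \<theta> * barrier w b y"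
proof (rule field_le_epsilon)
  fix \<epsilon> :: real assume \<epsilon>: "\<epsilon> > 0"
  \<comment> \<open>\<open>\<epsilon>\<close> keeps the reciprocals meaningful when a barrier
    vanishes and puts both translated points strictly inside the cone.\<close>
  define a1 a2 where "a1 = barrier w b x + \<epsilon>" and "a2 = barrier w b y + \<epsilon>"
  have a: "a1 > 0" "a2 > 0"
    using barrier_nonneg(1)[OF x w] barrier_nonneg(1)[OF y w] \<epsilon> by (auto simp: a1_def a2_def)
  define u where "u = (1 - \<theta>) *\<^sub>R x + \<theta> *\<^sub>R y"
  define r where "r = (1 - \<theta>) / a1 + \<theta> / a2"
  have u: "F.cone u b" unfolding u_def by (intro cone_convex x y \<theta>)
  have r: "r \<ge> 0" using a \<theta> by (simp add: r_def)
  have "F.cone (x - (1 / a1) *\<^sub>R w) b"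
    using a \<epsilon> by (subst cone_diff_iff[OF x w]) (auto simp: a1_def)
  moreover have "F.cone (y - (1 / a2) *\<^sub>R w) b"
    using a \<epsilon> by (subst cone_diff_iff[OF y w]) (auto simp: a2_def)
  ultimately have "F.cone ((1 - \<theta>) *\<^sub>R (x - (1 / a1) *\<^sub>R w) + \<theta> *\<^sub>R (y - (1 / a2) *\<^sub>R w)) b"
    using \<theta> by (intro cone_convex)
  moreover have "(1 - \<theta>) *\<^sub>R (x - (1 / a1) *\<^sub>R w) + \<theta> *\<^sub>R (y - (1 / a2) *\<^sub>R w) = u - r *\<^sub>R w"
    by (simp add: u_def r_def algebra_simps scaleR_diff_right)
  ultimately have lt: "r * barrier w b u < 1" using cone_diff_iff[OF u w r] by simp
  also have "1 \<le> r * ((1 - \<theta>) * a1 + \<theta> * a2)"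
    unfolding r_def by (rule harmonic_arithmetic_mean[OF a \<theta>])
  finally have "barrier w b u < (1 - \<theta>) * a1 + \<theta> * a2"
    using r by (simp add: mult_less_cancel_left)
  then show "barrier w b ((1 - \<theta>) *\<^sub>R x + \<theta> *\<^sub>R y) \<le> (1 - \<theta>) * barrier w b x + \<theta> * barrier w b y + \<epsilon>"
    by (simp add: u_def a1_def a2_def algebra_simps)
qed

text \<open>Total differentiability makes the derivative linear in the direction, so along a
  weighted sum of vectors of \<open>W\<close> it is the weighted sum of their increments.\<close>

lemma f_gradient:
  obtains f' where "bounded_linear f'"
    and "\<And>u x s. x + s *\<^sub>R u = y \<Longrightarrow> ((\<lambda>t. f b (x + t *\<^sub>R u)) has_real_derivative f' u) (at s)"
    and "\<And>w. w \<in> W \<Longrightarrow> f' w = increment w b y"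
proof -
  have "f b differentiable (at y)"
    using F_differentiable[of b y] by (simp add: f_def[abs_def])
  then obtain f' where f': "(f b has_derivative f') (at y)" by (auto simp: differentiable_def)
  then interpret f': bounded_linear f' by (rule has_derivative_bounded_linear)
  have dir: "((\<lambda>t. f b (x + t *\<^sub>R u)) has_real_derivative f' u) (at s)" if "x + s *\<^sub>R u = y" for x s u
  proof -
    have "((\<lambda>t. f b (x + t *\<^sub>R u)) has_derivative (\<lambda>h. f' (h *\<^sub>R u))) (at s)"
      by (rule has_derivative_compose[of "\<lambda>t. x + t *\<^sub>R u" _ s UNIV "f b" f', simplified])
         (auto intro!: derivative_eq_intros simp: that f')
    moreover have "(\<lambda>h. f' (h *\<^sub>R u)) = (*) (f' u)" by (auto simp: f'.scaleR)
    ultimately show ?thesis by (simp add: has_field_derivative_def)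
  qed
  have diff: "f' w = increment w b y" if "w \<in> W" for w
  proof -
    have "((\<lambda>t. f b y + t * increment w b y) has_real_derivative f' w) (at 0)"
      using dir[of y 0 w] by (simp add: f_affine[OF that])
    moreover have "((\<lambda>t. f b y + t * increment w b y) has_real_derivative increment w b y) (at 0)"
      by (auto intro!: derivative_eq_intros)
    ultimately show ?thesis by (rule DERIV_unique)
  qed
  show ?thesis by (rule that[OF f'.bounded_linear_axioms dir diff])
qed

lemma f_has_derivative:
  assumes "finite S" "S \<subseteq> W"
  shows "((\<lambda>t. f b (x + t *\<^sub>R (\<Sum>w\<in>S. p w *\<^sub>R w))) has_real_derivative
    (\<Sum>w\<in>S. p w * increment w b (x + t *\<^sub>R (\<Sum>w\<in>S. p w *\<^sub>R w)))) (at t)"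
proof -
  define v where "v = (\<Sum>w\<in>S. p w *\<^sub>R w)"
  obtain f' where f': "bounded_linear f'"
    and dir: "((\<lambda>t. f b (x + t *\<^sub>R v)) has_real_derivative f' v) (at t)"
    and diff: "\<And>w. w \<in> W \<Longrightarrow> f' w = increment w b (x + t *\<^sub>R v)"
    using f_gradient[of "x + t *\<^sub>R v" b] by metis
  interpret f': bounded_linear f' by (rule f')
  have "f' v = (\<Sum>w\<in>S. p w * increment w b (x + t *\<^sub>R v))"
    using assms diff unfolding v_def by (auto simp: f'.sum f'.scaleR intro!: sum.cong)
  then show ?thesis using dir by (simp add: v_def)
qed

end

subsection \<open>Mixing operators and the barrier step\<close>

text \<open>If \<open>F\<close> is affine along the vectors of \<open>S\<close> and \<open>p\<close> is a probability vector on \<open>S\<close> with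
  mean \<open>v\<close>, this is the operator \<open>1 - b_i D_v\<close>, written without derivatives.\<close>

definition mix :: "nat \<Rightarrow> (real ^ 'n) set \<Rightarrow> (real ^ 'n \<Rightarrow> real) \<Rightarrow>
    (complex ^ 'n \<Rightarrow> (nat \<Rightarrow> complex) \<Rightarrow> complex) \<Rightarrow> complex ^ 'n \<Rightarrow> (nat \<Rightarrow> complex) \<Rightarrow> complex" where
  "mix i S p F = (\<lambda>z b. \<Sum>w\<in>S. of_real (p w) * F (z - b i *s cvec w) b)"

lemma mix_commute: "mix i S p (mix j S' p' F) = mix j S' p' (mix i S p F)"
proof (intro ext)
  fix z b
  have "mix i S p (mix j S' p' F) z b =
    (\<Sum>w\<in>S. \<Sum>w'\<in>S'. of_real (p w) * of_real (p' w') * F (z - b i *s cvec w - b j *s cvec w') b)"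
    by (simp add: mix_def sum_distrib_left mult.assoc)
  also have "\<dots> = (\<Sum>w'\<in>S'. \<Sum>w\<in>S. of_real (p w) * of_real (p' w') * F (z - b i *s cvec w - b j *s cvec w') b)"
    by (rule sum.swap)
  also have "\<dots> = mix j S' p' (mix i S p F) z b"
    unfolding mix_def sum_distrib_left
    by (intro sum.cong refl) (simp add: mult.left_commute diff_diff_eq add.commute)
  finally show "mix i S p (mix j S' p' F) z b = mix j S' p' (mix i S p F) z b" .
qed

definition weights :: "'a set \<Rightarrow> ('a \<Rightarrow> real) \<Rightarrow> bool" where
  "weights S p \<longleftrightarrow> finite S \<and> (\<forall>w\<in>S. p w \<ge> 0) \<and> sum p S = 1"

context rank_one_family
begin

lemma stable_family_N: "stable_family c d e W (\<lambda>z b. N z)"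
proof
  show "N (cvec x) \<in> \<real>" for x by (simp add: N_cvec)
  show "N (z + t *s cvec w) = N z + t * (N (z + cvec w) - N z)" if "w \<in> W" for w z t
    using W_affine[OF that, of z] by (auto simp: affine_at_def)
  show "N (cvec x + \<i> *s cvec y) \<noteq> 0" if "pos_cone y" for x y
    using N.cone_stable[OF that, of \<i> x] by simp
  show "(\<lambda>x. Re (N (cvec x))) differentiable (at x)" for x
    using differentiable_peval[of c x] peval_e by (simp add: N_cvec)
qed (use N.F_cont N.F_hol in \<open>simp_all add: N_hom\<close>)

lemma psd_scale_sum:
  assumes "finite S" "S \<subseteq> W" "\<And>w. w \<in> S \<Longrightarrow> p w \<ge> 0"
  shows "psd (\<Sum>w\<in>S. p w *\<^sub>R w)"
  using assms
proof (induction S rule: finite_induct)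
  case empty
  then show ?case using pos_cone_scale[OF pos_cone_e] by (simp add: psd_def)
next
  case (insert w S)
  have "pos_cone ((\<Sum>w\<in>S. p w *\<^sub>R w) + \<eta> *\<^sub>R e + p w *\<^sub>R w)" if "\<eta> > 0" for \<eta>
  proof -
    have "pos_cone ((\<Sum>w\<in>S. p w *\<^sub>R w) + \<eta> *\<^sub>R e)"
      using insert that by (auto simp: psd_def)
    then show ?thesis by (rule pos_cone_add_psd) (use insert in \<open>auto intro: W_psd\<close>)
  qed
  then show ?case using insert.hyps by (simp add: psd_def add_ac)
qed

end

context stable_family
begin

lemma mix_eq:
  assumes "S \<subseteq> W" "weights S p"
  shows "mix i S p F z b = F z b - b i * (\<Sum>w\<in>S. of_real (p w) * (F (z + cvec w) b - F z b))"
proof -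
  have F: "F (z - b i *s cvec w) b = F z b - b i * (F (z + cvec w) b - F z b)" if "w \<in> S" for w
    using F_affine[of w z "- b i" b] that assms(1) by auto
  have "mix i S p F z b = (\<Sum>w\<in>S. of_real (p w) * F z b - b i * (of_real (p w) * (F (z + cvec w) b - F z b)))"
    unfolding mix_def by (rule sum.cong) (simp_all add: F algebra_simps)
  also have "\<dots> = of_real (sum p S) * F z b - b i * (\<Sum>w\<in>S. of_real (p w) * (F (z + cvec w) b - F z b))"
    by (simp add: sum_subtractf sum_distrib_left sum_distrib_right)
  also have "complex_of_real (sum p S) = 1"
    using assms(2) by (simp add: weights_def del: of_real_sum)
  finally show ?thesis by simp
qed

lemma stable_family_mix:
  assumes S: "S \<subseteq> W" and wt: "weights S p"
  shows "stable_family c d e W (mix i S p F)"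
proof
  show "continuous_on UNIV (\<lambda>(\<alpha>, \<beta>, \<gamma>). mix i S p F (\<alpha> *s z1 + \<beta> *s z2 + \<gamma> *s z3)
      (\<lambda>j. \<alpha> * b1 j + \<beta> * b2 j + \<gamma> * b3 j))" for z1 z2 z3 b1 b2 b3
  proof -
    have eq: "\<alpha> *s z1 + \<beta> *s z2 + \<gamma> *s z3 - (\<alpha> * b1 i + \<beta> * b2 i + \<gamma> * b3 i) *s cvec w
      = \<alpha> *s (z1 - b1 i *s cvec w) + \<beta> *s (z2 - b2 i *s cvec w) + \<gamma> *s (z3 - b3 i *s cvec w)" for \<alpha> \<beta> \<gamma> w
      by (simp add: vec_eq_iff algebra_simps)
    show ?thesis
      unfolding mix_def case_prod_unfold eq
      by (intro continuous_intros F_continuous[unfolded case_prod_unfold])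
  qed
  show "(\<lambda>t. mix i S p F (z0 + t *s z1) (\<lambda>j. b0 j + t * b1 j)) holomorphic_on UNIV" for z0 z1 b0 b1
  proof -
    have eq: "z0 + t *s z1 - (b0 i + t * b1 i) *s cvec w = (z0 - b0 i *s cvec w) + t *s (z1 - b1 i *s cvec w)" for t w
      by (simp add: vec_eq_iff algebra_simps)
    show ?thesis
      unfolding mix_def eq by (intro holomorphic_intros F_holomorphic)
  qed
  show "mix i S p F (k *s z) (\<lambda>j. k * b j) = k ^ d * mix i S p F z b" for k z b
  proof -
    have eq: "k *s z - (k * b i) *s cvec w = k *s (z - b i *s cvec w)" for w
      by (simp add: vec_eq_iff algebra_simps)
    show ?thesis
      unfolding mix_def eq F_homogeneous by (simp add: sum_distrib_left mult.left_commute)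
  qed
  show "mix i S p F (cvec x) (\<lambda>j. of_real (b j)) \<in> \<real>" for x b
  proof -
    have eq: "cvec x - of_real (b i) *s cvec w = cvec (x - b i *\<^sub>R w)" for w
      by (simp add: cvec_diff cvec_scaleR)
    show ?thesis unfolding mix_def eq by (intro sum_in_Reals Reals_mult F_real) auto
  qed
  show "mix i S p F (z + t *s cvec w) b = mix i S p F z b + t * (mix i S p F (z + cvec w) b - mix i S p F z b)"
    if "w \<in> W" for w z b t
  proof -
    have eq: "z + y - x = z - x + y" for x y z :: "complex ^ 'n" by simp
    show ?thesis
      unfolding mix_def eq sum_subtractf[symmetric] sum_distrib_left sum.distrib[symmetric] F_affine[OF that, of _ t]
      by (rule sum.cong) (simp_all add: algebra_simps)
  qed
  show "mix i S p F (cvec x + \<i> *s cvec y) (\<lambda>j. of_real (b j)) \<noteq> 0" if y: "pos_cone y" for x y b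
  proof
    define z where "z = cvec x + \<i> *s cvec y"
    define b' where "b' = (\<lambda>j. complex_of_real (b j))"
    define a where "a = (\<lambda>w. (F (z + cvec w) b' - F z b') / F z b')"
    assume "mix i S p F (cvec x + \<i> *s cvec y) (\<lambda>j. of_real (b j)) = 0"
    then have "F z b' - of_real (b i) * (\<Sum>w\<in>S. of_real (p w) * (F (z + cvec w) b' - F z b')) = 0"
      using mix_eq[OF S wt, of i z b'] by (simp add: z_def b'_def)
    moreover have nz: "F z b' \<noteq> 0" unfolding z_def b'_def by (rule F_stable[OF y])
    \<comment> \<open>At a zero, \<open>b i\<close> times the mean of the quotients
      \<open>a w\<close> is 1, so the mean is real. All imaginary parts are nonpositive, hence 0
      where the weight is positive; by the case of equality those quotients vanish, and 0 would be
      1.\<close>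
    ultimately have 1: "of_real (b i) * (\<Sum>w\<in>S. of_real (p w) * a w) = 1"
      by (simp add: a_def sum_divide_distrib[symmetric])
    then have "b i * (\<Sum>w\<in>S. p w * Im (a w)) = 0" and bi: "b i \<noteq> 0"
      by (auto simp: complex_eq_iff)
    then have "(\<Sum>w\<in>S. p w * Im (a w)) = 0" by simp
    moreover have le: "Im (a w) \<le> 0" "Im (a w) = 0 \<Longrightarrow> a w = 0" if "w \<in> S" for w
      using Im_diff_quotient_nonpos[OF _ y, of w x b] that S unfolding a_def z_def b'_def by auto
    ultimately have "\<forall>w\<in>S. - (p w * Im (a w)) = 0"
      using wt by (subst sum_nonneg_eq_0_iff[symmetric])
        (auto simp: weights_def sum_negf mult_nonneg_nonpos)
    then have "of_real (p w) * a w = 0" if "w \<in> S" for w using le that by auto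
    then have "(\<Sum>w\<in>S. of_real (p w) * a w) = 0" by (intro sum.neutral) auto
    then show False using 1 by simp
  qed
  show "mix i S p F z (\<lambda>_. 0) = N z" for z
    using mix_eq[OF S wt, of i z "\<lambda>_. 0"] by (simp add: F_0)
  show "(\<lambda>x. Re (mix i S p F (cvec x) (\<lambda>j. of_real (b j)))) differentiable (at x)" for x b
  proof -
    have eq: "cvec x - of_real (b i) *s cvec w = cvec (x - b i *\<^sub>R w)" for x w
      by (simp add: cvec_diff cvec_scaleR)
    have "(\<lambda>x. Re (F (cvec (x - b i *\<^sub>R w)) (\<lambda>j. of_real (b j)))) differentiable (at x)" for w
      by (rule differentiable_compose[where g = "\<lambda>x. x - b i *\<^sub>R w"]) (auto intro: F_differentiable derivative_intros)
    moreover have "Re (mix i S p F (cvec x) (\<lambda>j. of_real (b j))) =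
      (\<Sum>w\<in>S. p w * Re (F (cvec (x - b i *\<^sub>R w)) (\<lambda>j. of_real (b j))))" for x
      by (simp add: mix_def eq)
    ultimately show ?thesis using wt by (auto simp: weights_def intro!: differentiable_sum)
  qed
qed

section \<open>One mixing operator: the barrier step and the choice of a support point\<close>

context
  fixes i :: nat and S p
  assumes S: "S \<subseteq> W" and wt: "weights S p"
begin

interpretation G: stable_family c d e W "mix i S p F"
  by (rule stable_family_mix[OF S wt])

abbreviation mean_barrier where
  "mean_barrier b x \<equiv> (\<Sum>w\<in>S. p w * barrier w b x)"

lemma G_f: "G.f b x = f b x - b i * (\<Sum>w\<in>S. p w * increment w b x)"
  unfolding G.f_def mix_eq[OF S wt] by (simp add: f_def increment_def cvec_add)

lemma G_f': "f b x \<noteq> 0 \<Longrightarrow> G.f b x = f b x * (1 - b i * mean_barrier b x)"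
  by (simp add: G_f barrier_def sum_divide_distrib[symmetric] right_diff_distrib)

lemma mean_barrier_antimono:
  assumes x: "F.cone x b" and y: "psd y" "t \<ge> 0"
  shows "mean_barrier b (x + t *\<^sub>R y) \<le> mean_barrier b x"
  using wt S by (intro sum_mono mult_left_mono barrier_antimono x y) (auto simp: weights_def)

lemma cone_mix:
  assumes x: "F.cone x b" and b: "b i \<ge> 0" and less: "b i * mean_barrier b x < 1"
  shows "G.F.cone x b"
  unfolding G.cone_iff
proof (intro allI impI)
  fix s :: real assume s: "s \<ge> 0"
  have pos: "f b (x + s *\<^sub>R e) > 0" by (intro f_pos F.cone_add_e x s)
  have "b i * mean_barrier b (x + s *\<^sub>R e) < 1"
    using mult_left_mono[OF mean_barrier_antimono[OF x psd_e s] b] less by simp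
  then show "G.f b (x + s *\<^sub>R e) \<noteq> 0"
    using pos G_f'[of b "x + s *\<^sub>R e"] by auto
qed

text \<open>Let \<open>\<phi>(t)\<close> be the barrier at \<open>x + t v\<close>,
  \<open>M = - \<phi>'(\<delta>)\<close> and \<open>\<kappa> = 1 - b i * mean_barrier b y\<close>.
  The new barrier at \<open>y\<close> is \<open>\<phi>(\<delta>) + b i * M / \<kappa>\<close>.
  Monotonicity and \<open>bound\<close> give \<open>b i \<le> \<delta> * \<kappa>\<close>, and the
  tangent of the convex \<open>\<phi>\<close> at \<open>\<delta>\<close> gives
  \<open>\<phi>(\<delta>) + \<delta> * M \<le> \<phi>(0)\<close>, the old barrier at
  \<open>x\<close>.\<close>

lemma barrier_step:
  assumes x: "F.cone x b" and b: "b i \<ge> 0" and \<delta>: "\<delta> > 0"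
    and bound: "b i * (mean_barrier b x + 1 / \<delta>) \<le> 1"
  defines "y \<equiv> x + \<delta> *\<^sub>R (\<Sum>w\<in>S. p w *\<^sub>R w)"
  shows "G.F.cone y b" and "w \<in> W \<Longrightarrow> G.barrier w b y \<le> barrier w b x"
proof -
  define v where "v = (\<Sum>w\<in>S. p w *\<^sub>R w)"
  have fin: "finite S" using wt by (simp add: weights_def)
  have v: "psd v" unfolding v_def using wt S by (intro psd_scale_sum) (auto simp: weights_def)
  have xt: "F.cone (x + t *\<^sub>R v) b" if "t \<ge> 0" for t by (intro cone_add_psd x v that)
  have y: "F.cone y b" "y = x + \<delta> *\<^sub>R v" using xt[of \<delta>] \<delta> by (auto simp: y_def v_def)
  have R: "mean_barrier b y \<le> mean_barrier b x"
    unfolding y(2) using \<delta> by (intro mean_barrier_antimono x v) auto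
  have "b i * mean_barrier b y + b i / \<delta> \<le> b i * (mean_barrier b x + 1 / \<delta>)"
    using mult_left_mono[OF R b] by (simp add: algebra_simps)
  then have le: "b i / \<delta> \<le> 1 - b i * mean_barrier b y" using bound by simp
  then have key: "b i \<le> \<delta> * (1 - b i * mean_barrier b y)" using \<delta> by (simp add: field_simps)
  have lt: "b i * mean_barrier b y < 1"
  proof (cases "b i = 0")
    case False
    then have "b i / \<delta> > 0" using b \<delta> by simp
    then show ?thesis using le by simp
  qed simp
  show G: "G.F.cone y b" by (rule cone_mix[OF y(1) b lt])
  show "G.barrier w b y \<le> barrier w b x" if w: "w \<in> W"
  proof -
    define \<phi> where "\<phi> = (\<lambda>t. barrier w b (x + t *\<^sub>R v))"
    \<comment> \<open>At \<open>y\<close>, \<open>Q\<close> is the derivative of \<open>f\<close>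
      along the mean \<open>v\<close>, and \<open>P\<close> that of \<open>increment w\<close>: a
      mixed second derivative in the directions \<open>v\<close> and \<open>w\<close>.\<close>
    define P where "P = (\<Sum>u\<in>S. p u * increment u b (y + w)) - (\<Sum>u\<in>S. p u * increment u b y)"
    define Q where "Q = (\<Sum>u\<in>S. p u * increment u b y)"
    define A where "A = f b y"
    define D where "D = increment w b y"
    have A: "A > 0" unfolding A_def by (rule f_pos[OF y(1)])
    have "convex_on {0..} \<phi>"
    proof (rule convex_onI)
      fix \<theta> s t :: real assume h: "0 < \<theta>" "\<theta> < 1" "s \<in> {0..}" "t \<in> {0..}"
      have "x + ((1 - \<theta>) *\<^sub>R s + \<theta> *\<^sub>R t) *\<^sub>R v = (1 - \<theta>) *\<^sub>R (x + s *\<^sub>R v) + \<theta> *\<^sub>R (x + t *\<^sub>R v)"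
        by (simp add: algebra_simps)
      then show "\<phi> ((1 - \<theta>) *\<^sub>R s + \<theta> *\<^sub>R t) \<le> (1 - \<theta>) * \<phi> s + \<theta> * \<phi> t"
        unfolding \<phi>_def using barrier_convex[OF xt xt w, of s t \<theta>] h by simp
    qed simp
    note convex = this
    have "((\<lambda>t. f b (x + t *\<^sub>R v)) has_real_derivative Q) (at \<delta>)"
      "((\<lambda>t. f b (x + w + t *\<^sub>R v)) has_real_derivative P + Q) (at \<delta>)"
      using f_has_derivative[OF fin S, of b x p \<delta>] f_has_derivative[OF fin S, of b "x + w" p \<delta>]
      unfolding v_def[symmetric] Q_def P_def y(2) by (simp_all add: add_ac)
    then have "((\<lambda>t. (f b (x + w + t *\<^sub>R v) - f b (x + t *\<^sub>R v)) / f b (x + t *\<^sub>R v)) has_real_derivative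
        ((P + Q - Q) * A - D * Q) / (A * A)) (at \<delta>)"
      using A y(2) unfolding A_def D_def increment_def
      by (auto intro!: derivative_eq_intros simp: add_ac)
    moreover have "\<phi> = (\<lambda>t. (f b (x + w + t *\<^sub>R v) - f b (x + t *\<^sub>R v)) / f b (x + t *\<^sub>R v))"
      by (simp add: \<phi>_def barrier_def increment_def add_ac)
    ultimately have der: "(\<phi> has_real_derivative (P * A - D * Q) / (A * A)) (at \<delta>)" by simp
    have tangent: "\<phi> t - \<phi> \<delta> \<ge> (P * A - D * Q) / (A * A) * (t - \<delta>)" if "t \<ge> 0" for t
      using \<delta> that by (intro convex_on_imp_above_tangent[OF convex])
        (auto intro: has_field_derivative_at_within[OF der] simp: interior_real_atLeast)
    define M where "M = (D * Q - P * A) / (A * A)"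
    have M: "(P * A - D * Q) / (A * A) = - M" by (simp add: M_def minus_divide_left)
    have "\<phi> (\<delta> + 1) \<le> \<phi> \<delta>"
      unfolding \<phi>_def using barrier_antimono[OF xt[of \<delta>] w v, of 1] \<delta> by (simp add: scaleR_add_left add_ac)
    then have M0: "M \<ge> 0" using tangent[of "\<delta> + 1"] \<delta> by (simp add: M)
    have r: "mean_barrier b y = Q / A"
      by (simp add: Q_def A_def barrier_def sum_divide_distrib)
    define \<kappa> where "\<kappa> = 1 - b i * (Q / A)"
    have \<kappa>: "\<kappa> > 0" "b i \<le> \<delta> * \<kappa>" using lt key by (auto simp: \<kappa>_def r)
    have "\<phi> 0 \<ge> D / A + \<delta> * M"
      using tangent[of 0] by (simp add: M) (simp add: \<phi>_def barrier_def D_def A_def y(2) mult.commute)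
    then have "A * \<kappa> * \<phi> 0 \<ge> A * \<kappa> * (D / A + \<delta> * M)"
      using A \<kappa> by (intro mult_left_mono) auto
    moreover have "A * M * (\<delta> * \<kappa>) \<ge> A * M * b i"
      using A M0 \<kappa> by (intro mult_left_mono) auto
    moreover have "A * \<kappa> * (D / A + \<delta> * M) = D * \<kappa> + A * M * (\<delta> * \<kappa>)" using A by (simp add: field_simps)
    moreover have "D * \<kappa> + A * M * b i = D - b i * P" using A by (simp add: \<kappa>_def M_def field_simps)
    ultimately have "D - b i * P \<le> \<phi> 0 * (A * \<kappa>)" by (simp add: mult.commute)
    moreover have "G.f b y = A * \<kappa>" using G_f'[of b y] A by (simp add: A_def[symmetric] r \<kappa>_def)
    moreover have "G.increment w b y = D - b i * P"
      by (simp add: G.increment_def G_f D_def increment_def P_def algebra_simps)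
    moreover have "\<phi> 0 = barrier w b x" by (simp add: \<phi>_def)
    ultimately show ?thesis using A \<kappa> by (simp add: G.barrier_def divide_le_eq)
  qed
qed

text \<open>Otherwise each \<open>w\<close> fails at some \<open>T w > \<rho>\<close>. Barriers
  decrease along \<open>e\<close>, so at the least of these finitely many points all of them are at
  least 1. So is their mean, and the mixed function would not be positive there.\<close>

lemma exists_good_point:
  assumes b: "b i = 1" and F: "\<And>t. t > \<rho> \<Longrightarrow> F.cone (t *\<^sub>R e) b" and G: "\<And>t. t > \<rho> \<Longrightarrow> G.F.cone (t *\<^sub>R e) b"
  shows "\<exists>w\<in>S. \<forall>t>\<rho>. F.cone (t *\<^sub>R e - w) b"
proof (rule ccontr)
  assume "\<not> ?thesis"
  then have "\<forall>w\<in>S. \<exists>t>\<rho>. \<not> F.cone (t *\<^sub>R e - w) b" by auto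
  then obtain T where T: "\<And>w. w \<in> S \<Longrightarrow> T w > \<rho> \<and> \<not> F.cone (T w *\<^sub>R e - w) b" by metis
  have fin: "finite S" "S \<noteq> {}" using wt by (auto simp: weights_def)
  define t where "t = Min (T ` S)"
  have t: "t > \<rho>" "\<And>w. w \<in> S \<Longrightarrow> t \<le> T w" using fin T by (auto simp: t_def)
  have "barrier w b (t *\<^sub>R e) \<ge> 1" if "w \<in> S" for w
  proof (rule ccontr)
    assume "\<not> barrier w b (t *\<^sub>R e) \<ge> 1"
    moreover have "barrier w b (t *\<^sub>R e + (T w - t) *\<^sub>R e) \<le> barrier w b (t *\<^sub>R e)"
      using that S t by (intro barrier_antimono_e F) auto
    ultimately have "1 * barrier w b (T w *\<^sub>R e) < 1" by (simp add: algebra_simps)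
    then have "F.cone (T w *\<^sub>R e - 1 *\<^sub>R w) b"
      using that S T by (subst cone_diff_iff) (auto intro: F)
    then show False using T[OF that] by simp
  qed
  then have "sum p S \<le> mean_barrier b (t *\<^sub>R e)"
    using wt by (intro sum_mono) (auto simp: weights_def intro: mult_left_mono[of 1 _ "p _", simplified])
  then have "mean_barrier b (t *\<^sub>R e) \<ge> 1" using wt by (simp add: weights_def)
  then have "G.f b (t *\<^sub>R e) \<le> 0"
    using G_f'[of b "t *\<^sub>R e"] f_pos[OF F[OF t(1)]] b by (simp add: mult_nonneg_nonpos)
  then show False using G.f_pos[OF G[OF t(1)]] by simp
qed

end

end

subsection \<open>Realising the random vectors\<close>

context rank_one_family
begin

text \<open>For distinct indices this is the expectation of \<open>N (z - \<Sum> b_i X_i)\<close>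
  with independent \<open>X_i\<close> distributed on \<open>S i\<close> with weights
  \<open>p i\<close>.\<close>

definition mixes :: "(nat \<Rightarrow> (real ^ 'n) set) \<Rightarrow> (nat \<Rightarrow> real ^ 'n \<Rightarrow> real) \<Rightarrow> nat list \<Rightarrow>
    complex ^ 'n \<Rightarrow> (nat \<Rightarrow> complex) \<Rightarrow> complex" where
  "mixes S p L = fold (\<lambda>i. mix i (S i) (p i)) L (\<lambda>z b. N z)"

definition admissible :: "(nat \<Rightarrow> (real ^ 'n) set) \<Rightarrow> (nat \<Rightarrow> real ^ 'n \<Rightarrow> real) \<Rightarrow> nat set \<Rightarrow> bool" where
  "admissible S p J \<longleftrightarrow> (\<forall>i\<in>J. S i \<subseteq> W \<and> weights (S i) (p i))"

abbreviation mcone where "mcone F \<equiv> hyperbolic_function.cone e F"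

lemma mixes_Nil: "mixes S p [] = (\<lambda>z b. N z)"
  by (simp add: mixes_def)

lemma mixes_snoc: "mixes S p (L @ [i]) = mix i (S i) (p i) (mixes S p L)"
  by (simp add: mixes_def)

text \<open>Commutativity of the operators; it allows any index to be treated as the last
  one.\<close>

lemma mixes_mset: "mset L = mset L' \<Longrightarrow> mixes S p L = mixes S p L'"
  unfolding mixes_def by (rule fun_cong[OF fold_multiset_equiv]) (auto simp: mix_commute)

lemma stable_family_mixes: "admissible S p (set L) \<Longrightarrow> stable_family c d e W (mixes S p L)"
proof (induction L rule: rev_induct)
  case Nil
  then show ?case by (simp add: mixes_Nil stable_family_N)
next
  case (snoc i L)
  then have "stable_family c d e W (mixes S p L)" by (auto simp: admissible_def)
  then show ?case
    using snoc.prems unfolding mixes_snoc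
    by (intro stable_family.stable_family_mix) (auto simp: admissible_def)
qed

lemma mixes_cong_b:
  "(\<And>j. j \<in> set L \<Longrightarrow> b j = b' j) \<Longrightarrow> mixes S p L z b = mixes S p L z b'"
proof (induction L arbitrary: z rule: rev_induct)
  case (snoc i L)
  have "mixes S p L z b = mixes S p L z b'" for z using snoc by auto
  then show ?case using snoc.prems[of i] by (simp add: mixes_snoc mix_def)
qed (simp add: mixes_Nil)

lemma mixes_cong:
  "(\<And>j. j \<in> set L \<Longrightarrow> S j = S' j \<and> p j = p' j) \<Longrightarrow> mixes S p L = mixes S' p' L"
proof (induction L rule: rev_induct)
  case (snoc i L)
  then have "mixes S p L = mixes S' p' L" by auto
  then show ?case using snoc.prems[of i] by (simp add: mixes_snoc)
qed (simp add: mixes_Nil)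

lemma mixes_0:
  assumes "admissible S p (set L)" "\<And>j. j \<in> set L \<Longrightarrow> b j = 0"
  shows "mixes S p L z b = N z"
proof -
  interpret stable_family c d e W "mixes S p L" by (rule stable_family_mixes[OF assms(1)])
  have "mixes S p L z b = mixes S p L z (\<lambda>_. 0)" by (rule mixes_cong_b) (rule assms(2))
  then show ?thesis by (simp add: F_0)
qed

lemma mixes_singletons:
  "mixes (\<lambda>i. {\<kappa> i}) (\<lambda>_ _. 1) L z (\<lambda>_. 1) = N (z - (\<Sum>i\<leftarrow>L. cvec (\<kappa> i)))"
proof (induction L arbitrary: z rule: rev_induct)
  case (snoc i L)
  then show ?case by (simp add: mixes_snoc mix_def diff_diff_eq add.commute)
qed (simp add: mixes_Nil)

lemma mcone_cong:
  assumes "admissible S p (set L)" "\<And>j. j \<in> set L \<Longrightarrow> b j = b' j" "mcone (mixes S p L) x b"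
  shows "mcone (mixes S p L) x b'"
proof -
  interpret stable_family c d e W "mixes S p L" by (rule stable_family_mixes[OF assms(1)])
  have "mixes S p L z (\<lambda>j. complex_of_real (b j)) = mixes S p L z (\<lambda>j. complex_of_real (b' j))" for z
    by (rule mixes_cong_b) (simp add: assms(2))
  then show ?thesis using assms(3) unfolding F.cone_def by simp
qed

lemma N_pos: "pos_cone x \<Longrightarrow> Re (N (cvec x)) > 0"
proof -
  assume x: "pos_cone x"
  interpret N': stable_family c d e W "\<lambda>z b. N z" by (rule stable_family_N)
  show ?thesis using N'.f_pos[of x "\<lambda>_. 0"] x by (simp add: N'.f_def)
qed

text \<open>The vector \<open>(0, -1_i)\<close> lies in the closure of the hyperbolicity cone of the polynomial in
  \<open>(x, b)\<close>; adding it switches the operator with index \<open>i\<close> off.\<close>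

lemma mcone_remove:
  assumes adm: "admissible S p (set (L @ [i]))" and i: "i \<notin> set L"
    and cone: "mcone (mixes S p (L @ [i])) x (\<lambda>_. 1)"
  shows "mcone (mixes S p L) x (\<lambda>_. 1)"
proof -
  have adm': "admissible S p (set L)" using adm by (auto simp: admissible_def)
  interpret F: stable_family c d e W "mixes S p L" by (rule stable_family_mixes[OF adm'])
  interpret G: stable_family c d e W "mixes S p (L @ [i])" by (rule stable_family_mixes[OF adm])
  obtain \<eta> where \<eta>: "\<eta> > 0" "G.F.cone (x - \<eta> *\<^sub>R e) (\<lambda>_. 1)"
    using G.F.cone_open[OF cone] by auto
  \<comment> \<open>With \<open>b_i = -1\<close> the operator adds \<open>w\<close> instead of
    subtracting it, so the value is a mean of \<open>N\<close> over points
    \<open>w + (\<eta> + s) e\<close> of the open cone.\<close>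
  have "G.F.cone (\<eta> *\<^sub>R e) (\<lambda>j. if j = i then -1 else 0)"
    unfolding G.F.cone_def
  proof (intro allI impI)
    fix s :: real assume s: "s \<ge> 0"
    define x' where "x' = (\<lambda>w. \<eta> *\<^sub>R e + s *\<^sub>R e + w)"
    have "Re (mixes S p (L @ [i]) (cvec (\<eta> *\<^sub>R e + s *\<^sub>R e)) (\<lambda>j. complex_of_real (if j = i then -1 else 0)))
      = (\<Sum>w\<in>S i. p i w * Re (N (cvec (x' w))))"
    proof -
      have "mixes S p L z (\<lambda>j. complex_of_real (if j = i then -1 else 0)) = N z" for z
        using i by (intro mixes_0 adm') auto
      then show ?thesis by (simp add: mixes_snoc mix_def x'_def cvec_add)
    qed
    also have "\<dots> > 0"
    proof -
      have pos: "Re (N (cvec (x' w))) > 0" if "w \<in> S i" for w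
      proof -
        have "pos_cone (w + (\<eta> + s) *\<^sub>R e)"
          using W_psd[of w] adm that \<eta> s by (auto simp: admissible_def psd_def)
        then show ?thesis using N_pos by (simp add: x'_def algebra_simps)
      qed
      have w: "finite (S i)" "\<forall>w\<in>S i. p i w \<ge> 0" "sum (p i) (S i) = 1"
        using adm by (auto simp: admissible_def weights_def)
      obtain w where "w \<in> S i" "p i w \<noteq> 0"
        using w(3) by (metis sum.neutral zero_neq_one)
      then show ?thesis
        using w pos by (intro sum_pos2[of _ w]) (auto simp: less_imp_le order_less_le)
    qed
    finally show "mixes S p (L @ [i]) (cvec (\<eta> *\<^sub>R e + s *\<^sub>R e))
        (\<lambda>j. complex_of_real (if j = i then -1 else 0)) \<noteq> 0" by auto
  qed
  from G.F.cone_add[OF \<eta>(2) this]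
  have "G.F.cone x (\<lambda>j. 1 + (if j = i then -1 else 0))" by simp
  moreover have "mixes S p (L @ [i]) z (\<lambda>j. complex_of_real (1 + (if j = i then -1 else 0)))
    = mixes S p L z (\<lambda>j. complex_of_real 1)" for z
  proof -
    have "mixes S p (L @ [i]) z (\<lambda>j. complex_of_real (1 + (if j = i then -1 else 0)))
      = of_real (sum (p i) (S i)) * mixes S p L z (\<lambda>j. complex_of_real (1 + (if j = i then -1 else 0)))"
      by (simp add: mixes_snoc mix_def sum_distrib_right)
    also have "complex_of_real (sum (p i) (S i)) = 1"
      using adm by (simp add: admissible_def weights_def del: of_real_sum)
    also have "mixes S p L z (\<lambda>j. complex_of_real (1 + (if j = i then -1 else 0)))
      = mixes S p L z (\<lambda>j. complex_of_real 1)"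
      using i by (intro mixes_cong_b) auto
    finally show ?thesis by simp
  qed
  ultimately show ?thesis unfolding F.F.cone_def G.F.cone_def by simp
qed

text \<open>With \<open>i\<close> moved to the end, \<open>exists_good_point\<close> selects
  \<open>w\<close>. The operator with support \<open>{w}\<close> is a translation by
  \<open>- b_i w\<close>, so the selected property at \<open>t e - w\<close> is the claim at
  \<open>t e\<close>.\<close>

lemma realise_one:
  assumes adm: "admissible S p (set L)" and L: "distinct L" "i \<in> set L"
    and cone: "\<And>t. t > \<rho> \<Longrightarrow> mcone (mixes S p L) (t *\<^sub>R e) (\<lambda>_. 1)"
  shows "\<exists>w\<in>S i. \<forall>t>\<rho>. mcone (mixes (S(i := {w})) (p(i := (\<lambda>_. 1))) L) (t *\<^sub>R e) (\<lambda>_. 1)"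
proof -
  define L' where "L' = remove1 i L"
  have ms: "mset L = mset (L' @ [i])" using L by (simp add: L'_def)
  have i: "i \<notin> set L'" using L by (simp add: L'_def)
  have seteq: "set L = set (L' @ [i])" using ms by (metis set_mset_mset)
  have adm': "admissible S p (set (L' @ [i]))" using adm seteq by simp
  have adm'': "admissible S p (set L')" using adm' by (auto simp: admissible_def)
  have Si: "S i \<subseteq> W" "weights (S i) (p i)" using adm' by (auto simp: admissible_def)
  have eq: "mixes S p L = mix i (S i) (p i) (mixes S p L')"
    unfolding mixes_mset[OF ms] mixes_snoc ..
  interpret F: stable_family c d e W "mixes S p L'" by (rule stable_family_mixes[OF adm''])
  have "\<exists>w\<in>S i. \<forall>t>\<rho>. F.F.cone (t *\<^sub>R e - w) (\<lambda>_. 1)"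
  proof (rule F.exists_good_point[OF Si])
    show "mcone (mix i (S i) (p i) (mixes S p L')) (t *\<^sub>R e) (\<lambda>_. 1)" if "t > \<rho>" for t
      using cone[OF that] by (simp add: eq)
    show "F.F.cone (t *\<^sub>R e) (\<lambda>_. 1)" if "t > \<rho>" for t
      using cone[OF that] mcone_remove[OF adm' i] by (simp add: mixes_mset[OF ms])
  qed simp
  then obtain w where w: "w \<in> S i" "\<And>t. t > \<rho> \<Longrightarrow> F.F.cone (t *\<^sub>R e - w) (\<lambda>_. 1)" by auto
  let ?S = "S(i := {w})" and ?p = "p(i := (\<lambda>_. 1))"
  have eq': "mixes ?S ?p L = mix i {w} (\<lambda>_. 1) (mixes S p L')"
  proof -
    have "mixes ?S ?p L' = mixes S p L'" using i by (intro mixes_cong) auto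
    then show ?thesis unfolding mixes_mset[OF ms] mixes_snoc by simp
  qed
  interpret G: stable_family c d e W "mix i {w} (\<lambda>_. 1) (mixes S p L')"
    using w(1) Si by (intro F.stable_family_mix) (auto simp: weights_def)
  have "G.F.cone (t *\<^sub>R e) (\<lambda>_. 1)" if "t > \<rho>" for t
    using w(2)[OF that] unfolding G.F.cone_def F.F.cone_def
    by (simp add: mix_def cvec_add cvec_diff add_diff_eq diff_add_eq)
  then show ?thesis using w(1) by (intro bexI[of _ w]) (simp_all add: eq')
qed

lemma realise_all:
  assumes adm: "admissible S p (set L)" and L: "distinct L"
    and cone: "\<And>t. t > \<rho> \<Longrightarrow> mcone (mixes S p L) (t *\<^sub>R e) (\<lambda>_. 1)"
  shows "\<exists>\<kappa>. (\<forall>i\<in>set L. \<kappa> i \<in> S i) \<and> (\<forall>t>\<rho>. N (cvec (t *\<^sub>R e - (\<Sum>i\<in>set L. \<kappa> i))) \<noteq> 0)"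
proof -
  \<comment> \<open>Supports and weights once the indices in \<open>A\<close> are fixed at
    \<open>\<kappa>\<close>. The list \<open>L\<close> stays the same; when \<open>A\<close> is all
    of it, the mixed polynomial is a translate of \<open>N\<close>.\<close>
  define SS where "SS = (\<lambda>A \<kappa> i. if i \<in> A then {\<kappa> i} else S i)"
  define PP where "PP = (\<lambda>A i. if i \<in> A then (\<lambda>_. 1) else p i)"
  have step: "\<exists>\<kappa>. (\<forall>i\<in>A. \<kappa> i \<in> S i) \<and> (\<forall>t>\<rho>. mcone (mixes (SS A \<kappa>) (PP A) L) (t *\<^sub>R e) (\<lambda>_. 1))"
    if "finite A" "A \<subseteq> set L" for A
    using that
  proof (induction A rule: finite_subset_induct')
    case empty
    then show ?case using cone by (simp add: SS_def PP_def)
  next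
    case (insert i A)
    then obtain \<kappa> where \<kappa>: "\<forall>i\<in>A. \<kappa> i \<in> S i"
      "\<And>t. t > \<rho> \<Longrightarrow> mcone (mixes (SS A \<kappa>) (PP A) L) (t *\<^sub>R e) (\<lambda>_. 1)" by auto
    have "admissible (SS A \<kappa>) (PP A) (set L)"
      using adm \<kappa>(1) insert.hyps by (auto simp: admissible_def SS_def PP_def weights_def)
    then have "\<exists>w\<in>SS A \<kappa> i. \<forall>t>\<rho>. mcone (mixes ((SS A \<kappa>)(i := {w})) ((PP A)(i := (\<lambda>_. 1))) L) (t *\<^sub>R e) (\<lambda>_. 1)"
      by (rule realise_one[OF _ L]) (use insert.hyps \<kappa>(2) in auto)
    then obtain w where w: "w \<in> SS A \<kappa> i"
      "\<forall>t>\<rho>. mcone (mixes ((SS A \<kappa>)(i := {w})) ((PP A)(i := (\<lambda>_. 1))) L) (t *\<^sub>R e) (\<lambda>_. 1)"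
      by auto
    have "(SS A \<kappa>)(i := {w}) = SS (insert i A) (\<kappa>(i := w))" "(PP A)(i := (\<lambda>_. 1)) = PP (insert i A)"
      using insert.hyps by (auto simp: SS_def PP_def fun_eq_iff)
    moreover have "w \<in> S i" using w(1) insert.hyps by (simp add: SS_def)
    then have "\<forall>i'\<in>insert i A. (\<kappa>(i := w)) i' \<in> S i'" using \<kappa>(1) by simp
    ultimately show ?case using w(2) by metis
  qed
  from step[of "set L"] obtain \<kappa> where \<kappa>: "\<forall>i\<in>set L. \<kappa> i \<in> S i"
    "\<And>t. t > \<rho> \<Longrightarrow> mcone (mixes (SS (set L) \<kappa>) (PP (set L)) L) (t *\<^sub>R e) (\<lambda>_. 1)" by auto
  have "N (cvec (t *\<^sub>R e - (\<Sum>i\<in>set L. \<kappa> i))) \<noteq> 0" if t: "t > \<rho>" for t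
  proof -
    have adm': "admissible (SS (set L) \<kappa>) (PP (set L)) (set L)"
      using adm \<kappa>(1) by (auto simp: admissible_def SS_def PP_def weights_def)
    interpret F: stable_family c d e W "mixes (SS (set L) \<kappa>) (PP (set L)) L"
      by (rule stable_family_mixes[OF adm'])
    have "mixes (SS (set L) \<kappa>) (PP (set L)) L = mixes (\<lambda>i. {\<kappa> i}) (\<lambda>_ _. 1) L"
      by (rule mixes_cong) (auto simp: SS_def PP_def)
    then have "N (cvec (t *\<^sub>R e) - (\<Sum>i\<leftarrow>L. cvec (\<kappa> i))) \<noteq> 0"
      using F.F.cone_imp_ne_0[OF \<kappa>(2)[OF t]] mixes_singletons[of \<kappa> L "cvec (t *\<^sub>R e)"] by simp
    moreover have "(\<Sum>i\<leftarrow>L. cvec (\<kappa> i)) = cvec (\<Sum>i\<in>set L. \<kappa> i)"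
      using L by (simp add: sum_list_distinct_conv_sum_set) (simp add: vec_eq_iff)
    ultimately show ?thesis by (simp add: cvec_diff)
  qed
  then show ?thesis using \<kappa>(1) by blast
qed

text \<open>For \<open>w\<close> in \<open>W\<close> this is the trace: \<open>N\<close> is affine
  along \<open>w\<close> from \<open>e\<close>, with slope \<open>tr(w)\<close>.\<close>

definition rank_one_trace :: "real ^ 'n \<Rightarrow> real" where
  "rank_one_trace w = Re (N (cvec (e + w))) - 1"

definition weighted_mean :: "(nat \<Rightarrow> (real ^ 'n) set) \<Rightarrow> (nat \<Rightarrow> real ^ 'n \<Rightarrow> real) \<Rightarrow> nat \<Rightarrow> real ^ 'n" where
  "weighted_mean S p i = (\<Sum>w\<in>S i. p i w *\<^sub>R w)"

abbreviation mbarrier where "mbarrier F \<equiv> stable_family.barrier F"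

text \<open>By homogeneity the step \<open>w\<close> at \<open>s e\<close> is the step
  \<open>w / s\<close> at \<open>e\<close>. This is the starting value of the chain.\<close>

lemma barrier_N:
  assumes w: "w \<in> W" and s: "s > 0"
  shows "mbarrier (\<lambda>z b. N z) w b (s *\<^sub>R e) = rank_one_trace w / s"
proof -
  interpret N': stable_family c d e W "\<lambda>z b. N z" by (rule stable_family_N)
  have 1: "N'.f b e = 1" by (simp add: N'.f_def N_e)
  have hom: "N'.f b (s *\<^sub>R x) = s ^ d * N'.f b x" for x
    by (simp add: N'.f_def cvec_scaleR N_hom flip: of_real_power)
  have "N'.f b (s *\<^sub>R e + w) = N'.f b (s *\<^sub>R (e + (1 / s) *\<^sub>R w))"
    using s by (simp add: algebra_simps)
  also have "\<dots> = s ^ d * (1 + (1 / s) * rank_one_trace w)"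
  proof -
    have "rank_one_trace w = N'.f b (e + w) - 1" by (simp add: rank_one_trace_def N'.f_def)
    then show ?thesis using N'.f_affine[OF w, of b e "1 / s"] unfolding hom by (simp add: 1 N'.increment_def)
  qed
  finally show ?thesis using s by (simp add: N'.barrier_def N'.increment_def hom 1 field_simps)
qed

lemma pos_cone_scale_e: "s > 0 \<Longrightarrow> pos_cone (s *\<^sub>R e)"
  by (intro pos_cone_scale pos_cone_e)

text \<open>Keeping the bound \<open>rank_one_trace w / s\<close> for all \<open>w\<close> in
  \<open>W\<close> bounds every mean barrier by \<open>\<epsilon> / s\<close>, so the single
  condition \<open>bound\<close> permits each step.\<close>

lemma barrier_chain:
  assumes adm: "admissible S p (set L)" and L: "distinct L"
    and tr: "\<And>i. i \<in> set L \<Longrightarrow> (\<Sum>w\<in>S i. p i w * rank_one_trace w) \<le> \<epsilon>"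
    and pos: "s > 0" "\<delta> > 0" "a \<ge> 0" and bound: "a * (\<epsilon> / s + 1 / \<delta>) \<le> 1"
    and b: "\<And>i. i \<in> set L \<Longrightarrow> b i = a"
  defines "x \<equiv> s *\<^sub>R e + \<delta> *\<^sub>R (\<Sum>i\<in>set L. weighted_mean S p i)"
  shows "mcone (mixes S p L) x b \<and> (\<forall>w\<in>W. mbarrier (mixes S p L) w b x \<le> rank_one_trace w / s)"
  using adm L tr b unfolding x_def
proof (induction L rule: rev_induct)
  case Nil
  then show ?case
    using pos by (simp add: mixes_Nil N_cone_any[of _ b] pos_cone_scale_e barrier_N)
next
  case (snoc i L)
  define x where "x = s *\<^sub>R e + \<delta> *\<^sub>R (\<Sum>i\<in>set L. weighted_mean S p i)"
  have adm': "admissible S p (set L)" using snoc.prems(1) by (auto simp: admissible_def)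
  have Si: "S i \<subseteq> W" "weights (S i) (p i)" using snoc.prems(1) by (auto simp: admissible_def)
  interpret F: stable_family c d e W "mixes S p L" by (rule stable_family_mixes[OF adm'])
  have IH: "F.F.cone x b" "\<And>w. w \<in> W \<Longrightarrow> F.barrier w b x \<le> rank_one_trace w / s"
    using snoc adm' unfolding x_def by auto
  have bi: "b i = a" using snoc.prems(4)[of i] by simp
  have "(\<Sum>w\<in>S i. p i w * F.barrier w b x) \<le> (\<Sum>w\<in>S i. p i w * (rank_one_trace w / s))"
    using Si by (intro sum_mono mult_left_mono IH(2)) (auto simp: weights_def)
  also have "\<dots> = (\<Sum>w\<in>S i. p i w * rank_one_trace w) / s" by (simp add: sum_divide_distrib)
  also have "\<dots> \<le> \<epsilon> / s" using snoc.prems(3)[of i] pos by (intro divide_right_mono) auto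
  finally have le: "(\<Sum>w\<in>S i. p i w * F.barrier w b x) \<le> \<epsilon> / s" .
  have "b i * ((\<Sum>w\<in>S i. p i w * F.barrier w b x) + 1 / \<delta>) \<le> a * (\<epsilon> / s + 1 / \<delta>)"
    unfolding bi using le pos by (intro mult_left_mono) auto
  with bound have le1: "b i * ((\<Sum>w\<in>S i. p i w * F.barrier w b x) + 1 / \<delta>) \<le> 1" by simp
  have y: "x + \<delta> *\<^sub>R (\<Sum>w\<in>S i. p i w *\<^sub>R w) = s *\<^sub>R e + \<delta> *\<^sub>R (\<Sum>i\<in>set (L @ [i]). weighted_mean S p i)"
    using snoc.prems(2) by (simp add: x_def weighted_mean_def scaleR_add_right)
  have "b i \<ge> 0" using bi pos by simp
  from F.barrier_step[OF Si IH(1) this pos(2) le1] IH(2) show ?case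
    unfolding y mixes_snoc by force
qed

end

subsection \<open>The bound for the mean polynomial\<close>

text \<open>Room above \<open>\<epsilon>\<close>: it makes the condition on the last operator strict
  and gives \<open>\<epsilon>' > 1 / m\<close>.\<close>

lemma delta_bound_right_continuous:
  assumes "delta_bound \<epsilon> m < t"
  obtains \<epsilon>' where "\<epsilon>' > \<epsilon>" "delta_bound \<epsilon>' m < t"
proof -
  have "((\<lambda>x. delta_bound x m) \<longlongrightarrow> delta_bound \<epsilon> m) (at_right \<epsilon>)"
    unfolding delta_bound_def by (intro tendsto_intros)
  then have "\<forall>\<^sub>F x in at_right \<epsilon>. delta_bound x m < t"
    using assms by (rule order_tendstoD)
  then obtain b where "b > \<epsilon>" "\<forall>y>\<epsilon>. y < b \<longrightarrow> delta_bound y m < t"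
    unfolding eventually_at_right_field by auto
  then show ?thesis using that[of "(\<epsilon> + b) / 2"] by simp
qed

text \<open>With \<open>u = \<beta> - 1\<close> the constraint gives
  \<open>\<beta> - a = u / A\<close>, and \<open>\<beta> * \<epsilon> + A * \<delta>\<close> is a
  constant plus \<open>u * R\<^sup>2 + A\<^sup>2 / u\<close>, least at \<open>u = A / R\<close>. The
  assumption on \<open>\<epsilon>\<close> means \<open>R > 1 / m\<close>, that is
  \<open>u < m - 1\<close>, that is \<open>a > 0\<close>.\<close>

lemma delta_bound_optimum:
  fixes \<epsilon> A R \<beta> a \<delta> :: real and m :: nat
  assumes m: "m \<ge> 2" and \<epsilon>: "\<epsilon> > 1 / real m"
  defines "A \<equiv> 1 - 1 / real m"
  defines "R \<equiv> sqrt (\<epsilon> - (1 / real m) * A)"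
  defines "\<beta> \<equiv> 1 + A / R"
  defines "a \<equiv> (real m - \<beta>) / (real m - 1)"
  defines "\<delta> \<equiv> a * \<beta> / (\<beta> - a)"
  shows "0 < a" "a < \<beta>" "1 < \<beta>" "(real m - 1) * a + \<beta> = real m" "\<beta> * \<epsilon> + A * \<delta> = delta_bound \<epsilon> m"
proof -
  have m0: "real m \<ge> 2" using m by simp
  have A: "A > 0" "A * real m = real m - 1" using m0 by (auto simp: A_def field_simps)
  have "R > 1 / m"
  proof -
    have "1 / real m - (1 / m) * A = (1 / m) ^ 2" using m0 by (simp add: A_def field_simps power2_eq_square)
    then have "(1 / real m) ^ 2 < \<epsilon> - (1 / m) * A" using \<epsilon> by simp
    then show ?thesis unfolding R_def by (rule real_less_rsqrt)
  qed
  then have R: "R > 0" "1 < m * R" using m0 by (auto simp: field_simps intro: less_trans[of 0 "1 / real m"])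
  have "A < A * (m * R)" using A(1) R(2) by simp
  then have "A / R < A * real m" using R(1) by (simp add: pos_divide_less_eq mult.assoc)
  then have u: "A / R < real m - 1" "A / R > 0" using R A by auto
  show "1 < \<beta>" using u by (simp add: \<beta>_def)
  show a: "0 < a" using u m0 by (simp add: a_def \<beta>_def)
  have a_eq: "a = 1 - (A / R) / (real m - 1)"
  proof -
    have "real m - \<beta> = (real m - 1) - A / R" by (simp add: \<beta>_def)
    then have "a = (real m - 1) / (real m - 1) - (A / R) / (real m - 1)"
      unfolding a_def by (simp only: diff_divide_distrib[of "real m - 1"])
    also have "(real m - 1) / (real m - 1) = 1" using m0 by (intro divide_self) simp
    finally show ?thesis .
  qed
  have "(A / R) / (real m - 1) > 0" using m0 by (intro divide_pos_pos A(1) R(1)) auto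
  then have "a < 1" unfolding a_eq by linarith
  then show "a < \<beta>" using u unfolding \<beta>_def by linarith
  show "(real m - 1) * a + \<beta> = real m" using m0 by (simp add: a_def field_simps)
  have diff: "\<beta> - a = 1 / R"
  proof -
    have "\<beta> - a = (A / R) * (1 + 1 / (real m - 1))" by (simp add: \<beta>_def a_eq algebra_simps)
    also have "1 + 1 / (real m - 1) = 1 / A" using m0 by (simp add: A_def field_simps)
    finally show ?thesis using A by simp
  qed
  have a_eq': "A * a = A - (A / R) / m"
  proof -
    have "a = 1 - (A / R) / (A * real m)" using A by (simp add: a_eq)
    then show ?thesis using A(1) by (simp add: right_diff_distrib)
  qed
  have "R\<^sup>2 = \<epsilon> - (1 / m) * A"
  proof -
    have "(1 / m) * A \<le> 1 / m" using m0 by (simp add: A_def field_simps)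
    then show ?thesis unfolding R_def using \<epsilon> by simp
  qed
  then have \<epsilon>_eq: "\<epsilon> = R\<^sup>2 + A / m" by simp
  have "A * \<delta> = (A * a) * \<beta> * R" using diff by (simp add: \<delta>_def)
  also have "\<dots> = (A - (A / R) / m) * (1 + A / R) * R" by (simp add: a_eq' \<beta>_def)
  finally have "\<beta> * \<epsilon> + A * \<delta> = (1 + A / R) * (R\<^sup>2 + A / m) + (A - (A / R) / m) * (1 + A / R) * R"
    by (simp add: \<epsilon>_eq \<beta>_def)
  also have "\<dots> = (A + R)\<^sup>2" using R(1) m0 by (simp add: field_simps power2_eq_square)
  also have "\<dots> = delta_bound \<epsilon> m" by (simp add: delta_bound_def A_def R_def)
  finally show "\<beta> * \<epsilon> + A * \<delta> = delta_bound \<epsilon> m" .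
qed

context rank_one_family
begin

text \<open>After the last operator no barrier has to be controlled any more, so
  \<open>cone_mix\<close> takes the place of \<open>barrier_step\<close>.\<close>

lemma mcone_last:
  assumes adm: "admissible S p (set (L @ [k]))" and L: "distinct (L @ [k])"
    and tr: "\<And>i. i \<in> set (L @ [k]) \<Longrightarrow> (\<Sum>w\<in>S i. p i w * rank_one_trace w) \<le> \<epsilon>"
    and pos: "s > 0" "\<delta> > 0" "a \<ge> 0" "\<beta> \<ge> 0"
    and bound: "a * (\<epsilon> / s + 1 / \<delta>) \<le> 1" "\<beta> * (\<epsilon> / s) < 1"
  shows "mcone (mixes S p (L @ [k])) (s *\<^sub>R e + \<delta> *\<^sub>R (\<Sum>i\<in>set L. weighted_mean S p i)) (\<lambda>j. if j = k then \<beta> else a)"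
proof -
  define x where "x = s *\<^sub>R e + \<delta> *\<^sub>R (\<Sum>i\<in>set L. weighted_mean S p i)"
  define b where "b = (\<lambda>j. if j = k then \<beta> else a)"
  have adm': "admissible S p (set L)" using adm by (auto simp: admissible_def)
  have Sk: "S k \<subseteq> W" "weights (S k) (p k)" using adm by (auto simp: admissible_def)
  interpret F: stable_family c d e W "mixes S p L" by (rule stable_family_mixes[OF adm'])
  have "F.F.cone x b \<and> (\<forall>w\<in>W. F.barrier w b x \<le> rank_one_trace w / s)"
    unfolding x_def by (rule barrier_chain[OF adm' _ _ pos(1-3) bound(1)]) (use L tr in \<open>auto simp: b_def\<close>)
  then have IH: "F.F.cone x b" "\<And>w. w \<in> W \<Longrightarrow> F.barrier w b x \<le> rank_one_trace w / s" by auto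
  have "(\<Sum>w\<in>S k. p k w * F.barrier w b x) \<le> (\<Sum>w\<in>S k. p k w * (rank_one_trace w / s))"
    using Sk by (intro sum_mono mult_left_mono IH(2)) (auto simp: weights_def)
  also have "\<dots> = (\<Sum>w\<in>S k. p k w * rank_one_trace w) / s" by (simp add: sum_divide_distrib)
  also have "\<dots> \<le> \<epsilon> / s" using tr[of k] pos by (intro divide_right_mono) auto
  finally have "\<beta> * (\<Sum>w\<in>S k. p k w * F.barrier w b x) \<le> \<beta> * (\<epsilon> / s)"
    using pos(4) by (rule mult_left_mono)
  moreover have bk: "b k = \<beta>" by (simp add: b_def)
  ultimately have "b k * (\<Sum>w\<in>S k. p k w * F.barrier w b x) < 1" using bound(2) by simp
  moreover have "b k \<ge> 0" using pos bk by simp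
  ultimately have "mcone (mix k (S k) (p k) (mixes S p L)) x b"
    by (intro F.cone_mix[OF Sk IH(1)])
  then show ?thesis by (simp add: mixes_snoc x_def b_def)
qed

text \<open>All operators but the last one need a shift of the point, and the last one tolerates a larger
  coefficient. Averaging over the choice of the last operator, which is possible because the cone
  in the variables \<open>(x, b)\<close> is convex, yields the stated constant.\<close>

theorem mean_cone_bound:
  assumes adm: "admissible S p {..<m}" and m: "m \<ge> 1"
    and sum: "(\<Sum>i<m. weighted_mean S p i) = e"
    and tr: "\<And>i. i < m \<Longrightarrow> (\<Sum>w\<in>S i. p i w * rank_one_trace w) \<le> \<epsilon>"
    and \<epsilon>: "\<epsilon> \<ge> 1 / m" and t: "t > delta_bound \<epsilon> m"
  shows "mcone (mixes S p [0..<m]) (t *\<^sub>R e) (\<lambda>_. 1)"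
proof (cases "m = 1")
  case True
  \<comment> \<open>Here \<open>a\<close> would be a quotient by \<open>m - 1 = 0\<close>. The only
    operator is the last one, and \<open>delta_bound \<epsilon> 1 = \<epsilon>\<close>.\<close>
  then have "t > \<epsilon>" "\<epsilon> > 0" using t \<epsilon> by (auto simp: delta_bound_def)
  then have "mcone (mixes S p ([] @ [0])) (t *\<^sub>R e + 1 *\<^sub>R (\<Sum>i\<in>set []. weighted_mean S p i)) (\<lambda>j. if j = 0 then 1 else 0)"
    using adm tr True by (intro mcone_last[where \<epsilon> = \<epsilon>]) (auto simp: lessThan_Suc)
  then have "mcone (mixes S p [0]) (t *\<^sub>R e) (\<lambda>j. if j = 0 then 1 else 0)" by simp
  then have "mcone (mixes S p [0]) (t *\<^sub>R e) (\<lambda>_. 1)"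
    by (rule mcone_cong[rotated 2]) (use adm True in \<open>auto simp: lessThan_Suc\<close>)
  then show ?thesis using True by simp
next
  case False
  then have m2: "m \<ge> 2" using m by simp
  obtain \<epsilon>' where \<epsilon>': "\<epsilon>' > \<epsilon>" "delta_bound \<epsilon>' m < t" using delta_bound_right_continuous[OF t] .
  define A where "A = 1 - 1 / real m"
  define R where "R = sqrt (\<epsilon>' - (1 / real m) * A)"
  define \<beta> where "\<beta> = 1 + A / R"
  define a where "a = (real m - \<beta>) / (real m - 1)"
  define \<delta> where "\<delta> = a * \<beta> / (\<beta> - a)"
  have "\<epsilon>' > 1 / m" using \<epsilon> \<epsilon>' by simp
  note opt = delta_bound_optimum[OF m2 this, folded A_def, folded R_def, folded \<beta>_def, folded a_def, folded \<delta>_def]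
  \<comment> \<open>Solves \<open>\<beta> * (\<epsilon>' / s) = 1\<close>, so that
    \<open>\<epsilon> < \<epsilon>'\<close> gives strictness; likewise \<open>\<delta>\<close>
    solves \<open>a * (1 / \<beta> + 1 / \<delta>) = 1\<close>.\<close>
  define s where "s = \<beta> * \<epsilon>'"
  have "1 / real m > 0" using m by simp
  then have \<epsilon>0: "\<epsilon> > 0" "\<epsilon>' > 0" using \<epsilon> \<epsilon>' by linarith+
  have s: "s > 0" using opt \<epsilon>0 by (simp add: s_def)
  have \<delta>: "\<delta> > 0" using opt by (simp add: \<delta>_def)
  have q: "\<beta> * (\<epsilon> / s) < 1" "\<epsilon> / s \<le> 1 / \<beta>"
    using opt \<epsilon>0 \<epsilon>'(1) by (auto simp: s_def field_simps)
  have "a * (\<epsilon> / s + 1 / \<delta>) \<le> a * (1 / \<beta> + 1 / \<delta>)"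
    using opt q by (intro mult_left_mono) auto
  also have "\<dots> = 1"
    using opt by (simp add: \<delta>_def field_simps)
  finally have bound: "a * (\<epsilon> / s + 1 / \<delta>) \<le> 1" .
  have adm': "admissible S p (set [0..<m])" using adm by (simp add: atLeast0LessThan)
  interpret F: stable_family c d e W "mixes S p [0..<m]" by (rule stable_family_mixes[OF adm'])
  \<comment> \<open>The position with \<open>k\<close> as last index: the means add up to
    \<open>e\<close>, so the shifts of the others add up to \<open>\<delta>\<close> times
    \<open>e\<close> minus the mean of index \<open>k\<close>.\<close>
  define x where "x = (\<lambda>k. s *\<^sub>R e + \<delta> *\<^sub>R (e - weighted_mean S p k))"
  define b where "b = (\<lambda>(k::nat) (j::nat). if j = k then \<beta> else a)"
  have "F.F.cone (x k) (b k)" if k: "k \<in> {..<m}" for k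
  proof -
    define L where "L = remove1 k [0..<m]"
    have ms: "mset [0..<m] = mset (L @ [k])" using k by (simp add: L_def)
    have seteq: "set (L @ [k]) = {..<m}" using ms by (metis set_mset_mset set_upt atLeast0LessThan)
    have dist: "distinct (L @ [k])" by (simp add: L_def)
    have setL: "set L = {..<m} - {k}" by (simp add: L_def atLeast0LessThan)
    have "(\<Sum>i\<in>set L. weighted_mean S p i) = e - weighted_mean S p k"
      using k by (simp add: setL sum_diff1 sum)
    moreover have "mcone (mixes S p (L @ [k])) (s *\<^sub>R e + \<delta> *\<^sub>R (\<Sum>i\<in>set L. weighted_mean S p i)) (\<lambda>j. if j = k then \<beta> else a)"
      using adm tr opt s \<delta> bound q(1) dist
      by (intro mcone_last[where \<epsilon> = \<epsilon>]) (simp_all only: seteq, auto)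
    ultimately show ?thesis by (simp add: mixes_mset[OF ms] x_def b_def)
  qed
  then have "F.F.cone (\<Sum>k<m. x k) (\<lambda>j. \<Sum>k<m. b k j)"
    using m by (intro F.F.cone_sum) (auto simp: lessThan_empty_iff)
  then have "F.F.cone ((1 / m) *\<^sub>R (\<Sum>k<m. x k)) (\<lambda>j. (1 / m) * (\<Sum>k<m. b k j))"
    by (rule F.F.cone_scale) (use m in simp)
  moreover have "(1 / m) *\<^sub>R (\<Sum>k<m. x k) = delta_bound \<epsilon>' m *\<^sub>R e"
  proof -
    have "(\<Sum>k<m. x k) = (m * s) *\<^sub>R e + \<delta> *\<^sub>R (m *\<^sub>R e - e)"
      by (simp add: x_def sum.distrib sum_subtractf sum sum_constant_scaleR del: sum_constant flip: scaleR_sum_right)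
    then have "(\<Sum>k<m. x k) = (m * s + \<delta> * (m - 1)) *\<^sub>R e"
      using m by (simp add: of_nat_diff algebra_simps)
    moreover have "(1 / m) * (m * s + \<delta> * (m - 1)) = s + A * \<delta>"
      using m by (simp add: A_def of_nat_diff field_simps)
    ultimately have "(1 / m) *\<^sub>R (\<Sum>k<m. x k) = (s + A * \<delta>) *\<^sub>R e" by simp
    then show ?thesis using opt(5) by (simp add: s_def)
  qed
  moreover have "(1 / m) * (\<Sum>k<m. b k j) = 1" if "j \<in> set [0..<m]" for j
  proof -
    have "(\<Sum>k<m. b k j) = (\<Sum>k\<in>{..<m} - {j}. a) + \<beta>"
      using that by (subst sum.remove[of _ j]) (auto simp: b_def)
    also have "\<dots> = m" using that opt(4) m by (simp add: of_nat_diff)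
    finally show ?thesis using m by simp
  qed
  ultimately have "F.F.cone (delta_bound \<epsilon>' m *\<^sub>R e) (\<lambda>_. 1)"
    using mcone_cong[OF adm', of "\<lambda>j. (1 / m) * (\<Sum>k<m. b k j)" "\<lambda>_. 1"] by metis
  from F.F.cone_add_e[OF this, of "t - delta_bound \<epsilon>' m"] show ?thesis
    using \<epsilon>'(2) by (simp add: algebra_simps)
qed

end

subsection \<open>Eigenvalues\<close>

context hyperbolic_polynomial
begin

text \<open>Justifies the choice in \<open>eigs\<close>: the leading coefficient \<open>h(e)\<close>
  is nonzero, so the restriction has \<open>d\<close> complex roots, and hyperbolicity makes them
  real.\<close>

lemma exists_eigs: "\<exists>M. size M = d \<and> (\<forall>t. peval c (t *\<^sub>R e - x) = peval c e * (\<Prod>l\<in>#M. (t - l)))"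
proof -
  define Q where "Q = line_poly c (cvec (- x)) (cvec e)"
  have top: "coeff Q d = of_real (peval c e)"
    unfolding Q_def by (simp add: line_poly_top(2)[OF hom] peval_cvec)
  have deg: "degree Q = d"
  proof (rule antisym)
    show "degree Q \<le> d" unfolding Q_def by (rule line_poly_top(1)[OF hom])
    show "d \<le> degree Q" by (rule le_degree) (simp add: top peval_e)
  qed
  have "Q \<noteq> 0" using top peval_e by auto
  then obtain B where B: "size B = d" "Q = smult (of_real (peval c e)) (\<Prod>x\<in>#B. [:-x, 1:])"
    using alg_closed_imp_factorization[of Q] deg top by auto
  have real: "l \<in> \<real>" if "l \<in># B" for l
  proof -
    have "poly Q l = 0" using that unfolding B(2) by (auto simp: poly_prod_mset prod_mset_zero_iff)
    then have "peval c (cvec (- x) + l *s cvec e) = 0" by (simp add: Q_def poly_line_poly)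
    moreover have "cvec (- x) + l *s cvec e = (\<chi> i. l * complex_of_real (e $ i) - complex_of_real (x $ i))"
      by (simp add: vec_eq_iff)
    ultimately show ?thesis using hyperbolic unfolding hyperbolic_def by auto
  qed
  have "complex_of_real (peval c (t *\<^sub>R e - x)) = of_real (peval c e * (\<Prod>l\<in>#image_mset Re B. (t - l)))" for t
  proof -
    have "complex_of_real (peval c (t *\<^sub>R e - x)) = poly Q (of_real t)"
    proof -
      have "cvec (t *\<^sub>R e - x) = cvec (- x) + of_real t *s cvec e" by (simp add: vec_eq_iff)
      then show ?thesis unfolding peval_cvec[symmetric] Q_def poly_line_poly by simp
    qed
    also have "\<dots> = of_real (peval c e) * (\<Prod>l\<in>#B. (of_real t - l))"
      unfolding B(2) by (simp add: poly_prod_mset image_mset.compositionality o_def)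
    also have "(\<Prod>l\<in>#B. (of_real t - l)) = (\<Prod>l\<in>#B. of_real (t - Re l))"
      using real by (intro arg_cong[of _ _ prod_mset] image_mset_cong) (auto simp: complex_is_Real_iff complex_eq_iff)
    also have "\<dots> = of_real (\<Prod>l\<in>#image_mset Re B. (t - l))"
      by (induction B) auto
    finally show ?thesis by simp
  qed
  then show ?thesis using B(1) by (intro exI[of _ "image_mset Re B"]) (auto simp only: of_real_eq_iff size_image_mset)
qed

lemma eigs: "peval c (t *\<^sub>R e - x) = peval c e * (\<Prod>l\<in>#eigs c e x. (t - l))"
  and size_eigs: "size (eigs c e x) = d"
proof -
  obtain M where M: "size M = d" "\<And>t. peval c (t *\<^sub>R e - x) = peval c e * (\<Prod>l\<in>#M. (t - l))"
    using exists_eigs by blast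
  show *: "peval c (t *\<^sub>R e - x) = peval c e * (\<Prod>l\<in>#eigs c e x. (t - l))" for t
    unfolding eigs_def by (rule someI2[of _ M]) (use M in auto)
  have "poly (\<Prod>l\<in>#eigs c e x. [:-l, 1:]) t = poly (\<Prod>l\<in>#M. [:-l, 1:]) t" for t
    using M(2)[of t] *[of t] peval_e by (simp add: poly_prod_mset image_mset.compositionality o_def)
  then have "(\<Prod>l\<in>#eigs c e x. [:-l, 1:]) = (\<Prod>l\<in>#M. [:-l, 1:])"
    by (simp add: poly_eq_poly_eq_iff[symmetric] fun_eq_iff)
  moreover have "degree (\<Prod>l\<in>#K. [:-l, 1:]) = size K" for K :: "real multiset"
  proof (induction K)
    case (add l K)
    have "(\<Prod>l\<in>#K. [:-l, 1:]) \<noteq> 0" by (auto simp: prod_mset_zero_iff)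
    then have "degree ([:-l, 1:] * (\<Prod>l\<in>#K. [:-l, 1:])) = 1 + degree (\<Prod>l\<in>#K. [:-l, 1:])"
      by (subst degree_mult_eq) auto
    then show ?case using add.IH by (simp del: mult_pCons_left)
  qed simp
  ultimately show "size (eigs c e x) = d" using M(1) by metis
qed

lemma lambda_max_le_iff:
  assumes "d \<ge> 1"
  shows "lambda_max c e x \<le> \<rho> \<longleftrightarrow> (\<forall>t>\<rho>. peval c (t *\<^sub>R e - x) \<noteq> 0)"
proof -
  have "set_mset (eigs c e x) \<noteq> {}" using size_eigs[of x] assms by auto
  then have "lambda_max c e x \<le> \<rho> \<longleftrightarrow> (\<forall>l\<in>#eigs c e x. l \<le> \<rho>)"
    by (simp add: lambda_max_def)
  also have "\<dots> \<longleftrightarrow> (\<forall>t>\<rho>. peval c (t *\<^sub>R e - x) \<noteq> 0)"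
    unfolding eigs using peval_e by (force simp: prod_mset_zero_iff)
  finally show ?thesis .
qed

text \<open>\<open>e + t x\<close> is \<open>- t\<close> times \<open>(- 1 / t) e - x\<close>;
  homogeneity distributes one factor \<open>- t\<close> to each of the \<open>d\<close>
  eigenvalues.\<close>

lemma N_affine_line:
  "N (cvec (e + t *\<^sub>R x)) = of_real (\<Prod>l\<in>#eigs c e x. (1 + t * l))"
proof (cases "t = 0")
  case True
  then show ?thesis by (simp add: N_e)
next
  case False
  have "cvec (e + t *\<^sub>R x) = of_real (- t) *s cvec ((- 1 / t) *\<^sub>R e - x)"
    using False by (simp add: vec_eq_iff field_simps)
  then have "N (cvec (e + t *\<^sub>R x)) = of_real ((- t) ^ d * (\<Prod>l\<in>#eigs c e x. (- 1 / t - l)))"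
    using peval_e by (simp only: N_hom N_cvec eigs) simp
  also have "(- t) ^ d * (\<Prod>l\<in>#eigs c e x. (- 1 / t - l)) = (\<Prod>l\<in>#eigs c e x. (1 + t * l))"
  proof -
    have "(- t) ^ size K * (\<Prod>l\<in>#K. (- 1 / t - l)) = (\<Prod>l\<in>#K. (1 + t * l))" for K
    proof (induction K)
      case (add l K)
      have "(- t) ^ size (add_mset l K) * (\<Prod>l\<in>#add_mset l K. (- 1 / t - l))
        = (- t * (- 1 / t - l)) * ((- t) ^ size K * (\<Prod>l\<in>#K. (- 1 / t - l)))" by simp
      also have "\<dots> = (1 + t * l) * (\<Prod>l\<in>#K. (1 + t * l))"
        using False unfolding add.IH by (simp add: field_simps)
      finally show ?case by simp
    qed simp
    then show ?thesis using size_eigs[of x] by metis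
  qed
  finally show ?thesis .
qed

lemma psd_if_hcone:
  assumes "x \<in> hcone c e"
  shows "psd x"
proof -
  have nonneg: "l \<ge> 0" if "l \<in># eigs c e x" for l
  proof -
    have "lambda_min c e x \<le> l" unfolding lambda_min_def using that by (intro Min_le) auto
    then show ?thesis using assms by (simp add: hcone_def)
  qed
  have "N (cvec (x + t *\<^sub>R e)) \<noteq> 0" if "t > 0" for t
  proof -
    have "cvec (x + t *\<^sub>R e) = of_real t *s cvec (e + (1 / t) *\<^sub>R x)"
      using that by (simp add: vec_eq_iff field_simps)
    moreover have "1 + (1 / t) * l \<noteq> 0" if "l \<in># eigs c e x" for l
      using nonneg[OF that] \<open>t > 0\<close> by (simp add: add_nonneg_eq_0_iff)
    ultimately show ?thesis
      using that by (simp only: N_hom N_affine_line) (auto simp: prod_mset_zero_iff)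
  qed
  then show ?thesis
    unfolding psd_def N.cone_def
    by (auto simp: add.assoc simp flip: scaleR_add_left intro: add_pos_nonneg)
qed

text \<open>Exhibits the trace as a directional derivative at \<open>e\<close>, from which
  \<open>htr_gradient\<close> obtains its linearity.\<close>

lemma htr_derivative:
  "((\<lambda>t. Re (N (cvec (e + t *\<^sub>R x)))) has_real_derivative htr c e x) (at 0)"
proof -
  have "((\<lambda>t::real. \<Prod>l\<in>#K. (1 + t * l)) has_real_derivative sum_mset K) (at 0)" for K
  proof (induction K)
    case (add l K)
    show ?case by (auto intro!: derivative_eq_intros add.IH simp: )
  qed simp
  then show ?thesis by (simp add: N_affine_line htr_def)
qed

lemma N_affine_if_rank_one:
  assumes "hrk c e x \<le> 1"
  shows "N (cvec (e + t *\<^sub>R x)) = 1 + of_real (t * htr c e x)"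
proof -
  have "(\<Prod>l\<in>#K. (1 + t * l)) = 1 + t * sum_mset K" if "size (filter_mset (\<lambda>l. l \<noteq> 0) K) \<le> 1" for K
    using that
  proof (induction K)
    case (add l K)
    show ?case
    proof (cases "l = 0")
      case False
      then have "filter_mset (\<lambda>l. l \<noteq> 0) K = {#}" using add.prems by simp
      then have "set_mset (filter_mset (\<lambda>l. l \<noteq> 0) K) = {}" by (simp only: set_mset_empty)
      then have "\<forall>l\<in>#K. l = 0" by auto
      then have "(\<Prod>l\<in>#K. (1 + t * l)) = 1" "sum_mset K = 0"
        by (induction K) auto
      then show ?thesis by simp
    qed (use add in simp)
  qed simp
  then show ?thesis using assms by (simp add: N_affine_line hrk_def htr_def)
qed

end

subsection \<open>Finitely supported random vectors\<close>

context hyperbolic_polynomial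
begin

lemma open_pos_cone: "open {x. pos_cone x}"
  unfolding open_dist
proof (intro ballI, unfold mem_Collect_eq)
  fix x assume "pos_cone x"
  then obtain \<eta> where \<eta>: "\<eta> > 0" "pos_cone (x - \<eta> *\<^sub>R e)" using N.cone_open by blast
  obtain r where r: "r > 0" "\<And>h. norm h < r \<Longrightarrow> pos_cone (e + h)" using pos_cone_near_e by blast
  have "pos_cone y" if "dist y x < \<eta> * r" for y
  proof -
    have "norm ((1 / \<eta>) *\<^sub>R (y - x)) < r"
      unfolding norm_scaleR using that \<eta>(1) by (simp add: dist_norm divide_less_eq mult.commute)
    then have "pos_cone (\<eta> *\<^sub>R (e + (1 / \<eta>) *\<^sub>R (y - x)))"
      by (intro pos_cone_scale r(2) \<eta>(1))
    from pos_cone_add[OF \<eta>(2) this] show ?thesis using \<eta>(1) by (simp add: scaleR_add_right)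
  qed
  then show "\<exists>\<epsilon>>0. \<forall>y. dist y x < \<epsilon> \<longrightarrow> pos_cone y"
    using \<eta>(1) r(1) by (intro exI[of _ "\<eta> * r"]) auto
qed

text \<open>The event must be measurable, as \<open>measure\<close> is 0 by convention on other
  sets. The condition says that \<open>(\<rho> + 1 / (n + 1)) e - x\<close> is in the open cone for
  all \<open>n\<close>, a countable intersection of open sets.\<close>

lemma lambda_max_le_borel:
  assumes "d \<ge> 1"
  shows "{x. lambda_max c e x \<le> \<rho>} \<in> sets borel"
proof -
  have nz: "peval c x \<noteq> 0 \<longleftrightarrow> N (cvec x) \<noteq> 0" for x using peval_e by (simp add: N_cvec)
  have "lambda_max c e x \<le> \<rho> \<longleftrightarrow> (\<forall>n. pos_cone ((\<rho> + inverse (real (Suc n))) *\<^sub>R e - x))" for x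
  proof
    assume "lambda_max c e x \<le> \<rho>"
    then have *: "N (cvec (t *\<^sub>R e - x)) \<noteq> 0" if "t > \<rho>" for t
      using lambda_max_le_iff[OF assms] that nz by auto
    have "N (cvec ((\<rho> + inverse (real (Suc n))) *\<^sub>R e - x + s *\<^sub>R e)) \<noteq> 0" if "s \<ge> 0" for n s
      using *[of "\<rho> + inverse (real (Suc n)) + s"] that
      by (simp add: scaleR_add_left algebra_simps add_nonneg_pos)
    then show "\<forall>n. pos_cone ((\<rho> + inverse (real (Suc n))) *\<^sub>R e - x)" by (simp add: N.cone_def)
  next
    assume *: "\<forall>n. pos_cone ((\<rho> + inverse (real (Suc n))) *\<^sub>R e - x)"
    have "N (cvec (t *\<^sub>R e - x)) \<noteq> 0" if t: "t > \<rho>" for t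
    proof -
      obtain n where n: "inverse (real (Suc n)) < t - \<rho>" using reals_Archimedean[of "t - \<rho>"] t by auto
      have "pos_cone ((\<rho> + inverse (real (Suc n))) *\<^sub>R e - x + (t - \<rho> - inverse (real (Suc n))) *\<^sub>R e)"
        using * n by (intro N.cone_add_e) auto
      moreover have "(\<rho> + inverse (real (Suc n))) *\<^sub>R e - x + (t - \<rho> - inverse (real (Suc n))) *\<^sub>R e = t *\<^sub>R e - x"
        by (simp add: algebra_simps)
      ultimately show ?thesis using N.cone_imp_ne_0 by metis
    qed
    then show "lambda_max c e x \<le> \<rho>" using lambda_max_le_iff[OF assms] nz by auto
  qed
  then have "{x. lambda_max c e x \<le> \<rho>} = (\<Inter>n. (\<lambda>x. (\<rho> + inverse (real (Suc n))) *\<^sub>R e - x) -` {x. pos_cone x})"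
    by auto
  moreover have "(\<lambda>x. t *\<^sub>R e - x) -` {x. pos_cone x} \<in> sets borel" for t
    by (intro borel_open open_vimage open_pos_cone continuous_intros)
  ultimately show ?thesis by auto
qed

end

context rank_one_family
begin

lemma htr_gradient:
  obtains f' where "bounded_linear f'" "\<And>x. f' x = htr c e x" "\<And>w. w \<in> W \<Longrightarrow> f' w = rank_one_trace w"
proof -
  interpret N': stable_family c d e W "\<lambda>z b. N z" by (rule stable_family_N)
  obtain f' where f': "bounded_linear f'"
    "\<And>u x s. x + s *\<^sub>R u = e \<Longrightarrow> ((\<lambda>t. N'.f (\<lambda>_. 0) (x + t *\<^sub>R u)) has_real_derivative f' u) (at s)"
    "\<And>w. w \<in> W \<Longrightarrow> f' w = N'.increment w (\<lambda>_. 0) e"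
    using N'.f_gradient[of e "\<lambda>_. 0"] by metis
  have "f' x = htr c e x" for x
    using f'(2)[of e 0 x] htr_derivative[of x] DERIV_unique unfolding N'.f_def by auto
  moreover have "f' w = rank_one_trace w" if "w \<in> W" for w
    using f'(3)[OF that] by (simp add: N'.increment_def N'.f_def rank_one_trace_def N_e)
  ultimately show ?thesis using that f'(1) by blast
qed

lemma htr_e: "htr c e e = d"
proof -
  have "N (cvec (e + t *\<^sub>R e)) = of_real ((1 + t) ^ d)" for t
  proof -
    have "cvec (e + t *\<^sub>R e) = of_real (1 + t) *s cvec e" by (simp add: vec_eq_iff algebra_simps)
    then show ?thesis by (simp only: N_hom N_e) simp
  qed
  then have "((\<lambda>t. (1 + t) ^ d) has_real_derivative htr c e e) (at 0)"
    using htr_derivative[of e] by simp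
  moreover have "((\<lambda>t::real. (1 + t) ^ d) has_real_derivative d) (at 0)"
    by (auto intro!: derivative_eq_intros)
  ultimately show ?thesis by (rule DERIV_unique)
qed

end

lemma (in prob_space)
  fixes Y :: "'a \<Rightarrow> 'b::{second_countable_topology, t2_space}" and g :: "'b \<Rightarrow> 'c::{banach, second_countable_topology}"
  assumes Y: "Y \<in> borel_measurable M" and S: "finite S" "AE \<omega> in M. Y \<omega> \<in> S"
    and g: "(\<lambda>\<omega>. g (Y \<omega>)) \<in> borel_measurable M"
  shows integrable_finite_support: "integrable M (\<lambda>\<omega>. g (Y \<omega>))"
    and expectation_finite_support:
      "(\<integral>\<omega>. g (Y \<omega>) \<partial>M) = (\<Sum>w\<in>S. prob {\<omega>\<in>space M. Y \<omega> = w} *\<^sub>R g w)"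
proof -
  define h where "h = (\<lambda>\<omega>. \<Sum>w\<in>S. indicat_real {\<omega>\<in>space M. Y \<omega> = w} \<omega> *\<^sub>R g w)"
  have ev: "{\<omega>\<in>space M. Y \<omega> = w} \<in> events" for w
  proof -
    have "Y -` {w} \<inter> space M \<in> events" by (rule measurable_sets[OF Y]) simp
    then show ?thesis by (simp add: vimage_def Int_def conj_commute)
  qed
  have int: "integrable M (\<lambda>\<omega>. indicat_real {\<omega>\<in>space M. Y \<omega> = w} \<omega> *\<^sub>R g w)" for w
    using ev by (intro integrable_scaleR_left) (auto simp: less_top[symmetric])
  have h: "integrable M h" unfolding h_def by (intro Bochner_Integration.integrable_sum int)
  have AE: "AE \<omega> in M. h \<omega> = g (Y \<omega>)"
    using S(2) AE_space
  proof eventually_elim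
    case (elim \<omega>)
    have "h \<omega> = (\<Sum>w\<in>S. if w = Y \<omega> then g w else 0)"
      unfolding h_def using elim(2) by (intro sum.cong) (auto simp: indicator_def)
    then show ?case using elim(1) S(1) by simp
  qed
  show "integrable M (\<lambda>\<omega>. g (Y \<omega>))"
    using h integrable_cong_AE[OF borel_measurable_integrable[OF h] g AE] by simp
  have "(\<integral>\<omega>. g (Y \<omega>) \<partial>M) = (\<integral>\<omega>. h \<omega> \<partial>M)"
    using h AE g by (intro integral_cong_AE) auto
  also have "\<dots> = (\<Sum>w\<in>S. prob {\<omega>\<in>space M. Y \<omega> = w} *\<^sub>R g w)"
    unfolding h_def using int ev
    by (simp add: Bochner_Integration.integral_sum less_top[symmetric] Int_absorb2 sets.sets_into_space)
  finally show "(\<integral>\<omega>. g (Y \<omega>) \<partial>M) = (\<Sum>w\<in>S. prob {\<omega>\<in>space M. Y \<omega> = w} *\<^sub>R g w)" .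
qed

theorem theorem5p1:
  fixes c :: "('n::finite \<Rightarrow> nat) \<Rightarrow> real" and d :: nat and e :: "real ^ 'n"
    and M :: "'w measure" and X :: "nat \<Rightarrow> 'w \<Rightarrow> real ^ 'n"
    and m :: nat and \<epsilon> :: real
  assumes hyp: "hyperbolic c d e" and deg: "d \<ge> 1"
    and ps: "prob_space M"
    and rv: "\<And>i. i < m \<Longrightarrow> X i \<in> borel_measurable M"
    and indep: "prob_space.indep_vars M (\<lambda>_. borel) X {..<m}"
    and fin: "\<And>i. i < m \<Longrightarrow> \<exists>S. finite S \<and> (AE \<omega> in M. X i \<omega> \<in> S)"
    and cone: "\<And>i. i < m \<Longrightarrow> AE \<omega> in M. X i \<omega> \<in> hcone c e"
    and rank: "\<And>i. i < m \<Longrightarrow> AE \<omega> in M. hrk c e (X i \<omega>) \<le> 1"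
    and mean: "integral\<^sup>L M (\<lambda>\<omega>. \<Sum>i<m. X i \<omega>) = e"
    and trace: "\<And>i. i < m \<Longrightarrow> htr c e (integral\<^sup>L M (X i)) \<le> \<epsilon>"
  shows "measure M {\<omega> \<in> space M. lambda_max c e (\<Sum>i<m. X i \<omega>) \<le> delta_bound \<epsilon> m} > 0"
proof -
  interpret prob_space M by (rule ps)
  interpret hyperbolic_polynomial c d e by unfold_locales (rule hyp)
  define W where "W = {w \<in> hcone c e. hrk c e w \<le> 1}"
  interpret rank_one_family c d e W
  proof
    show "psd w" if "w \<in> W" for w using that psd_if_hcone by (simp add: W_def)
    then show "affine_at w z" if "w \<in> W" for w z
      using that by (intro affine_at_everywhere[OF _ N_affine_if_rank_one]) (auto simp: W_def)
  qed
  \<comment> \<open>An empty sum would give \<open>e = 0\<close>, but \<open>N\<close> is 1 at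
    \<open>e\<close> and vanishes at 0 for \<open>d \<ge> 1\<close>.\<close>
  have m: "m \<ge> 1"
  proof (rule ccontr)
    assume "\<not> m \<ge> 1"
    then have "m = 0" by simp
    then have "e = 0" using mean by simp
    then have "N (0 *s cvec e) = 1" using N_e by simp
    then show False using deg by (simp only: N_hom) (simp add: power_0_left)
  qed
  obtain S0 where S0: "\<And>i. i < m \<Longrightarrow> finite (S0 i) \<and> (AE \<omega> in M. X i \<omega> \<in> S0 i)"
    using fin by metis
  define p where "p = (\<lambda>i w. prob {\<omega>\<in>space M. X i \<omega> = w})"
  \<comment> \<open>Points of mass 0 are dropped: conditions that hold almost everywhere are certain
    only at atoms, and the final product of masses must be positive.\<close>
  define S where "S = (\<lambda>i. {w\<in>S0 i. p i w \<noteq> 0})"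
  have ev: "{\<omega>\<in>space M. X i \<omega> = w} \<in> events" if "i < m" for i w
  proof -
    have "X i -` {w} \<inter> space M \<in> events" by (rule measurable_sets[OF rv[OF that]]) simp
    then show ?thesis by (simp add: vimage_def Int_def conj_commute)
  qed
  have null: "p i w = 0 \<longleftrightarrow> (AE \<omega> in M. X i \<omega> \<noteq> w)" if "i < m" for i w
    unfolding p_def by (rule prob_Collect_eq_0[OF ev[OF that]])
  have finS: "finite (S i)" if "i < m" for i using S0[OF that] by (simp add: S_def)
  have AE_S: "AE \<omega> in M. X i \<omega> \<in> S i" if i: "i < m" for i
  proof -
    have "AE \<omega> in M. \<forall>w\<in>{w\<in>S0 i. p i w = 0}. X i \<omega> \<noteq> w"
      using S0[OF i] null[OF i] by (intro AE_finite_allI) auto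
    moreover have "AE \<omega> in M. X i \<omega> \<in> S0 i" using S0[OF i] by simp
    ultimately show ?thesis by eventually_elim (auto simp: S_def)
  qed
  have SW: "S i \<subseteq> W" if i: "i < m" for i
  proof
    fix w assume w: "w \<in> S i"
    show "w \<in> W"
    proof (rule ccontr)
      assume "w \<notin> W"
      have "AE \<omega> in M. X i \<omega> \<noteq> w"
        using cone[OF i] rank[OF i] by eventually_elim (use \<open>w \<notin> W\<close> in \<open>auto simp: W_def\<close>)
      then show False using w null[OF i] by (simp add: S_def)
    qed
  qed
  have "sum (p i) (S i) = 1" if "i < m" for i
    using expectation_finite_support[OF rv[OF that] finS[OF that] AE_S[OF that], of "\<lambda>_. 1::real"]
    by (simp add: p_def prob_space)
  then have adm: "admissible S p {..<m}"
    using SW finS by (auto simp: admissible_def weights_def p_def)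
  have EX: "integral\<^sup>L M (X i) = weighted_mean S p i" if "i < m" for i
    using expectation_finite_support[OF rv[OF that] finS[OF that] AE_S[OF that], of "\<lambda>x. x"] rv[OF that]
    by (simp add: p_def weighted_mean_def)
  have int: "integrable M (X i)" if "i < m" for i
    using integrable_finite_support[OF rv[OF that] finS[OF that] AE_S[OF that], of "\<lambda>x. x"] rv[OF that] by simp
  have sum_mean: "(\<Sum>i<m. weighted_mean S p i) = e"
    using mean int EX by (simp add: Bochner_Integration.integral_sum)
  obtain f' where f': "bounded_linear f'" "\<And>x. f' x = htr c e x" "\<And>w. w \<in> W \<Longrightarrow> f' w = rank_one_trace w"
    using htr_gradient by metis
  interpret f': bounded_linear f' by (rule f'(1))
  have tr: "(\<Sum>w\<in>S i. p i w * rank_one_trace w) \<le> \<epsilon>" if i: "i < m" for i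
  proof -
    have "(\<Sum>w\<in>S i. p i w * rank_one_trace w) = f' (weighted_mean S p i)"
      using SW[OF i] f'(3) by (auto simp: weighted_mean_def f'.sum f'.scaleR intro!: sum.cong)
    then show ?thesis using trace[OF i] EX[OF i] f'(2) by simp
  qed
  \<comment> \<open>The trace is linear with \<open>tr(e) = d\<close>, so
    \<open>d \<le> m * \<epsilon>\<close>; with \<open>d \<ge> 1\<close> this is the lower bound on
    \<open>\<epsilon>\<close> in \<open>mean_cone_bound\<close>.\<close>
  have "real d = (\<Sum>i<m. f' (weighted_mean S p i))"
    using htr_e f'(2)[of e] by (simp add: f'.sum[symmetric] sum_mean)
  also have "\<dots> \<le> (\<Sum>i<m. \<epsilon>)"
    using trace EX f'(2) by (intro sum_mono) auto
  finally have "real d \<le> m * \<epsilon>" by simp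
  then have "1 \<le> m * \<epsilon>" using deg by linarith
  then have \<epsilon>: "\<epsilon> \<ge> 1 / m" using m by (simp add: field_simps)
  have "admissible S p (set [0..<m])" using adm by (simp add: atLeast0LessThan)
  then have "\<exists>\<kappa>. (\<forall>i\<in>set [0..<m]. \<kappa> i \<in> S i) \<and>
      (\<forall>t>delta_bound \<epsilon> m. N (cvec (t *\<^sub>R e - (\<Sum>i\<in>set [0..<m]. \<kappa> i))) \<noteq> 0)"
    by (rule realise_all) (use mean_cone_bound[OF adm m sum_mean tr \<epsilon>] in auto)
  then obtain \<kappa> where \<kappa>: "\<And>i. i < m \<Longrightarrow> \<kappa> i \<in> S i"
    "\<And>t. t > delta_bound \<epsilon> m \<Longrightarrow> N (cvec (t *\<^sub>R e - (\<Sum>i<m. \<kappa> i))) \<noteq> 0"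
    by (auto simp: atLeast0LessThan)
  have good: "lambda_max c e (\<Sum>i<m. \<kappa> i) \<le> delta_bound \<epsilon> m"
    using \<kappa>(2) by (auto simp: lambda_max_le_iff[OF deg] N_cvec)
  \<comment> \<open>The event that all vectors take the chosen values; independence makes its
    probability a product of positive masses.\<close>
  define A where "A = (\<Inter>i\<in>{..<m}. X i -` {\<kappa> i} \<inter> space M)"
  define B where "B = {\<omega> \<in> space M. lambda_max c e (\<Sum>i<m. X i \<omega>) \<le> delta_bound \<epsilon> m}"
  have "prob A = (\<Prod>i\<in>{..<m}. prob (X i -` {\<kappa> i} \<inter> space M))"
    unfolding A_def using m by (intro indep_varsD[OF indep]) (auto simp: lessThan_empty_iff)
  also have "\<dots> = (\<Prod>i<m. p i (\<kappa> i))"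
    by (simp add: p_def vimage_def Int_def conj_commute)
  also have "\<dots> > 0"
    using \<kappa>(1) by (intro prod_pos) (auto simp: S_def p_def zero_less_measure_iff)
  finally have "prob A > 0" .
  moreover have "A \<subseteq> B"
  proof
    fix \<omega> assume \<omega>: "\<omega> \<in> A"
    then have *: "\<omega> \<in> X i -` {\<kappa> i} \<inter> space M" if "i < m" for i
      using that unfolding A_def by blast
    have "\<omega> \<in> space M" "\<And>i. i < m \<Longrightarrow> X i \<omega> = \<kappa> i" using *[of 0] * m by auto
    then show "\<omega> \<in> B" using good by (simp add: B_def)
  qed
  moreover have "B \<in> events"
  proof -
    have "(\<lambda>\<omega>. \<Sum>i<m. X i \<omega>) \<in> borel_measurable M" using rv by (intro borel_measurable_sum) auto
    from measurable_sets[OF this lambda_max_le_borel[OF deg, of "delta_bound \<epsilon> m"]] show ?thesis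
      by (simp add: B_def vimage_def Int_def conj_commute)
  qed
  ultimately have "prob B > 0" using finite_measure_mono[of A B] by linarith
  then show ?thesis by (simp add: B_def)
qed

end
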